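(* Let $N$ be a submanifold of a conformal manifold $(M,c)$ with normal bundle $\nu$, let $\nabla$ be a Weyl structure on $M$ and $\nabla^N$ the induced Weyl structure on $N$. Denote by $\nabla^\perp$ the connection induced by $\nabla$ on $\nu$: $\nabla^\perp_X\xi:=(\nabla_X\xi)^\perp$ for $X\in TN$ and $\xi$ a section of $\nu$. Then $\nabla^\perp$ depends only on $\nabla^N$. Moreover, the connection $\nabla^{\perp,0}$ induced on the weightless normal bundle $\nu^0:=\nu\otimes L^{-1}$ depends only on the embedding of $N$ in the conformal manifold $(M,c)$. In particular, its curvature $\kappa\in\Lambda^2T^*N\otimes\mathrm{End}^{skew}(\nu)$ is a tensor that depends on the conformal embedding alone.
   Context: All objects are smooth. On an $m$-manifold $M$, for $k\in\mathbb R$, $L^k$ is the oriented real line bundle associated with the frame bundle and the representation $|\det|^{k/m}$. A conformal structure $c$ is a positive-definite section of $S^2T^*M\otimes L^2$, normalized by $|\det c|=1$; equivalently it is the conformal class of metrics $l^{-2}c$, for $l$ a positive section of $L$. A Weyl structure $\nabla$ on $(M,c)$ is a torsion-free connection on $TM$ with $\nabla c=0$, where $L$ carries the connection induced by $\nabla$. For a submanifold $N\subset M$ with the induced conformal structure, $TM|_N=TN\oplus\nu$ is the $c$-orthogonal splitting, with components denoted by $(\cdot)^N$ and $(\cdot)^\perp$; the Weyl structure induced by $\nabla$ on $N$ is $\nabla^N_XY:=(\nabla_XY)^N$. Along $N$, $L$ denotes $L_M|_N=L_N$, and $\nabla^{\perp,0}$ is the tensor product connection of $\nabla^\perp$ and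 the connection induced by $\nabla$ on $L^{-1}$. *)

theory Defs
  imports "HOL-Analysis.Analysis" "HOL-Library.Function_Algebras"
begin

text \<open>Fibres of the bundles below are sets of functions, with pointwise vector space operations.\<close>

instantiation "fun" :: (type, real_vector) real_vector
begin

definition scaleR_fun :: "real \<Rightarrow> ('a \<Rightarrow> 'b) \<Rightarrow> 'a \<Rightarrow> 'b" where
  "scaleR_fun r f = (\<lambda>x. r *\<^sub>R f x)"

instance
  by standard (simp_all add: scaleR_fun_def fun_eq_iff scaleR_add_right scaleR_add_left)

end


section \<open>Smooth manifolds\<close>

primrec C_k :: "nat \<Rightarrow> 'a::euclidean_space set \<Rightarrow> ('a \<Rightarrow> 'b::euclidean_space) \<Rightarrow> bool" where
  "C_k 0 S f \<longleftrightarrow> continuous_on S f"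
| "C_k (Suc k) S f \<longleftrightarrow>
     f differentiable_on S \<and> (\<forall>v. C_k k S (\<lambda>x. frechet_derivative f (at x) v))"

text \<open>Only meaningful for open \<open>S\<close>.\<close>

definition C_inf :: "'a::euclidean_space set \<Rightarrow> ('a \<Rightarrow> 'b::euclidean_space) \<Rightarrow> bool" where
  "C_inf S f \<longleftrightarrow> (\<forall>k. C_k k S f)"

text \<open>A chart is a pair of a domain and a map; the values of the map off the domain are irrelevant.
  The atlas need not be maximal.\<close>

type_synonym ('a, 'm) chart = "'a set \<times> ('a \<Rightarrow> real ^ 'm)"

record ('a, 'm::finite) mfd =
  mtop :: "'a topology"
  atlas :: "('a, 'm) chart set"

definition points :: "('a, 'm::finite) mfd \<Rightarrow> 'a set" where
  "points M = topspace (mtop M)"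

definition charts_at :: "('a, 'm::finite) mfd \<Rightarrow> 'a \<Rightarrow> ('a, 'm) chart set" where
  "charts_at M p = {\<phi> \<in> atlas M. p \<in> fst \<phi>}"

definition in_chart :: "('a, 'm::finite) chart \<Rightarrow> ('a \<Rightarrow> 'b) \<Rightarrow> real ^ 'm \<Rightarrow> 'b" where
  "in_chart \<phi> f = f \<circ> inv_into (fst \<phi>) (snd \<phi>)"

definition manifold :: "('a, 'm::finite) mfd \<Rightarrow> bool" where
  "manifold M \<longleftrightarrow>
     Hausdorff_space (mtop M) \<and> second_countable (mtop M) \<and>
     (\<Union>\<phi>\<in>atlas M. fst \<phi>) = points M \<and>
     (\<forall>\<phi>\<in>atlas M. openin (mtop M) (fst \<phi>) \<and> open (snd \<phi> ` fst \<phi>) \<and>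
        homeomorphic_map (subtopology (mtop M) (fst \<phi>)) (top_of_set (snd \<phi> ` fst \<phi>)) (snd \<phi>)) \<and>
     (\<forall>\<phi>\<in>atlas M. \<forall>\<psi>\<in>atlas M. C_inf (snd \<phi> ` (fst \<phi> \<inter> fst \<psi>)) (in_chart \<phi> (snd \<psi>)))"

definition smooth_fun ::
    "('a, 'm::finite) mfd \<Rightarrow> 'a set \<Rightarrow> ('a \<Rightarrow> 'b::euclidean_space) \<Rightarrow> bool" where
  "smooth_fun M V f \<longleftrightarrow> (\<forall>\<phi>\<in>atlas M. C_inf (snd \<phi> ` (fst \<phi> \<inter> V)) (in_chart \<phi> f))"


section \<open>Tangent vectors\<close>

text \<open>A tangent vector at \<open>p\<close> assigns to every chart around \<open>p\<close> a coordinate vector, these being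
  related by the differentials of the coordinate changes; it is set to 0 on all other charts.
  A vector does not remember its base point.\<close>

type_synonym ('a, 'm) tvec = "('a, 'm) chart \<Rightarrow> real ^ 'm"

definition tspace :: "('a, 'm::finite) mfd \<Rightarrow> 'a \<Rightarrow> ('a, 'm) tvec set" where
  "tspace M p = {v.
     (\<forall>\<phi>. \<phi> \<notin> charts_at M p \<longrightarrow> v \<phi> = 0) \<and>
     (\<forall>\<phi>\<in>charts_at M p. \<forall>\<psi>\<in>charts_at M p.
        v \<psi> = frechet_derivative (in_chart \<phi> (snd \<psi>)) (at (snd \<phi> p)) (v \<phi>))}"

text \<open>Derivative of \<open>f\<close> at \<open>p\<close> in the direction \<open>v \<in> tspace M p\<close>; it does not depend on the chart.\<close>

definition dd ::
    "('a, 'm::finite) mfd \<Rightarrow> 'a \<Rightarrow> ('a, 'm) tvec \<Rightarrow> ('a \<Rightarrow> 'b::real_normed_vector) \<Rightarrow> 'b" where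
  "dd M p v f = (let \<phi> = SOME \<phi>. \<phi> \<in> charts_at M p in
     frechet_derivative (in_chart \<phi> f) (at (snd \<phi> p)) (v \<phi>))"

text \<open>Differential at \<open>p\<close> of the inclusion of \<open>points N \<subseteq> points M\<close>.\<close>

definition dincl ::
    "('a, 'n::finite) mfd \<Rightarrow> ('a, 'm::finite) mfd \<Rightarrow> 'a \<Rightarrow> ('a, 'n) tvec \<Rightarrow> ('a, 'm) tvec" where
  "dincl N M p x = (\<lambda>\<psi>. if \<psi> \<in> charts_at M p then dd N p x (snd \<psi>) else 0)"

text \<open>Embedded submanifolds: subspace topology, and the inclusion is a smooth immersion.\<close>

definition submanifold :: "('a, 'n::finite) mfd \<Rightarrow> ('a, 'm::finite) mfd \<Rightarrow> bool" where
  "submanifold N M \<longleftrightarrow>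
     manifold N \<and> manifold M \<and> points N \<subseteq> points M \<and>
     mtop N = subtopology (mtop M) (points N) \<and>
     (\<forall>\<psi>\<in>atlas M. smooth_fun N (fst \<psi> \<inter> points N) (snd \<psi>)) \<and>
     (\<forall>p\<in>points N. inj_on (dincl N M p) (tspace N p))"

text \<open>Smooth sections over \<open>V\<close>, open in \<open>N\<close>, of the restriction of \<open>TM\<close> to \<open>N\<close>. The case \<open>N = M\<close>
  gives the vector fields on \<open>M\<close>. Below, \<open>N\<close> is always a submanifold of \<open>M\<close>, possibly \<open>M\<close> itself.\<close>

definition tfield ::
    "('a, 'n::finite) mfd \<Rightarrow> ('a, 'm::finite) mfd \<Rightarrow> 'a set \<Rightarrow> ('a \<Rightarrow> ('a, 'm) tvec) \<Rightarrow> bool" where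
  "tfield N M V s \<longleftrightarrow>
     openin (mtop N) V \<and> (\<forall>q\<in>V. s q \<in> tspace M q) \<and>
     (\<forall>\<psi>\<in>atlas M. smooth_fun N (V \<inter> fst \<psi>) (\<lambda>q. s q \<psi>))"

definition bracket ::
    "('a, 'm::finite) mfd \<Rightarrow> ('a \<Rightarrow> ('a, 'm) tvec) \<Rightarrow> ('a \<Rightarrow> ('a, 'm) tvec) \<Rightarrow> 'a \<Rightarrow> ('a, 'm) tvec" where
  "bracket M X Y p = (\<lambda>\<phi>. if \<phi> \<in> charts_at M p
     then dd M p (X p) (\<lambda>q. Y q \<phi>) - dd M p (Y p) (\<lambda>q. X q \<phi>) else 0)"


section \<open>Connections on the tangent bundle\<close>

text \<open>A connection acts on local vector fields: \<open>D p v s\<close> is the covariant derivative at \<open>p\<close> of a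
  field \<open>s\<close>, smooth on some neighbourhood of \<open>p\<close>, in the direction \<open>v\<close>. Compatibility with
  restriction to smaller neighbourhoods is the locality clause.\<close>

type_synonym ('a, 'n, 'm) cderiv =
  "'a \<Rightarrow> ('a, 'n) tvec \<Rightarrow> ('a \<Rightarrow> ('a, 'm) tvec) \<Rightarrow> ('a, 'm) tvec"

definition connection :: "('a, 'm::finite) mfd \<Rightarrow> ('a, 'm, 'm) cderiv \<Rightarrow> bool" where
  "connection M D \<longleftrightarrow>
     (\<forall>U s. tfield M M U s \<longrightarrow>
        (\<forall>p\<in>U. \<forall>v\<in>tspace M p.
           D p v s \<in> tspace M p \<and>
           (\<forall>w\<in>tspace M p. \<forall>a b. D p (a *\<^sub>R v + b *\<^sub>R w) s = a *\<^sub>R D p v s + b *\<^sub>R D p w s) \<and>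
           (\<forall>t. tfield M M U t \<longrightarrow> D p v (\<lambda>q. s q + t q) = D p v s + D p v t) \<and>
           (\<forall>f::'a \<Rightarrow> real. smooth_fun M U f \<longrightarrow>
              D p v (\<lambda>q. f q *\<^sub>R s q) = dd M p v f *\<^sub>R s p + f p *\<^sub>R D p v s) \<and>
           (\<forall>t. (\<forall>q\<in>U. s q = t q) \<longrightarrow> D p v s = D p v t)) \<and>
        (\<forall>X. tfield M M U X \<longrightarrow> tfield M M U (\<lambda>q. D q (X q) s)))"

definition torsion_free :: "('a, 'm::finite) mfd \<Rightarrow> ('a, 'm, 'm) cderiv \<Rightarrow> bool" where
  "torsion_free M D \<longleftrightarrow>
     (\<forall>U X Y. tfield M M U X \<and> tfield M M U Y \<longrightarrow>
        (\<forall>p\<in>U. D p (X p) Y - D p (Y p) X = bracket M X Y p))"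


section \<open>Frames and the density bundles\<close>

type_synonym ('a, 'm) frame = "'m \<Rightarrow> ('a, 'm) tvec"

definition frame_at :: "('a, 'm::finite) mfd \<Rightarrow> 'a \<Rightarrow> ('a, 'm) frame \<Rightarrow> bool" where
  "frame_at M p f \<longleftrightarrow>
     (\<forall>i. f i \<in> tspace M p) \<and>
     (\<forall>v\<in>tspace M p. \<exists>!a :: real ^ 'm. v = (\<Sum>i\<in>UNIV. a $ i *\<^sub>R f i))"

definition frame_coord :: "('a, 'm::finite) frame \<Rightarrow> ('a, 'm) tvec \<Rightarrow> real ^ 'm" where
  "frame_coord f v = (THE a. v = (\<Sum>i\<in>UNIV. a $ i *\<^sub>R f i))"

definition frame_act :: "('a, 'm::finite) frame \<Rightarrow> real ^ 'm ^ 'm \<Rightarrow> ('a, 'm) frame" where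
  "frame_act f A = (\<lambda>j. \<Sum>i\<in>UNIV. A $ i $ j *\<^sub>R f i)"

text \<open>\<open>L\<^sup>k\<close> is associated with the frame bundle and the representation \<open>\<rho> = \<bar>det\<bar> powr (k / m)\<close>.
  The class \<open>[f, v]\<close> is encoded as the equivariant function \<open>l\<close> on frames with \<open>l f = v\<close> and
  \<open>l (f A) = \<rho>(A)\<^sup>-\<^sup>1 l f\<close>. With values in \<open>E\<close> instead of the reals, these functions form the
  fibre of \<open>E \<otimes> L\<^sup>k\<close>. An element of \<open>L\<^sup>k\<close> is positive if its values on frames are.\<close>

definition weighted ::
    "('a, 'm::finite) mfd \<Rightarrow> real \<Rightarrow> 'a \<Rightarrow> 'v::real_vector set \<Rightarrow> (('a, 'm) frame \<Rightarrow> 'v) set" where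
  "weighted M k p E = {l.
     (\<forall>f. \<not> frame_at M p f \<longrightarrow> l f = 0) \<and>
     (\<forall>f. frame_at M p f \<longrightarrow> l f \<in> E) \<and>
     (\<forall>f A. frame_at M p f \<and> invertible A \<longrightarrow>
        l (frame_act f A) = \<bar>det A\<bar> powr (- (k / real CARD('m))) *\<^sub>R l f)}"

type_synonym ('a, 'm) density = "('a, 'm) frame \<Rightarrow> real"

definition density_space :: "('a, 'm::finite) mfd \<Rightarrow> real \<Rightarrow> 'a \<Rightarrow> ('a, 'm) density set" where
  "density_space M k p = weighted M k p (UNIV :: real set)"

definition frame_field ::
    "('a, 'n::finite) mfd \<Rightarrow> ('a, 'm::finite) mfd \<Rightarrow> 'a set \<Rightarrow> ('a \<Rightarrow> ('a, 'm) frame) \<Rightarrow> bool" where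
  "frame_field N M V e \<longleftrightarrow>
     (\<forall>i. tfield N M V (\<lambda>q. e q i)) \<and> (\<forall>q\<in>V. frame_at M q (e q))"

text \<open>Smooth sections over \<open>V\<close> of the restriction of \<open>L\<^sup>k\<close> to \<open>N\<close>.\<close>

definition dens_section ::
    "('a, 'n::finite) mfd \<Rightarrow> ('a, 'm::finite) mfd \<Rightarrow> real \<Rightarrow> 'a set \<Rightarrow> ('a \<Rightarrow> ('a, 'm) density) \<Rightarrow> bool"
  where
  "dens_section N M k V l \<longleftrightarrow>
     openin (mtop N) V \<and> (\<forall>q\<in>V. l q \<in> density_space M k q) \<and>
     (\<forall>W e. W \<subseteq> V \<and> frame_field N M W e \<longrightarrow> smooth_fun N W (\<lambda>q. l q (e q)))"

text \<open>Pull-back to \<open>N\<close> of a connection \<open>D\<close> on \<open>TM\<close>: if \<open>s = (\<Sum>i. a\<^sub>i e\<^sub>i)\<close> along \<open>N\<close> for a local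
  frame \<open>e\<close> of \<open>TM\<close>, then the derivative is \<open>\<Sum>i. x(a\<^sub>i) e\<^sub>i + a\<^sub>i D\<^sub>x e\<^sub>i\<close>, for every choice of \<open>e\<close>.\<close>

definition pull_conn ::
    "('a, 'n::finite) mfd \<Rightarrow> ('a, 'm::finite) mfd \<Rightarrow> ('a, 'm, 'm) cderiv \<Rightarrow> ('a, 'n, 'm) cderiv" where
  "pull_conn N M D p x s = (THE w. \<forall>W e. p \<in> W \<and> frame_field M M W e \<longrightarrow>
     w = (\<Sum>i\<in>UNIV. dd N p x (\<lambda>q. frame_coord (e q) (s q) $ i) *\<^sub>R e p i
                    + frame_coord (e p) (s p) $ i *\<^sub>R D p (dincl N M p x) (\<lambda>q. e q i)))"

text \<open>Connection on the restriction of \<open>L\<^sup>k\<close> to \<open>N\<close>, induced by a connection \<open>D\<close> on the restriction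
  of \<open>TM\<close> to \<open>N\<close>. If \<open>\<omega>\<close> is the connection matrix of \<open>D\<close> in a local frame \<open>e\<close>, the derivative of
  \<open>[e, \<lambda>]\<close> is \<open>[e, d\<lambda> + \<rho>\<^sub>*(\<omega>) \<lambda>]\<close>, where \<open>\<rho>\<^sub>*(\<omega>) = (k / m) tr \<omega>\<close>.\<close>

definition dens_conn ::
    "('a, 'n::finite) mfd \<Rightarrow> ('a, 'm::finite) mfd \<Rightarrow> real \<Rightarrow> ('a, 'n, 'm) cderiv \<Rightarrow>
     'a \<Rightarrow> ('a, 'n) tvec \<Rightarrow> ('a \<Rightarrow> ('a, 'm) density) \<Rightarrow> ('a, 'm) density" where
  "dens_conn N M k D p x l = (\<lambda>f. if frame_at M p f
     then THE r. \<forall>W e. p \<in> W \<and> frame_field N M W e \<and> e p = f \<longrightarrow>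
       r = dd N p x (\<lambda>q. l q (e q))
           + (k / real CARD('m)) * (\<Sum>j\<in>UNIV. frame_coord f (D p x (\<lambda>q. e q j)) $ j) * l p f
     else 0)"


section \<open>Conformal and Weyl structures\<close>

type_synonym ('a, 'm) conf = "'a \<Rightarrow> ('a, 'm) tvec \<Rightarrow> ('a, 'm) tvec \<Rightarrow> ('a, 'm) density"

text \<open>The determinant of \<open>c\<close> lies in the trivial line \<open>(\<Lambda>\<^sup>m T\<^sup>*)\<^sup>2 \<otimes> L\<^sup>2\<^sup>m\<close> and is computed in an
  arbitrary frame.\<close>

definition conformal_structure :: "('a, 'm::finite) mfd \<Rightarrow> ('a, 'm) conf \<Rightarrow> bool" where
  "conformal_structure M c \<longleftrightarrow>
     (\<forall>p\<in>points M.
        (\<forall>v\<in>tspace M p. \<forall>w\<in>tspace M p.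
           c p v w \<in> density_space M 2 p \<and> c p v w = c p w v \<and>
           (\<forall>u\<in>tspace M p. \<forall>a b. c p (a *\<^sub>R u + b *\<^sub>R v) w = a *\<^sub>R c p u w + b *\<^sub>R c p v w)) \<and>
        (\<forall>f. frame_at M p f \<longrightarrow>
           (\<forall>v\<in>tspace M p. v \<noteq> 0 \<longrightarrow> c p v v f > 0) \<and>
           \<bar>det (\<chi> i j. c p (f i) (f j) f)\<bar> = 1)) \<and>
     (\<forall>U X Y. tfield M M U X \<and> tfield M M U Y \<longrightarrow>
        dens_section M M 2 U (\<lambda>q. c q (X q) (Y q)))"

definition weyl_structure ::
    "('a, 'm::finite) mfd \<Rightarrow> ('a, 'm) conf \<Rightarrow> ('a, 'm, 'm) cderiv \<Rightarrow> bool" where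
  "weyl_structure M c D \<longleftrightarrow>
     connection M D \<and> torsion_free M D \<and>
     (\<forall>U X Y. tfield M M U X \<and> tfield M M U Y \<longrightarrow>
        (\<forall>p\<in>U. \<forall>v\<in>tspace M p.
           dens_conn M M 2 D p v (\<lambda>q. c q (X q) (Y q)) = c p (D p v X) (Y p) + c p (X p) (D p v Y)))"


section \<open>The normal bundle and the induced connections\<close>

definition normal_space ::
    "('a, 'n::finite) mfd \<Rightarrow> ('a, 'm::finite) mfd \<Rightarrow> ('a, 'm) conf \<Rightarrow> 'a \<Rightarrow> ('a, 'm) tvec set" where
  "normal_space N M c p = {\<xi> \<in> tspace M p. \<forall>x\<in>tspace N p. c p (dincl N M p x) \<xi> = 0}"

definition tan_part ::
    "('a, 'n::finite) mfd \<Rightarrow> ('a, 'm::finite) mfd \<Rightarrow> ('a, 'm) conf \<Rightarrow> 'a \<Rightarrow>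
     ('a, 'm) tvec \<Rightarrow> ('a, 'n) tvec" where
  "tan_part N M c p w =
     (THE x. x \<in> tspace N p \<and> (\<exists>\<xi>\<in>normal_space N M c p. w = dincl N M p x + \<xi>))"

definition nor_part ::
    "('a, 'n::finite) mfd \<Rightarrow> ('a, 'm::finite) mfd \<Rightarrow> ('a, 'm) conf \<Rightarrow> 'a \<Rightarrow>
     ('a, 'm) tvec \<Rightarrow> ('a, 'm) tvec" where
  "nor_part N M c p w =
     (THE \<xi>. \<xi> \<in> normal_space N M c p \<and> (\<exists>x\<in>tspace N p. w = dincl N M p x + \<xi>))"

definition normal_section ::
    "('a, 'n::finite) mfd \<Rightarrow> ('a, 'm::finite) mfd \<Rightarrow> ('a, 'm) conf \<Rightarrow> 'a set \<Rightarrow>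
     ('a \<Rightarrow> ('a, 'm) tvec) \<Rightarrow> bool" where
  "normal_section N M c V \<xi> \<longleftrightarrow> tfield N M V \<xi> \<and> (\<forall>q\<in>V. \<xi> q \<in> normal_space N M c q)"

definition induced_weyl ::
    "('a, 'n::finite) mfd \<Rightarrow> ('a, 'm::finite) mfd \<Rightarrow> ('a, 'm) conf \<Rightarrow>
     ('a, 'm, 'm) cderiv \<Rightarrow> ('a, 'n, 'n) cderiv" where
  "induced_weyl N M c D p x Y = tan_part N M c p (pull_conn N M D p x (\<lambda>q. dincl N M q (Y q)))"

definition normal_conn ::
    "('a, 'n::finite) mfd \<Rightarrow> ('a, 'm::finite) mfd \<Rightarrow> ('a, 'm) conf \<Rightarrow>
     ('a, 'm, 'm) cderiv \<Rightarrow> ('a, 'n, 'm) cderiv" where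
  "normal_conn N M c D p x \<xi> = nor_part N M c p (pull_conn N M D p x \<xi>)"

text \<open>The weightless normal bundle \<open>\<nu>\<^sup>0 = \<nu> \<otimes> L\<^sup>-\<^sup>1\<close>.\<close>

type_synonym ('a, 'm) wvec = "('a, 'm) frame \<Rightarrow> ('a, 'm) tvec"

definition wnormal_space ::
    "('a, 'n::finite) mfd \<Rightarrow> ('a, 'm::finite) mfd \<Rightarrow> ('a, 'm) conf \<Rightarrow> 'a \<Rightarrow> ('a, 'm) wvec set" where
  "wnormal_space N M c p = weighted M (- 1) p (normal_space N M c p)"

definition wnormal_section ::
    "('a, 'n::finite) mfd \<Rightarrow> ('a, 'm::finite) mfd \<Rightarrow> ('a, 'm) conf \<Rightarrow> 'a set \<Rightarrow>
     ('a \<Rightarrow> ('a, 'm) wvec) \<Rightarrow> bool" where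
  "wnormal_section N M c V \<eta> \<longleftrightarrow>
     openin (mtop N) V \<and> (\<forall>q\<in>V. \<eta> q \<in> wnormal_space N M c q) \<and>
     (\<forall>W e. W \<subseteq> V \<and> frame_field N M W e \<longrightarrow> tfield N M W (\<lambda>q. \<eta> q (e q)))"

definition tensor :: "('a, 'm) tvec \<Rightarrow> ('a, 'm::finite) density \<Rightarrow> ('a, 'm) wvec" where
  "tensor \<xi> l = (\<lambda>f. l f *\<^sub>R \<xi>)"

text \<open>Tensor product connection: \<open>L\<^sup>-\<^sup>1\<close> being a line bundle, every section of \<open>\<nu>\<^sup>0\<close> is locally of the
  form \<open>\<xi> \<otimes> l\<close>, and the value given by the product rule does not depend on the decomposition.\<close>

definition wnormal_conn ::
    "('a, 'n::finite) mfd \<Rightarrow> ('a, 'm::finite) mfd \<Rightarrow> ('a, 'm) conf \<Rightarrow> ('a, 'm, 'm) cderiv \<Rightarrow>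
     'a \<Rightarrow> ('a, 'n) tvec \<Rightarrow> ('a \<Rightarrow> ('a, 'm) wvec) \<Rightarrow> ('a, 'm) wvec" where
  "wnormal_conn N M c D p x \<eta> = (THE r. \<forall>V \<xi> l.
     p \<in> V \<and> normal_section N M c V \<xi> \<and> dens_section N M (- 1) V l \<and>
     (\<forall>q\<in>V. \<eta> q = tensor (\<xi> q) (l q)) \<longrightarrow>
       r = tensor (normal_conn N M c D p x \<xi>) (l p)
           + tensor (\<xi> p) (dens_conn N M (- 1) (pull_conn N M D) p x l))"

definition curvature ::
    "('a, 'n::finite) mfd \<Rightarrow> ('a \<Rightarrow> ('a, 'n) tvec \<Rightarrow> ('a \<Rightarrow> 'v) \<Rightarrow> 'v::real_vector) \<Rightarrow>
     ('a \<Rightarrow> ('a, 'n) tvec) \<Rightarrow> ('a \<Rightarrow> ('a, 'n) tvec) \<Rightarrow> ('a \<Rightarrow> 'v) \<Rightarrow> 'a \<Rightarrow> 'v" where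
  "curvature N C X Y \<eta> p =
     C p (X p) (\<lambda>q. C q (Y q) \<eta>) - C p (Y p) (\<lambda>q. C q (X q) \<eta>) - C p (bracket N X Y p) \<eta>"

text \<open>Smooth sections of \<open>\<Lambda>\<^sup>2T\<^sup>*N \<otimes> End\<^sup>s\<^sup>k\<^sup>e\<^sup>w(\<nu>)\<close>.\<close>

definition skew_normal_two_form ::
    "('a, 'n::finite) mfd \<Rightarrow> ('a, 'm::finite) mfd \<Rightarrow> ('a, 'm) conf \<Rightarrow>
     ('a \<Rightarrow> ('a, 'n) tvec \<Rightarrow> ('a, 'n) tvec \<Rightarrow> ('a, 'm) tvec \<Rightarrow> ('a, 'm) tvec) \<Rightarrow> bool" where
  "skew_normal_two_form N M c \<kappa> \<longleftrightarrow>
     (\<forall>p\<in>points N. \<forall>x\<in>tspace N p. \<forall>y\<in>tspace N p. \<forall>\<xi>\<in>normal_space N M c p.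
        \<kappa> p x y \<xi> \<in> normal_space N M c p \<and>
        \<kappa> p x y \<xi> = - \<kappa> p y x \<xi> \<and>
        (\<forall>z\<in>tspace N p. \<forall>a b. \<kappa> p (a *\<^sub>R x + b *\<^sub>R z) y \<xi> = a *\<^sub>R \<kappa> p x y \<xi> + b *\<^sub>R \<kappa> p z y \<xi>) \<and>
        (\<forall>\<zeta>\<in>normal_space N M c p.
           (\<forall>a b. \<kappa> p x y (a *\<^sub>R \<xi> + b *\<^sub>R \<zeta>) = a *\<^sub>R \<kappa> p x y \<xi> + b *\<^sub>R \<kappa> p x y \<zeta>) \<and>
           c p (\<kappa> p x y \<xi>) \<zeta> + c p \<xi> (\<kappa> p x y \<zeta>) = 0)) \<and>
     (\<forall>V X Y \<xi>. tfield N N V X \<and> tfield N N V Y \<and> normal_section N M c V \<xi> \<longrightarrow>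
        normal_section N M c V (\<lambda>q. \<kappa> q (X q) (Y q) (\<xi> q)))"

end

theory Submission
  imports Defs
begin

text \<open>In a chart \<open>\<psi>\<close> of \<open>M\<close> the coordinate frame trivialises \<open>L\<close>, so \<open>c\<close> becomes a metric \<open>g\<close> and a Weyl structure
  \<open>D\<close> becomes \<open>d + \<Gamma>\<close>, where \<open>\<Gamma> - \<tau>\<close> is metric for \<open>\<tau> = tr \<Gamma> / m\<close>. By Koszul's argument two Weyl
  structures differ by \<open>S\<close> with
  \<open>g(S\<^sub>u v, w) = \<delta>(u) g(v, w) + \<delta>(v) g(u, w) - \<delta>(w) g(u, v)\<close>, where \<open>\<delta> = tr S / m\<close>. For tangential \<open>u\<close> and
  normal \<open>v\<close> the normal part of \<open>S\<^sub>u v\<close> is \<open>\<delta>(u) v\<close>, which the change \<open>\<delta>\<close> of the connection on \<open>L\<close> cancels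
  in \<open>\<nu> \<otimes> L\<^sup>-\<^sup>1\<close>; and \<open>g(S\<^sub>u u, u) = \<delta>(u) g(u, u)\<close> shows that the induced Weyl structure determines
  \<open>\<delta>\<close> along \<open>N\<close>. On normal sections the connection is \<open>d + A\<close> for a matrix-valued form \<open>A\<close>, whose curvature
  \<open>dA + A \<and> A\<close> is tensorial, and it is skew because the connection preserves \<open>g\<close>.\<close>

section \<open>Calculus of smooth functions\<close>

text \<open>The obstacle is the form of the induced derivatives: the pulled-back connection, the
  density connection and the tensor product connection are definite descriptions over all frames, or
  all decompositions, near a point. Each is therefore computed in a fixed chart of \<open>M\<close>,
  where every frame or decomposition is seen to give the same value, before two Weyl structures are
  compared. No frame of the normal bundle is chosen: in a chart a normal section is a function to
  \<open>real ^ 'm\<close> fixed by a projection \<open>P\<close> that varies with the point, and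
  the derivative of \<open>P\<close> is absorbed into the matrix \<open>A\<close>. The curvature of
  the weightless bundle acts on the normal bundle itself because tensoring with a line does not
  change endomorphisms: one matrix acts on the values of a section in all frames. Tensoriality is
  not argued by linearity over functions; the curvature is written as an explicit bilinear
  expression in the components of the two vectors, and pointwise identities are read off from
  sections extending given vectors. If there is no Weyl structure at all, the form 0 serves.\<close>

lemma differentiable_on_open_at:
  assumes "open S"
  shows "f differentiable_on S \<longleftrightarrow> (\<forall>x\<in>S. f differentiable (at x))"
  by (simp add: differentiable_on_def at_within_open[OF _ assms])

lemma frechet_derivative_worksI:
  "f differentiable (at x) \<Longrightarrow> (f has_derivative frechet_derivative f (at x)) (at x)"
  by (simp add: frechet_derivative_works)

text \<open>The recursion uses derivatives \<open>at x\<close>, not within \<open>S\<close>;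
  openness of \<open>S\<close> lets agreement on \<open>S\<close> pass to these derivatives.\<close>

lemma C_k_cong:
  assumes "open S" "\<And>x. x \<in> S \<Longrightarrow> f x = g x"
  shows "C_k k S f \<longleftrightarrow> C_k k S g"
  using assms(2)
proof (induction k arbitrary: f g)
  case 0
  then show ?case by (simp cong: continuous_on_cong_simp)
next
  case (Suc k)
  have diff: "f differentiable_on S \<longleftrightarrow> g differentiable_on S"
  proof -
    have "q differentiable_on S" if p: "p differentiable_on S" and pq: "\<And>x. x \<in> S \<Longrightarrow> p x = q x" for p q :: "'a \<Rightarrow> 'b"
      unfolding differentiable_on_def differentiable_def
    proof
      fix x assume x: "x \<in> S"
      then obtain D where "(p has_derivative D) (at x within S)"
        using p unfolding differentiable_on_def differentiable_def by blast
      then have "(q has_derivative D) (at x within S)"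
        using x pq by (intro has_derivative_transform[of x S q p]) auto
      then show "\<exists>D. (q has_derivative D) (at x within S)" by blast
    qed
    from this[of f g] this[of g f] show ?thesis using Suc.prems by auto
  qed
  have "C_k k S (\<lambda>x. frechet_derivative f (at x) v) \<longleftrightarrow> C_k k S (\<lambda>x. frechet_derivative g (at x) v)"
    if "f differentiable_on S" for v
  proof (rule Suc.IH)
    fix x assume "x \<in> S"
    then show "frechet_derivative f (at x) v = frechet_derivative g (at x) v"
      using that assms(1) Suc.prems
      by (subst frechet_derivative_transform_within_open[of f x S g]) (simp_all add: differentiable_on_open_at)
  qed
  then show ?case using diff by auto
qed

lemma C_k_subset: "C_k k S f \<Longrightarrow> T \<subseteq> S \<Longrightarrow> C_k k T f"
proof (induction k arbitrary: f)
  case 0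
  then show ?case using continuous_on_subset[of S f T] by simp
next
  case (Suc k)
  then show ?case using differentiable_on_subset[of f S T] by simp
qed

lemma C_k_SucD: "C_k (Suc k) S f \<Longrightarrow> C_k k S f"
proof (induction k arbitrary: f)
  case 0
  then show ?case by (simp add: differentiable_imp_continuous_on)
next
  case (Suc k)
  have "C_k k S (\<lambda>x. frechet_derivative f (at x) v)" for v
    using Suc.prems C_k.simps(2)[of "Suc k" S f] by (intro Suc.IH) blast
  moreover have "f differentiable_on S" using Suc.prems by (simp only: C_k.simps)
  ultimately show ?case by simp
qed

lemma C_k_local:
  assumes "\<And>x. x \<in> S \<Longrightarrow> \<exists>T. open T \<and> x \<in> T \<and> C_k k T f"
  shows "C_k k S f"
  using assms
proof (induction k arbitrary: f)
  case 0
  then show ?case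
    by (auto simp: continuous_on_eq_continuous_within)
       (metis at_within_open continuous_at_imp_continuous_at_within continuous_within)
next
  case (Suc k)
  have "f differentiable_on S"
    unfolding differentiable_on_def
    by (metis C_k.simps(2) Suc.prems differentiable_at_withinI differentiable_on_open_at)
  moreover have "C_k k S (\<lambda>x. frechet_derivative f (at x) v)" for v
    by (rule Suc.IH) (use Suc.prems in fastforce)
  ultimately show ?case by simp
qed

lemma C_k_const: "C_k k S (\<lambda>x. c)"
  by (induction k arbitrary: c) auto

lemma C_k_add:
  assumes "open S" "C_k k S f" "C_k k S g"
  shows "C_k k S (\<lambda>x. f x + g x)"
  using assms(2,3)
proof (induction k arbitrary: f g)
  case 0
  then show ?case by (auto intro: continuous_on_add)
next
  case (Suc k)
  have "frechet_derivative (\<lambda>x. f x + g x) (at x) v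
      = frechet_derivative f (at x) v + frechet_derivative g (at x) v" if "x \<in> S" for x v
  proof -
    have "((\<lambda>x. f x + g x) has_derivative
        (\<lambda>v. frechet_derivative f (at x) v + frechet_derivative g (at x) v)) (at x)"
      using Suc.prems that assms(1)
      by (intro has_derivative_add) (simp_all add: differentiable_on_open_at frechet_derivative_worksI)
    then show ?thesis by (simp add: frechet_derivative_at[symmetric])
  qed
  then have "C_k k S (\<lambda>x. frechet_derivative (\<lambda>x. f x + g x) (at x) v)" for v
    using Suc.IH[of "\<lambda>x. frechet_derivative f (at x) v" "\<lambda>x. frechet_derivative g (at x) v"] Suc.prems
    by (subst C_k_cong[OF assms(1)]) auto
  then show ?case using Suc.prems by (auto intro: differentiable_on_add)
qed

lemma C_k_sum:
  assumes "open S" "\<And>i. i \<in> I \<Longrightarrow> C_k k S (f i)"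
  shows "C_k k S (\<lambda>x. \<Sum>i\<in>I. f i x)"
  using assms(2)
proof (induction I rule: infinite_finite_induct)
  case (insert i I)
  then show ?case using C_k_add[OF assms(1), of k "f i" "\<lambda>x. \<Sum>i\<in>I. f i x"] by simp
qed (simp_all add: C_k_const)

lemma C_k_linear:
  assumes "open S" "linear h" "C_k k S f"
  shows "C_k k S (\<lambda>x. h (f x))"
  using assms(3)
proof (induction k arbitrary: f)
  case 0
  then show ?case
    using assms(2) by (auto intro: linear_continuous_on_compose)
next
  case (Suc k)
  have deriv: "((\<lambda>x. h (f x)) has_derivative (\<lambda>v. h (frechet_derivative f (at x) v))) (at x)"
    if "x \<in> S" for x
    using Suc.prems that assms
    by (intro bounded_linear.has_derivative[of h])
       (simp_all add: differentiable_on_open_at frechet_derivative_worksI linear_conv_bounded_linear)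
  then have "C_k k S (\<lambda>x. frechet_derivative (\<lambda>x. h (f x)) (at x) v)" for v
    using Suc.IH[of "\<lambda>x. frechet_derivative f (at x) v"] Suc.prems
    by (subst C_k_cong[OF assms(1)]) (auto simp: frechet_derivative_at[OF deriv, symmetric])
  then show ?case
    using deriv assms(1) by (auto simp: differentiable_on_open_at intro: differentiableI)
qed

text \<open>The product rule yields products of one function with a derivative of the other.
  \<open>C_k_SucD\<close> lowers the order of the undifferentiated factor, so that the induction
  hypothesis covers both products.\<close>

lemma C_k_scaleR:
  fixes f :: "'a::euclidean_space \<Rightarrow> real"
  assumes "open S" "C_k k S f" "C_k k S g"
  shows "C_k k S (\<lambda>x. f x *\<^sub>R g x)"
  using assms(2,3)
proof (induction k arbitrary: f g)
  case 0
  then show ?case by (auto intro: continuous_on_scaleR)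
next
  case (Suc k)
  have deriv: "((\<lambda>x. f x *\<^sub>R g x) has_derivative
      (\<lambda>v. f x *\<^sub>R frechet_derivative g (at x) v + frechet_derivative f (at x) v *\<^sub>R g x)) (at x)"
    if "x \<in> S" for x
    using Suc.prems that assms(1)
    by (intro has_derivative_scaleR) (simp_all add: differentiable_on_open_at frechet_derivative_worksI)
  have "C_k k S (\<lambda>x. frechet_derivative (\<lambda>x. f x *\<^sub>R g x) (at x) v)" for v
  proof -
    have "C_k k S (\<lambda>x. f x *\<^sub>R frechet_derivative g (at x) v + frechet_derivative f (at x) v *\<^sub>R g x)"
      using Suc.prems C_k_SucD[of k S f] C_k_SucD[of k S g]
      by (intro C_k_add[OF assms(1)] Suc.IH) auto
    then show ?thesis
      by (subst C_k_cong[OF assms(1)]) (auto simp: frechet_derivative_at[OF deriv, symmetric])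
  qed
  then show ?case
    using deriv assms(1) by (auto simp: differentiable_on_open_at intro: differentiableI)
qed

text \<open>Turns a derivative in a direction that varies with the point into a sum of derivatives
  in fixed directions with varying coefficients; \<open>C_k\<close> speaks of fixed directions
  only.\<close>

lemma linear_eq_basis_sum:
  assumes "linear h"
  shows "h (v::'a::euclidean_space) = (\<Sum>b\<in>Basis. (v \<bullet> b) *\<^sub>R h b)"
proof -
  have "h v = h (\<Sum>b\<in>Basis. (v \<bullet> b) *\<^sub>R b)" by (simp add: euclidean_representation)
  then show ?thesis by (simp only: linear_sum[OF assms] linear_cmul[OF assms])
qed

text \<open>By the chain rule the outer derivative is evaluated in the moving direction
  \<open>g'(x) v\<close>. Expanding this direction in the basis leaves compositions of fixed
  directional derivatives of \<open>f\<close> with \<open>g\<close>, which the induction hypothesis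
  covers.\<close>

lemma C_k_compose:
  assumes "open S" "open T" "g ` S \<subseteq> T" "C_k k T f" "C_k k S g"
  shows "C_k k S (\<lambda>x. f (g x))"
  using assms(4,5)
proof (induction k arbitrary: f)
  case 0
  then show ?case
    using assms(3) by (auto intro: continuous_on_compose2)
next
  case (Suc k)
  let ?D = "frechet_derivative"
  have der: "((\<lambda>x. f (g x)) has_derivative (\<lambda>v. ?D f (at (g x)) (?D g (at x) v))) (at x)"
    if "x \<in> S" for x
  proof (rule has_derivative_compose[of g])
    show "(g has_derivative ?D g (at x)) (at x)"
      using Suc.prems that assms(1) by (simp add: differentiable_on_open_at frechet_derivative_worksI)
    have "g x \<in> T" using assms(3) that by auto
    then show "(f has_derivative ?D f (at (g x))) (at (g x))"
      using Suc.prems assms(2) by (simp add: differentiable_on_open_at frechet_derivative_worksI)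
  qed
  have "?D (\<lambda>x. f (g x)) (at x) v = (\<Sum>b\<in>Basis. (?D g (at x) v \<bullet> b) *\<^sub>R ?D f (at (g x)) b)"
    if "x \<in> S" for x v
  proof -
    have "linear (?D f (at (g x)))"
      using Suc.prems that assms(1-3)
      by (intro linear_frechet_derivative) (auto simp: differentiable_on_open_at)
    then show ?thesis
      unfolding frechet_derivative_at[OF der[OF that], symmetric] by (rule linear_eq_basis_sum)
  qed
  moreover have "C_k k S (\<lambda>x. \<Sum>b\<in>Basis. (?D g (at x) v \<bullet> b) *\<^sub>R ?D f (at (g x)) b)" for v
  proof (intro C_k_sum C_k_scaleR assms(1))
    fix b :: 'b
    show "C_k k S (\<lambda>x. ?D g (at x) v \<bullet> b)"
      using Suc.prems
      by (intro C_k_linear[OF assms(1), of "\<lambda>y. y \<bullet> b" k "\<lambda>x. ?D g (at x) v"])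
         (auto intro: linearI simp: inner_add_left)
    show "C_k k S (\<lambda>x. ?D f (at (g x)) b)"
      using Suc.prems C_k_SucD[of k S g] by (intro Suc.IH) auto
  qed
  ultimately have "C_k k S (\<lambda>x. ?D (\<lambda>x. f (g x)) (at x) v)" for v
    by (subst C_k_cong[OF assms(1)]) auto
  then show ?case
    using der assms(1) by (auto simp: differentiable_on_open_at intro: differentiableI)
qed

lemma C_infD: "C_inf S f \<Longrightarrow> f differentiable_on S"
  unfolding C_inf_def using C_k.simps(2)[of 0 S f] by simp

lemma C_inf_differentiable: "C_inf S f \<Longrightarrow> open S \<Longrightarrow> x \<in> S \<Longrightarrow> f differentiable (at x)"
  using C_infD[of S f] by (simp add: differentiable_on_open_at)

lemma C_inf_frechet: "C_inf S f \<Longrightarrow> C_inf S (\<lambda>x. frechet_derivative f (at x) v)"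
  unfolding C_inf_def using C_k.simps(2)[of _ S f] by simp

lemma C_inf_subset: "C_inf S f \<Longrightarrow> T \<subseteq> S \<Longrightarrow> C_inf T f"
  unfolding C_inf_def using C_k_subset[of _ S f T] by blast

lemma C_inf_cong: "open S \<Longrightarrow> (\<And>x. x \<in> S \<Longrightarrow> f x = g x) \<Longrightarrow> C_inf S f \<longleftrightarrow> C_inf S g"
  using C_k_cong[of S f g] by (simp add: C_inf_def)

lemma C_inf_local:
  "(\<And>x. x \<in> S \<Longrightarrow> \<exists>T. open T \<and> x \<in> T \<and> C_inf T f) \<Longrightarrow> C_inf S f"
  unfolding C_inf_def by (intro allI C_k_local) blast

lemma C_inf_const: "C_inf S (\<lambda>x. c)"
  by (simp add: C_inf_def C_k_const)

lemma C_inf_add: "open S \<Longrightarrow> C_inf S f \<Longrightarrow> C_inf S g \<Longrightarrow> C_inf S (\<lambda>x. f x + g x)"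
  by (simp add: C_inf_def C_k_add)

lemma C_inf_sum: "open S \<Longrightarrow> (\<And>i. i \<in> I \<Longrightarrow> C_inf S (f i)) \<Longrightarrow> C_inf S (\<lambda>x. \<Sum>i\<in>I. f i x)"
  by (simp add: C_inf_def C_k_sum)

lemma C_inf_linear: "open S \<Longrightarrow> linear h \<Longrightarrow> C_inf S f \<Longrightarrow> C_inf S (\<lambda>x. h (f x))"
  unfolding C_inf_def using C_k_linear[of S h _ f] by blast

lemma C_inf_scaleR:
  fixes f :: "'a::euclidean_space \<Rightarrow> real"
  shows "open S \<Longrightarrow> C_inf S f \<Longrightarrow> C_inf S g \<Longrightarrow> C_inf S (\<lambda>x. f x *\<^sub>R g x)"
  by (simp add: C_inf_def C_k_scaleR)

lemma C_inf_compose: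
  "open S \<Longrightarrow> open T \<Longrightarrow> g ` S \<subseteq> T \<Longrightarrow> C_inf T f \<Longrightarrow> C_inf S g \<Longrightarrow> C_inf S (\<lambda>x. f (g x))"
  unfolding C_inf_def using C_k_compose[of S T g _ f] by blast

lemma C_inf_ident: "open S \<Longrightarrow> C_inf S (\<lambda>x. x)"
proof -
  have "C_k k S (\<lambda>x. x)" for k
    by (cases k) (auto simp: C_k_const intro: differentiable_on_ident)
  then show ?thesis by (simp add: C_inf_def)
qed

text \<open>The derivative is a constant multiple of a power with exponent \<open>a - 1\<close>,
  hence the induction over all exponents at once.\<close>

lemma C_inf_powr: "C_inf {0<..} (\<lambda>x::real. x powr a)"
proof -
  have der: "((\<lambda>x::real. x powr a) has_derivative (\<lambda>v. v * (a * x powr (a - 1)))) (at x)"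
    if "x > 0" for x a
    using that by (auto intro!: derivative_eq_intros simp: powr_diff field_simps)
  have "C_k k {0<..} (\<lambda>x::real. x powr a)" for k
  proof (induction k arbitrary: a)
    case 0
    then show ?case by (auto intro!: continuous_intros)
  next
    case (Suc k)
    have "C_k k {0<..} (\<lambda>x::real. (v * a) *\<^sub>R x powr (a - 1))" for v
      by (intro C_k_scaleR C_k_const Suc.IH) auto
    moreover have "C_k k {0<..} (\<lambda>x. frechet_derivative (\<lambda>x. x powr a) (at x) v)
        \<longleftrightarrow> C_k k {0<..} (\<lambda>x. (v * a) *\<^sub>R x powr (a - 1))" for v
      by (rule C_k_cong) (simp_all add: frechet_derivative_at[OF der, symmetric])
    ultimately have "C_k k {0<..} (\<lambda>x. frechet_derivative (\<lambda>x. x powr a) (at x) v)" for v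
      by blast
    then show ?case
      using der by (auto simp: differentiable_on_open_at intro: differentiableI)
  qed
  then show ?thesis by (simp add: C_inf_def)
qed

text \<open>The identity \<open>inverse y = y * (y * y) powr (-1)\<close> reduces both signs of
  \<open>y\<close> to a power of a positive number.\<close>

lemma C_inf_inverse: "C_inf (- {0}) (\<lambda>x::real. inverse x)"
proof (rule C_inf_local)
  fix x :: real assume x: "x \<in> - {0}"
  have sq: "C_inf T (\<lambda>x::real. (x *\<^sub>R x) powr (-1))" if "open T" "0 \<notin> T" for T
  proof (rule C_inf_compose[OF that(1) _ _ C_inf_powr])
    show "(\<lambda>x. x *\<^sub>R x) ` T \<subseteq> {0<..}"
      using that(2) by (auto simp: zero_less_mult_iff neq_iff) (metis linorder_neqE_linordered_idom)
  qed (intro that C_inf_scaleR C_inf_ident open_greaterThan)+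
  have "inverse y = y *\<^sub>R ((y *\<^sub>R y) powr (-1))" if "y \<noteq> 0" for y :: real
    using that by (simp add: powr_minus field_simps)
  then have "C_inf (-{0}) (\<lambda>x::real. inverse x) \<longleftrightarrow> C_inf (-{0}) (\<lambda>y::real. y *\<^sub>R ((y *\<^sub>R y) powr (-1)))"
    by (intro C_inf_cong) auto
  also have \<dots>
    by (intro C_inf_scaleR C_inf_ident sq) auto
  finally show "\<exists>T. open T \<and> x \<in> T \<and> C_inf T (inverse :: real \<Rightarrow> real)"
    using x by (intro exI[of _ "- {0}"]) auto
qed

section \<open>Symmetry of second derivatives\<close>

lemma second_difference_mean_value:
  fixes f :: "'a::euclidean_space \<Rightarrow> real"
  assumes S: "open S" and f: "f differentiable_on S"
    and fv: "(\<lambda>x. frechet_derivative f (at x) v) differentiable_on S"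
    and "0 < h" and seg: "\<And>s t. 0 \<le> s \<Longrightarrow> s \<le> h \<Longrightarrow> 0 \<le> t \<Longrightarrow> t \<le> h \<Longrightarrow> a + s *\<^sub>R v + t *\<^sub>R w \<in> S"
  shows "\<exists>s t. 0 < s \<and> s < h \<and> 0 < t \<and> t < h \<and>
    f (a + h *\<^sub>R v + h *\<^sub>R w) - f (a + h *\<^sub>R v) - f (a + h *\<^sub>R w) + f a
      = h * h * frechet_derivative (\<lambda>x. frechet_derivative f (at x) v) (at (a + s *\<^sub>R v + t *\<^sub>R w)) w"
proof -
  let ?fv = "\<lambda>x. frechet_derivative f (at x) v"
  have curve: "((\<lambda>s. F (b + s *\<^sub>R u)) has_real_derivative frechet_derivative F (at (b + s *\<^sub>R u)) u) (at s)"
    if "F differentiable_on S" "b + s *\<^sub>R u \<in> S" for F :: "'a \<Rightarrow> real" and b u s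
  proof -
    have F: "(F has_derivative frechet_derivative F (at (b + s *\<^sub>R u))) (at (b + s *\<^sub>R u))"
      using that S by (simp add: differentiable_on_open_at frechet_derivative_worksI)
    have "((\<lambda>s. F (b + s *\<^sub>R u)) has_derivative (\<lambda>r. frechet_derivative F (at (b + s *\<^sub>R u)) (r *\<^sub>R u))) (at s)"
      by (rule has_derivative_compose[where g = F and f = "\<lambda>s. b + s *\<^sub>R u", OF _ F])
         (auto intro!: derivative_eq_intros)
    then show ?thesis
      unfolding has_field_derivative_def
      using linear_cmul[OF has_derivative_linear[OF F]] by (simp add: mult_commute_abs)
  qed
  \<comment> \<open>The mean value theorem is applied along \<open>v\<close> to the difference of
    the values of \<open>f\<close> at points shifted by \<open>h w\<close>, and below along
    \<open>w\<close> to the derivative so obtained.\<close>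
  have "\<exists>s. 0 < s \<and> s < h \<and>
      (f (a + h *\<^sub>R w + h *\<^sub>R v) - f (a + h *\<^sub>R v)) - (f (a + h *\<^sub>R w + 0 *\<^sub>R v) - f (a + 0 *\<^sub>R v))
      = (h - 0) * (?fv (a + h *\<^sub>R w + s *\<^sub>R v) - ?fv (a + s *\<^sub>R v))"
  proof (rule MVT2[OF \<open>0 < h\<close>])
    fix s assume "0 \<le> s" "s \<le> h"
    then show "((\<lambda>s. f (a + h *\<^sub>R w + s *\<^sub>R v) - f (a + s *\<^sub>R v)) has_real_derivative
        ?fv (a + h *\<^sub>R w + s *\<^sub>R v) - ?fv (a + s *\<^sub>R v)) (at s)"
      using seg[of s h] seg[of s 0] \<open>0 < h\<close>
      by (intro DERIV_diff curve f) (auto simp: algebra_simps)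
  qed
  then obtain s where s: "0 < s" "s < h" and eq1:
    "f (a + h *\<^sub>R w + h *\<^sub>R v) - f (a + h *\<^sub>R v) - f (a + h *\<^sub>R w) + f a
      = h * (?fv (a + h *\<^sub>R w + s *\<^sub>R v) - ?fv (a + s *\<^sub>R v))"
    by force
  have "\<exists>t. 0 < t \<and> t < h \<and> ?fv (a + s *\<^sub>R v + h *\<^sub>R w) - ?fv (a + s *\<^sub>R v + 0 *\<^sub>R w)
      = (h - 0) * frechet_derivative ?fv (at (a + s *\<^sub>R v + t *\<^sub>R w)) w"
    using seg s by (intro MVT2[OF \<open>0 < h\<close>] curve fv) auto
  then obtain t where t: "0 < t" "t < h" and eq2: "?fv (a + s *\<^sub>R v + h *\<^sub>R w) - ?fv (a + s *\<^sub>R v)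
      = h * frechet_derivative ?fv (at (a + s *\<^sub>R v + t *\<^sub>R w)) w"
    by auto
  have "a + h *\<^sub>R w + h *\<^sub>R v = a + h *\<^sub>R v + h *\<^sub>R w" "a + h *\<^sub>R w + s *\<^sub>R v = a + s *\<^sub>R v + h *\<^sub>R w"
    by (simp_all add: add_ac)
  with eq1 eq2 s t show ?thesis by (intro exI[of _ s] exI[of _ t]) (simp add: algebra_simps)
qed

text \<open>The second difference is symmetric in \<open>v\<close> and \<open>w\<close>, so its two
  mean value expressions show that the two mixed derivatives agree at a pair of points close to
  \<open>a\<close>; continuity carries this to \<open>a\<close> up to any \<open>e\<close>.\<close>

lemma second_derivative_symmetric_real:
  fixes f :: "'a::euclidean_space \<Rightarrow> real"
  assumes S: "open S" "C_inf S f" "a \<in> S"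
  shows "frechet_derivative (\<lambda>x. frechet_derivative f (at x) v) (at a) w
       = frechet_derivative (\<lambda>x. frechet_derivative f (at x) w) (at a) v" (is "?A a = ?B a")
proof -
  have cont: "isCont ?A a" "isCont ?B a"
    using C_inf_frechet[OF C_inf_frechet[OF S(2)]] S
    by (metis C_infD differentiable_imp_continuous_on continuous_on_eq_continuous_at)+
  have "\<bar>?A a - ?B a\<bar> \<le> e" if "e > 0" for e
  proof -
    obtain d where d: "d > 0" "\<And>x. dist x a < d \<Longrightarrow> \<bar>?A x - ?A a\<bar> < e/2 \<and> \<bar>?B x - ?B a\<bar> < e/2 \<and> x \<in> S"
    proof -
      obtain d1 where 1: "d1 > 0" "\<And>x. dist x a < d1 \<Longrightarrow> \<bar>?A x - ?A a\<bar> < e/2"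
        using cont(1) \<open>e > 0\<close> unfolding continuous_at_eps_delta dist_real_def by (meson half_gt_zero)
      obtain d2 where 2: "d2 > 0" "\<And>x. dist x a < d2 \<Longrightarrow> \<bar>?B x - ?B a\<bar> < e/2"
        using cont(2) \<open>e > 0\<close> unfolding continuous_at_eps_delta dist_real_def by (meson half_gt_zero)
      obtain d3 where 3: "d3 > 0" "\<And>x. dist x a < d3 \<Longrightarrow> x \<in> S"
        using S open_dist by metis
      show ?thesis using 1 2 3 that[of "min d1 (min d2 d3)"] by simp
    qed
    \<comment> \<open>With this side length the whole parallelogram spanned by \<open>h v\<close>
      and \<open>h w\<close> stays within \<open>d / 2\<close> of \<open>a\<close>; the summand 1
      keeps the denominator positive.\<close>
    define h where "h = d / (2 * (norm v + norm w + 1))"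
    have n: "norm v + norm w + 1 > 0" by (simp add: add_nonneg_pos)
    then have h: "h > 0" using d(1) by (simp add: h_def)
    have near: "dist (a + s *\<^sub>R v + t *\<^sub>R w) a < d" if "0 \<le> s" "s \<le> h" "0 \<le> t" "t \<le> h" for s t
    proof -
      have "dist (a + s *\<^sub>R v + t *\<^sub>R w) a = norm (s *\<^sub>R v + t *\<^sub>R w)"
        by (simp add: dist_norm algebra_simps)
      also have "\<dots> \<le> s * norm v + t * norm w"
        using that by (metis abs_of_nonneg norm_scaleR norm_triangle_ineq)
      also have "\<dots> \<le> h * norm v + h * norm w"
        using that by (intro add_mono mult_right_mono) auto
      also have "\<dots> \<le> h * (norm v + norm w + 1)" using h by (simp add: algebra_simps)
      also have "\<dots> = d / 2" using n by (simp add: h_def divide_simps)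
      finally show ?thesis using d(1) by simp
    qed
    have fd: "f differentiable_on S" "(\<lambda>x. frechet_derivative f (at x) u) differentiable_on S" for u
      using S by (auto intro: C_infD C_inf_frechet)
    have near': "a + s *\<^sub>R w + t *\<^sub>R v \<in> S" if "0 \<le> s" "s \<le> h" "0 \<le> t" "t \<le> h" for s t
      using near[of t s] that d(2) by (metis add.assoc add.commute)
    obtain s t where st: "0 < s" "s < h" "0 < t" "t < h"
      "f (a + h *\<^sub>R v + h *\<^sub>R w) - f (a + h *\<^sub>R v) - f (a + h *\<^sub>R w) + f a = h * h * ?A (a + s *\<^sub>R v + t *\<^sub>R w)"
      using second_difference_mean_value[OF S(1) fd h, of a v w] near d(2) by auto
    obtain s' t' where st': "0 < s'" "s' < h" "0 < t'" "t' < h"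
      "f (a + h *\<^sub>R w + h *\<^sub>R v) - f (a + h *\<^sub>R w) - f (a + h *\<^sub>R v) + f a = h * h * ?B (a + s' *\<^sub>R w + t' *\<^sub>R v)"
      using second_difference_mean_value[OF S(1) fd h near'] by auto
    have "h * h * ?A (a + s *\<^sub>R v + t *\<^sub>R w) = h * h * ?B (a + s' *\<^sub>R w + t' *\<^sub>R v)"
      using st(5) st'(5) by (simp add: algebra_simps)
    then have "?A (a + s *\<^sub>R v + t *\<^sub>R w) = ?B (a + s' *\<^sub>R w + t' *\<^sub>R v)" using h by simp
    moreover have "\<bar>?A (a + s *\<^sub>R v + t *\<^sub>R w) - ?A a\<bar> < e/2"
      using near[of s t] st d(2) by auto
    moreover have "\<bar>?B (a + s' *\<^sub>R w + t' *\<^sub>R v) - ?B a\<bar> < e/2"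
      using near[of t' s'] st' d(2) by (simp add: algebra_simps)
    ultimately show ?thesis by linarith
  qed
  then show ?thesis
    by (metis abs_ge_zero abs_le_zero_iff field_le_epsilon add_0 eq_iff_diff_eq_0)
qed

lemma frechet_derivative_linear_image:
  fixes f :: "'a::real_normed_vector \<Rightarrow> 'b::euclidean_space"
  assumes "linear h" "f differentiable (at x)"
  shows "frechet_derivative (\<lambda>x. h (f x)) (at x) v = h (frechet_derivative f (at x) v)"
proof -
  have "((\<lambda>x. h (f x)) has_derivative (\<lambda>v. h (frechet_derivative f (at x) v))) (at x)"
    using assms by (intro bounded_linear.has_derivative[of h])
      (simp_all add: frechet_derivative_worksI linear_conv_bounded_linear)
  then show ?thesis by (simp add: frechet_derivative_at[symmetric])
qed

lemma second_derivative_symmetric: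
  fixes f :: "'a::euclidean_space \<Rightarrow> 'b::euclidean_space"
  assumes S: "open S" "C_inf S f" "a \<in> S"
  shows "frechet_derivative (\<lambda>x. frechet_derivative f (at x) v) (at a) w
       = frechet_derivative (\<lambda>x. frechet_derivative f (at x) w) (at a) v"
proof (rule euclidean_eqI)
  fix b :: 'b assume "b \<in> Basis"
  have lin: "linear (\<lambda>y. y \<bullet> b)" by (auto intro: linearI simp: inner_add_left)
  have first: "frechet_derivative f (at x) u \<bullet> b = frechet_derivative (\<lambda>x. f x \<bullet> b) (at x) u" if "x \<in> S" for x u
    using frechet_derivative_linear_image[OF lin] C_inf_differentiable[OF S(2,1) that] by metis
  have "frechet_derivative (\<lambda>x. frechet_derivative f (at x) u) (at a) z \<bullet> b
      = frechet_derivative (\<lambda>x. frechet_derivative (\<lambda>x. f x \<bullet> b) (at x) u) (at a) z" for u z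
  proof -
    have d: "(\<lambda>x. frechet_derivative f (at x) u) differentiable (at a)"
      using S by (intro C_inf_differentiable[OF C_inf_frechet]) auto
    then have "frechet_derivative (\<lambda>x. frechet_derivative f (at x) u) (at a) z \<bullet> b
      = frechet_derivative (\<lambda>x. frechet_derivative f (at x) u \<bullet> b) (at a) z"
      using frechet_derivative_linear_image[OF lin d] by simp
    also have "\<dots> = frechet_derivative (\<lambda>x. frechet_derivative (\<lambda>x. f x \<bullet> b) (at x) u) (at a) z"
      using first C_inf_differentiable[OF C_inf_linear[OF S(1) lin C_inf_frechet[OF S(2)]] S(1,3)] S(1,3)
      by (subst frechet_derivative_transform_within_open) auto
    finally show ?thesis .
  qed
  moreover have "C_inf S (\<lambda>x. f x \<bullet> b)" by (rule C_inf_linear[OF S(1) lin S(2)])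
  ultimately show "frechet_derivative (\<lambda>x. frechet_derivative f (at x) v) (at a) w \<bullet> b
      = frechet_derivative (\<lambda>x. frechet_derivative f (at x) w) (at a) v \<bullet> b"
    using second_derivative_symmetric_real S by metis
qed

text \<open>Only the identity permutation contributes at the identity matrix.\<close>

lemma has_derivative_det_mat_1:
  "(det has_derivative trace) (at (mat 1 :: real^'n^'n))"
proof -
  let ?P = "{\<pi>. \<pi> permutes (UNIV::'n set)}"
  have "(det has_derivative (\<lambda>H. \<Sum>\<pi>\<in>?P. of_int (sign \<pi>) *
      (\<Sum>i\<in>UNIV. H $ i $ \<pi> i * (\<Prod>j\<in>UNIV - {i}. mat 1 $ j $ \<pi> j)))) (at (mat 1 :: real^'n^'n))"
    unfolding det_def
    by (auto intro!: derivative_eq_intros has_derivative_prod bounded_linear.has_derivative[OF bounded_linear_vec_nth] 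
        simp: fun_eq_iff)
  moreover have "(\<Sum>\<pi>\<in>?P. of_int (sign \<pi>) *
      (\<Sum>i\<in>UNIV. H $ i $ \<pi> i * (\<Prod>j\<in>UNIV - {i}. mat 1 $ j $ \<pi> j))) = trace H" for H :: "real^'n^'n"
  proof -
    have z: "(\<Prod>j\<in>UNIV - {i}. (mat 1 :: real^'n^'n) $ j $ \<pi> j) = 0" if \<pi>: "\<pi> \<in> ?P" "\<pi> \<noteq> id" for \<pi> :: "'n \<Rightarrow> 'n" and i
    proof -
      have "inj \<pi>" using \<pi>(1) permutes_inj by auto
      obtain k where k: "\<pi> k \<noteq> k" using \<pi>(2) by (auto simp: fun_eq_iff)
      \<comment> \<open>A permutation other than the identity moves at least two points, hence one
        different from \<open>i\<close>, and the factor of the identity matrix at that point is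
        0.\<close>
      obtain l where "l \<noteq> i" "\<pi> l \<noteq> l"
        using k \<open>inj \<pi>\<close> by (metis injD)
      then show ?thesis
        by (intro prod_zero bexI[of _ l]) (auto simp: mat_def)
    qed
    have "(\<Sum>\<pi>\<in>?P. of_int (sign \<pi>) * (\<Sum>i\<in>UNIV. H $ i $ \<pi> i * (\<Prod>j\<in>UNIV - {i}. (mat 1 :: real^'n^'n) $ j $ \<pi> j)))
       = (\<Sum>\<pi>\<in>{id}. of_int (sign \<pi>) * (\<Sum>i\<in>UNIV. H $ i $ \<pi> i * (\<Prod>j\<in>UNIV - {i}. (mat 1 :: real^'n^'n) $ j $ \<pi> j)))"
    proof (rule sum.mono_neutral_right)
      show "\<forall>\<pi>\<in>?P - {id}. of_int (sign \<pi>) *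
          (\<Sum>i\<in>UNIV. H $ i $ \<pi> i * (\<Prod>j\<in>UNIV - {i}. (mat 1 :: real^'n^'n) $ j $ \<pi> j)) = 0"
      proof
        fix \<pi> assume "\<pi> \<in> ?P - {id}"
        then have \<pi>: "\<pi> \<in> ?P" "\<pi> \<noteq> id" by auto
        show "of_int (sign \<pi>) *
          (\<Sum>i\<in>UNIV. H $ i $ \<pi> i * (\<Prod>j\<in>UNIV - {i}. (mat 1 :: real^'n^'n) $ j $ \<pi> j)) = 0"
          by (simp only: z[OF \<pi>] mult_zero_right sum.neutral_const)
      qed
    qed (auto simp: permutes_id finite_permutations)
    then show ?thesis by (simp add: trace_def mat_def)
  qed
  ultimately show ?thesis by simp
qed

section \<open>Smooth functions on manifolds\<close>

lemma openin_chart: "manifold N \<Longrightarrow> \<phi> \<in> atlas N \<Longrightarrow> openin (mtop N) (fst \<phi>)"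
  by (simp add: manifold_def)

lemma homeomorphic_map_chart:
  "manifold N \<Longrightarrow> \<phi> \<in> atlas N \<Longrightarrow>
    homeomorphic_map (subtopology (mtop N) (fst \<phi>)) (top_of_set (snd \<phi> ` fst \<phi>)) (snd \<phi>)"
  by (simp add: manifold_def)

lemma open_chart_image:
  assumes "manifold N" "\<phi> \<in> atlas N" "openin (mtop N) V"
  shows "open (snd \<phi> ` (fst \<phi> \<inter> V))"
proof -
  have "openin (subtopology (mtop N) (fst \<phi>)) (fst \<phi> \<inter> V)"
    using assms by (auto simp: openin_subtopology)
  then have "openin (top_of_set (snd \<phi> ` fst \<phi>)) (snd \<phi> ` (fst \<phi> \<inter> V))"
    using homeomorphic_imp_open_map[OF homeomorphic_map_chart[OF assms(1,2)]]
    by (simp add: open_map_def)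
  moreover have "open (snd \<phi> ` fst \<phi>)" using assms by (simp add: manifold_def)
  ultimately show ?thesis by (simp add: openin_open_eq)
qed

lemma inj_on_chart: "manifold N \<Longrightarrow> \<phi> \<in> atlas N \<Longrightarrow> inj_on (snd \<phi>) (fst \<phi>)"
  using homeomorphic_imp_injective_map[OF homeomorphic_map_chart, of N \<phi>]
    openin_subset[OF openin_chart, of N \<phi>] by (simp add: Int_absorb1)

lemma in_chart_at: "manifold N \<Longrightarrow> \<phi> \<in> atlas N \<Longrightarrow> q \<in> fst \<phi> \<Longrightarrow> in_chart \<phi> f (snd \<phi> q) = f q"
  by (simp add: in_chart_def inv_into_f_f inj_on_chart)

lemma charts_atD: "\<phi> \<in> charts_at N q \<Longrightarrow> \<phi> \<in> atlas N" "\<phi> \<in> charts_at N q \<Longrightarrow> q \<in> fst \<phi>"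
  by (simp_all add: charts_at_def)

lemma charts_atI: "\<phi> \<in> atlas N \<Longrightarrow> q \<in> fst \<phi> \<Longrightarrow> \<phi> \<in> charts_at N q"
  by (simp add: charts_at_def)

lemma ex_chart_at: "manifold N \<Longrightarrow> q \<in> points N \<Longrightarrow> \<exists>\<phi>. \<phi> \<in> charts_at N q"
proof -
  assume "manifold N" "q \<in> points N"
  then have "q \<in> (\<Union>\<phi>\<in>atlas N. fst \<phi>)" by (simp add: manifold_def)
  then show ?thesis by (auto simp: charts_at_def)
qed

lemma openin_points: "openin (mtop N) V \<Longrightarrow> q \<in> V \<Longrightarrow> q \<in> points N"
  using openin_subset by (auto simp: points_def)

lemma openin_Int_chart: "manifold N \<Longrightarrow> \<phi> \<in> atlas N \<Longrightarrow> openin (mtop N) V \<Longrightarrow> openin (mtop N) (V \<inter> fst \<phi>)"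
  by (simp add: openin_Int openin_chart)

lemma smooth_funD: "smooth_fun N V f \<Longrightarrow> \<phi> \<in> atlas N \<Longrightarrow> C_inf (snd \<phi> ` (fst \<phi> \<inter> V)) (in_chart \<phi> f)"
  by (simp add: smooth_fun_def)

lemma smooth_fun_subset: "smooth_fun N V f \<Longrightarrow> W \<subseteq> V \<Longrightarrow> smooth_fun N W f"
  unfolding smooth_fun_def by (meson C_inf_subset Int_mono image_mono order_refl)

lemma smooth_fun_cong:
  assumes "manifold N" "openin (mtop N) V" "\<And>q. q \<in> V \<Longrightarrow> f q = g q"
  shows "smooth_fun N V f \<longleftrightarrow> smooth_fun N V g"
  unfolding smooth_fun_def
proof (intro ball_cong refl C_inf_cong)
  fix \<phi> u assume \<phi>: "\<phi> \<in> atlas N"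
  then show "open (snd \<phi> ` (fst \<phi> \<inter> V))" using assms open_chart_image by blast
  assume "u \<in> snd \<phi> ` (fst \<phi> \<inter> V)"
  then obtain q where "q \<in> fst \<phi> \<inter> V" "u = snd \<phi> q" by blast
  then show "in_chart \<phi> f u = in_chart \<phi> g u"
    using in_chart_at[OF assms(1) \<phi>, of q f] in_chart_at[OF assms(1) \<phi>, of q g] assms(3) by auto
qed

lemma smooth_fun_local:
  assumes "manifold N" "\<And>q. q \<in> V \<Longrightarrow> \<exists>W. openin (mtop N) W \<and> q \<in> W \<and> smooth_fun N W f"
  shows "smooth_fun N V f"
  unfolding smooth_fun_def
proof (intro ballI C_inf_local)
  fix \<phi> u assume \<phi>: "\<phi> \<in> atlas N" and "u \<in> snd \<phi> ` (fst \<phi> \<inter> V)"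
  then obtain q where q: "q \<in> fst \<phi>" "q \<in> V" "u = snd \<phi> q" by blast
  then obtain W where "openin (mtop N) W" "q \<in> W" "smooth_fun N W f" using assms(2) by blast
  then show "\<exists>T. open T \<and> u \<in> T \<and> C_inf T (in_chart \<phi> f)"
    using q \<phi> open_chart_image[OF assms(1) \<phi>]
    by (intro exI[of _ "snd \<phi> ` (fst \<phi> \<inter> W)"]) (auto intro: smooth_funD)
qed

lemma smooth_fun_const: "smooth_fun N V (\<lambda>q. c)"
  by (simp add: smooth_fun_def in_chart_def comp_def C_inf_const)

context
  fixes N :: "('a, 'n::finite) mfd" and V :: "'a set"
  assumes N: "manifold N" and V: "openin (mtop N) V"
begin

lemma smooth_fun_add: "smooth_fun N V f \<Longrightarrow> smooth_fun N V g \<Longrightarrow> smooth_fun N V (\<lambda>q. f q + g q)"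
  by (simp add: smooth_fun_def in_chart_def comp_def C_inf_add[OF open_chart_image[OF N _ V]])

lemma smooth_fun_scaleR:
  fixes f :: "'a \<Rightarrow> real"
  shows "smooth_fun N V f \<Longrightarrow> smooth_fun N V g \<Longrightarrow> smooth_fun N V (\<lambda>q. f q *\<^sub>R g q)"
  by (simp add: smooth_fun_def in_chart_def comp_def C_inf_scaleR[OF open_chart_image[OF N _ V]])

lemma smooth_fun_mult:
  fixes f g :: "'a \<Rightarrow> real"
  shows "smooth_fun N V f \<Longrightarrow> smooth_fun N V g \<Longrightarrow> smooth_fun N V (\<lambda>q. f q * g q)"
  using smooth_fun_scaleR[of f g] by simp

lemma smooth_fun_sum: "(\<And>i. i \<in> I \<Longrightarrow> smooth_fun N V (f i)) \<Longrightarrow> smooth_fun N V (\<lambda>q. \<Sum>i\<in>I. f i q)"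
  by (simp add: smooth_fun_def in_chart_def comp_def C_inf_sum[OF open_chart_image[OF N _ V]])

lemma smooth_fun_compose:
  assumes "open T" "g ` V \<subseteq> T" "C_inf T F" "smooth_fun N V g"
  shows "smooth_fun N V (\<lambda>q. F (g q))"
  unfolding smooth_fun_def
proof
  fix \<phi> assume \<phi>: "\<phi> \<in> atlas N"
  have "C_inf (snd \<phi> ` (fst \<phi> \<inter> V)) (\<lambda>u. F (in_chart \<phi> g u))"
  proof (rule C_inf_compose[OF open_chart_image[OF N \<phi> V] assms(1) _ assms(3) smooth_funD[OF assms(4) \<phi>]])
    show "in_chart \<phi> g ` snd \<phi> ` (fst \<phi> \<inter> V) \<subseteq> T"
      using assms(2) in_chart_at[OF N \<phi>] by auto
  qed
  then show "C_inf (snd \<phi> ` (fst \<phi> \<inter> V)) (in_chart \<phi> (\<lambda>q. F (g q)))"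
    by (simp add: in_chart_def comp_def)
qed

lemma smooth_fun_linear:
  fixes h :: "'b::euclidean_space \<Rightarrow> 'c::euclidean_space"
  assumes "linear h" "smooth_fun N V f"
  shows "smooth_fun N V (\<lambda>q. h (f q))"
  by (rule smooth_fun_compose[OF open_UNIV _ C_inf_linear[OF open_UNIV assms(1) C_inf_ident[OF open_UNIV]] assms(2)]) simp

lemma smooth_fun_minus: "smooth_fun N V f \<Longrightarrow> smooth_fun N V (\<lambda>q. - f q)"
  by (rule smooth_fun_linear[of uminus f]) (auto intro: linearI)

lemma smooth_fun_diff: "smooth_fun N V f \<Longrightarrow> smooth_fun N V g \<Longrightarrow> smooth_fun N V (\<lambda>q. f q - g q)"
  using smooth_fun_add[OF _ smooth_fun_minus[of g], of f] by simp

lemma smooth_fun_vec_nth: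
  fixes f :: "'a \<Rightarrow> 'b::euclidean_space ^ 'm::finite"
  shows "smooth_fun N V f \<Longrightarrow> smooth_fun N V (\<lambda>q. f q $ i)"
  by (rule smooth_fun_linear[of "\<lambda>v. v $ i" f]) (auto intro: linearI)

lemma smooth_fun_vec_lambda:
  fixes f :: "'m::finite \<Rightarrow> 'a \<Rightarrow> 'b::euclidean_space"
  assumes "\<And>i. smooth_fun N V (f i)"
  shows "smooth_fun N V (\<lambda>q. \<chi> i. f i q)"
proof -
  have "smooth_fun N V (\<lambda>q. \<Sum>i\<in>UNIV. (\<chi> j. if j = i then f i q else 0))"
  proof (rule smooth_fun_sum)
    fix i :: 'm
    show "smooth_fun N V (\<lambda>q. (\<chi> j. if j = i then f i q else 0))"
      by (rule smooth_fun_linear[of "\<lambda>y. \<chi> j. if j = i then y else 0" "f i"])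
         (auto intro!: linearI assms simp: vec_eq_iff)
  qed
  moreover have "(\<Sum>i\<in>UNIV. (\<chi> j. if j = i then f i q else 0)) = (\<chi> i. f i q)" for q
    by (simp add: vec_eq_iff)
  ultimately show ?thesis by simp
qed

lemma smooth_fun_prod:
  fixes f :: "'i \<Rightarrow> 'a \<Rightarrow> real"
  shows "(\<And>i. i \<in> I \<Longrightarrow> smooth_fun N V (f i)) \<Longrightarrow> smooth_fun N V (\<lambda>q. \<Prod>i\<in>I. f i q)"
proof (induction I rule: infinite_finite_induct)
  case (insert i I)
  then show ?case using smooth_fun_mult[of "f i" "\<lambda>q. \<Prod>i\<in>I. f i q"] by simp
qed (simp_all add: smooth_fun_const)

lemma smooth_fun_det:
  fixes A :: "'a \<Rightarrow> real ^ 'm ^ 'm::finite"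
  assumes "smooth_fun N V A"
  shows "smooth_fun N V (\<lambda>q. det (A q))"
  unfolding det_def
  by (intro smooth_fun_sum smooth_fun_mult smooth_fun_const smooth_fun_prod smooth_fun_vec_nth assms)

lemma smooth_fun_inverse:
  fixes f :: "'a \<Rightarrow> real"
  assumes "smooth_fun N V f" "\<And>q. q \<in> V \<Longrightarrow> f q \<noteq> 0"
  shows "smooth_fun N V (\<lambda>q. inverse (f q))"
  by (rule smooth_fun_compose[OF _ _ C_inf_inverse assms(1)]) (use assms(2) in auto)

lemma smooth_fun_divide:
  fixes f g :: "'a \<Rightarrow> real"
  assumes "smooth_fun N V f" "smooth_fun N V g" "\<And>q. q \<in> V \<Longrightarrow> g q \<noteq> 0"
  shows "smooth_fun N V (\<lambda>q. f q / g q)"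
  unfolding divide_inverse by (intro smooth_fun_mult smooth_fun_inverse assms)

text \<open>The absolute value disappears through
  \<open>\<bar>y\<bar> powr a = (y * y) powr (a / 2)\<close>. The factors by which densities change
  from frame to frame have this form.\<close>

lemma smooth_fun_abs_powr:
  fixes f :: "'a \<Rightarrow> real"
  assumes "smooth_fun N V f" "\<And>q. q \<in> V \<Longrightarrow> f q \<noteq> 0"
  shows "smooth_fun N V (\<lambda>q. \<bar>f q\<bar> powr a)"
proof -
  have "smooth_fun N V (\<lambda>q. (f q * f q) powr (a / 2))"
  proof (rule smooth_fun_compose[OF _ _ C_inf_powr smooth_fun_mult[OF assms(1) assms(1)]])
    show "(\<lambda>q. f q * f q) ` V \<subseteq> {0<..}"
      using assms(2) by (auto simp: zero_less_mult_iff neq_iff) (metis linorder_neqE_linordered_idom)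
  qed simp
  moreover have "(y * y) powr (a / 2) = \<bar>y\<bar> powr a" for y :: real
  proof (cases "y = 0")
    case False
    then have "y * y = \<bar>y\<bar> powr 2" by (simp add: powr_numeral power2_eq_square)
    then show ?thesis by (simp only: powr_powr) simp
  qed simp
  ultimately show ?thesis by simp
qed

lemma smooth_fun_matrix_vector_mult:
  fixes A :: "'a \<Rightarrow> real ^ 'k::finite ^ 'm::finite"
  assumes "smooth_fun N V A" "smooth_fun N V f"
  shows "smooth_fun N V (\<lambda>q. A q *v f q)"
  unfolding matrix_vector_mult_def
  by (intro smooth_fun_vec_lambda smooth_fun_sum smooth_fun_mult smooth_fun_vec_nth assms)

lemma smooth_fun_matrix_mult:
  fixes A :: "'a \<Rightarrow> real ^ 'k::finite ^ 'm::finite" and B :: "'a \<Rightarrow> real ^ 'l::finite ^ 'k"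
  assumes "smooth_fun N V A" "smooth_fun N V B"
  shows "smooth_fun N V (\<lambda>q. A q ** B q)"
  unfolding matrix_matrix_mult_def
  by (intro smooth_fun_vec_lambda smooth_fun_sum smooth_fun_mult smooth_fun_vec_nth assms)

lemma smooth_fun_inner:
  fixes f g :: "'a \<Rightarrow> real ^ 'm::finite"
  assumes "smooth_fun N V f" "smooth_fun N V g"
  shows "smooth_fun N V (\<lambda>q. f q \<bullet> g q)"
  unfolding inner_vec_def inner_real_def
  by (intro smooth_fun_sum smooth_fun_mult smooth_fun_vec_nth assms)

text \<open>Cramer's rule writes the solution as quotients of determinants. It gives smoothness of
  quantities known only through a linear system: frame coordinates and tangential parts.\<close>

lemma smooth_fun_solve:
  fixes A :: "'a \<Rightarrow> real ^ 'm ^ 'm::finite"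
  assumes "smooth_fun N V A" "smooth_fun N V (\<lambda>q. A q *v x q)" "\<And>q. q \<in> V \<Longrightarrow> det (A q) \<noteq> 0"
  shows "smooth_fun N V x"
proof -
  let ?B = "\<lambda>k q. \<chi> i j. if j = k then (A q *v x q) $ i else A q $ i $ j"
  have B: "smooth_fun N V (?B k)" for k
  proof (intro smooth_fun_vec_lambda)
    fix i j
    have "smooth_fun N V (\<lambda>q. (A q *v x q) $ i)" "smooth_fun N V (\<lambda>q. A q $ i $ j)"
      by (intro smooth_fun_vec_nth assms)+
    then show "smooth_fun N V (\<lambda>q. if j = k then (A q *v x q) $ i else A q $ i $ j)"
      by (cases "j = k") simp_all
  qed
  have "smooth_fun N V (\<lambda>q. \<chi> k. det (?B k q) / det (A q))"
    by (intro smooth_fun_vec_lambda smooth_fun_divide smooth_fun_det B assms)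
  moreover have "x q = (\<chi> k. det (?B k q) / det (A q))" if "q \<in> V" for q
    using cramer[OF assms(3)[OF that], of "x q" "A q *v x q"] by simp
  ultimately show ?thesis
    using smooth_fun_cong[OF N V, of x "\<lambda>q. \<chi> k. det (?B k q) / det (A q)"] by blast
qed

lemma smooth_fun_chart: "\<phi> \<in> atlas N \<Longrightarrow> V \<subseteq> fst \<phi> \<Longrightarrow> smooth_fun N V (snd \<phi>)"
proof (rule smooth_fun_subset[of _ "fst \<phi>"])
  assume "\<phi> \<in> atlas N"
  then show "smooth_fun N (fst \<phi>) (snd \<phi>)"
    using N unfolding manifold_def smooth_fun_def by auto
qed

end

section \<open>Directional derivatives\<close>

lemma has_derivative_in_chart:
  assumes "manifold N" "openin (mtop N) V" "smooth_fun N V f" "q \<in> V" "\<phi> \<in> charts_at N q"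
  shows "(in_chart \<phi> f has_derivative frechet_derivative (in_chart \<phi> f) (at (snd \<phi> q))) (at (snd \<phi> q))"
proof -
  note \<phi> = charts_atD[OF assms(5)]
  have "in_chart \<phi> f differentiable at (snd \<phi> q)"
    using C_inf_differentiable[OF smooth_funD[OF assms(3) \<phi>(1)] open_chart_image[OF assms(1) \<phi>(1) assms(2)]]
      \<phi>(2) assms(4) by blast
  then show ?thesis by (rule frechet_derivative_worksI)
qed

lemma has_derivative_transition:
  assumes N: "manifold N" and \<phi>: "\<phi> \<in> charts_at N q" and \<psi>: "\<psi> \<in> charts_at N q"
  shows "(in_chart \<phi> (snd \<psi>) has_derivative frechet_derivative (in_chart \<phi> (snd \<psi>)) (at (snd \<phi> q))) (at (snd \<phi> q))"
  by (rule has_derivative_in_chart[OF N openin_chart[OF N charts_atD(1)[OF \<psi>]]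
      smooth_fun_chart[OF N openin_chart[OF N charts_atD(1)[OF \<psi>]] charts_atD(1)[OF \<psi>] order_refl]
      charts_atD(2)[OF \<psi>] \<phi>])

lemma linear_transition:
  "manifold N \<Longrightarrow> \<phi> \<in> charts_at N q \<Longrightarrow> \<psi> \<in> charts_at N q \<Longrightarrow>
    linear (frechet_derivative (in_chart \<phi> (snd \<psi>)) (at (snd \<phi> q)))"
  using has_derivative_linear[OF has_derivative_transition] .

section \<open>Tangent spaces as vector spaces\<close>

lemma tspaceD:
  assumes "v \<in> tspace N q"
  shows "\<phi> \<notin> charts_at N q \<Longrightarrow> v \<phi> = 0"
    and "\<phi> \<in> charts_at N q \<Longrightarrow> \<psi> \<in> charts_at N q \<Longrightarrow>
      v \<psi> = frechet_derivative (in_chart \<phi> (snd \<psi>)) (at (snd \<phi> q)) (v \<phi>)"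
  using assms unfolding tspace_def by blast+

lemma tspaceI:
  assumes "\<And>\<phi>. \<phi> \<notin> charts_at N q \<Longrightarrow> v \<phi> = 0"
    and "\<And>\<phi> \<psi>. \<phi> \<in> charts_at N q \<Longrightarrow> \<psi> \<in> charts_at N q \<Longrightarrow>
      v \<psi> = frechet_derivative (in_chart \<phi> (snd \<psi>)) (at (snd \<phi> q)) (v \<phi>)"
  shows "v \<in> tspace N q"
  using assms unfolding tspace_def by blast

lemma tspace_add:
  assumes N: "manifold N" and v: "v \<in> tspace N q" and w: "w \<in> tspace N q"
  shows "v + w \<in> tspace N q"
proof (rule tspaceI)
  fix \<phi> \<psi> assume c: "\<phi> \<in> charts_at N q" "\<psi> \<in> charts_at N q"
  show "(v + w) \<psi> = frechet_derivative (in_chart \<phi> (snd \<psi>)) (at (snd \<phi> q)) ((v + w) \<phi>)"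
    unfolding plus_fun_def tspaceD(2)[OF v c] tspaceD(2)[OF w c]
    by (rule linear_add[OF linear_transition[OF N c], symmetric])
qed (simp add: tspaceD(1)[OF v] tspaceD(1)[OF w])

lemma tspace_scaleR:
  assumes N: "manifold N" and v: "v \<in> tspace N q"
  shows "r *\<^sub>R v \<in> tspace N q"
proof (rule tspaceI)
  fix \<phi> \<psi> assume c: "\<phi> \<in> charts_at N q" "\<psi> \<in> charts_at N q"
  show "(r *\<^sub>R v) \<psi> = frechet_derivative (in_chart \<phi> (snd \<psi>)) (at (snd \<phi> q)) ((r *\<^sub>R v) \<phi>)"
    unfolding scaleR_fun_def tspaceD(2)[OF v c]
    by (rule linear_cmul[OF linear_transition[OF N c], symmetric])
qed (simp add: tspaceD(1)[OF v] scaleR_fun_def)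

lemma tspace_zero: "manifold N \<Longrightarrow> v \<in> tspace N q \<Longrightarrow> 0 \<in> tspace N q"
  using tspace_scaleR[of N v q 0] by simp

lemma tspace_minus: "manifold N \<Longrightarrow> v \<in> tspace N q \<Longrightarrow> - v \<in> tspace N q"
  using tspace_scaleR[of N v q "-1"] by simp

lemma tspace_diff: "manifold N \<Longrightarrow> v \<in> tspace N q \<Longrightarrow> w \<in> tspace N q \<Longrightarrow> v - w \<in> tspace N q"
  using tspace_add[of N v q "- w"] tspace_minus[of N w q] by simp

lemma tspace_sum:
  "manifold N \<Longrightarrow> u \<in> tspace N q \<Longrightarrow> (\<And>i. i \<in> I \<Longrightarrow> v i \<in> tspace N q) \<Longrightarrow> (\<Sum>i\<in>I. v i) \<in> tspace N q"
proof (induction I rule: infinite_finite_induct)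
  case (insert i I)
  show ?case
    unfolding sum.insert[OF insert.hyps] by (rule tspace_add) (use insert in auto)
qed (simp_all add: tspace_zero)

lemma tspace_eqI:
  assumes "v \<in> tspace N q" "w \<in> tspace N q" "\<phi> \<in> charts_at N q" "v \<phi> = w \<phi>"
  shows "v = w"
proof
  fix \<psi>
  show "v \<psi> = w \<psi>"
  proof (cases "\<psi> \<in> charts_at N q")
    case True
    show ?thesis
      unfolding tspaceD(2)[OF assms(1,3) True] tspaceD(2)[OF assms(2,3) True] assms(4) ..
  qed (simp add: tspaceD(1)[OF assms(1)] tspaceD(1)[OF assms(2)])
qed

text \<open>Chain rule for \<open>in_chart \<phi> f = in_chart \<psi> f \<circ> in_chart \<phi> (snd
  \<psi>)\<close>, which holds near \<open>snd \<phi> q\<close>.\<close>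

lemma frechet_derivative_chart_change:
  assumes N: "manifold N" and V: "openin (mtop N) V" and f: "smooth_fun N V f" and q: "q \<in> V"
    and \<phi>: "\<phi> \<in> charts_at N q" and \<psi>: "\<psi> \<in> charts_at N q"
  shows "frechet_derivative (in_chart \<phi> f) (at (snd \<phi> q)) a
    = frechet_derivative (in_chart \<psi> f) (at (snd \<psi> q))
        (frechet_derivative (in_chart \<phi> (snd \<psi>)) (at (snd \<phi> q)) a)"
proof -
  note \<phi>' = charts_atD[OF \<phi>] and \<psi>' = charts_atD[OF \<psi>]
  let ?S = "snd \<phi> ` (fst \<phi> \<inter> (V \<inter> fst \<psi>))"
  have S: "open ?S" by (rule open_chart_image[OF N \<phi>'(1) openin_Int_chart[OF N \<psi>'(1) V]])
  have qS: "snd \<phi> q \<in> ?S" using \<phi>'(2) \<psi>'(2) q by blast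
  have d\<psi>: "(in_chart \<phi> (snd \<psi>) has_derivative frechet_derivative (in_chart \<phi> (snd \<psi>)) (at (snd \<phi> q))) (at (snd \<phi> q))"
    by (rule has_derivative_transition[OF N \<phi> \<psi>])
  have df: "(in_chart \<psi> f has_derivative frechet_derivative (in_chart \<psi> f) (at (snd \<psi> q))) (at (in_chart \<phi> (snd \<psi>) (snd \<phi> q)))"
    using has_derivative_in_chart[OF N V f q \<psi>] in_chart_at[OF N \<phi>'(1) \<phi>'(2), of "snd \<psi>"] by simp
  have "((\<lambda>u. in_chart \<psi> f (in_chart \<phi> (snd \<psi>) u)) has_derivative
    (\<lambda>a. frechet_derivative (in_chart \<psi> f) (at (snd \<psi> q))
        (frechet_derivative (in_chart \<phi> (snd \<psi>)) (at (snd \<phi> q)) a))) (at (snd \<phi> q))"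
    by (rule has_derivative_compose[OF d\<psi> df])
  then have "(in_chart \<phi> f has_derivative
    (\<lambda>a. frechet_derivative (in_chart \<psi> f) (at (snd \<psi> q))
        (frechet_derivative (in_chart \<phi> (snd \<psi>)) (at (snd \<phi> q)) a))) (at (snd \<phi> q))"
  proof (rule has_derivative_transform_within_open[OF _ S qS])
    fix u assume "u \<in> ?S"
    then obtain r where r: "r \<in> fst \<phi>" "r \<in> V" "r \<in> fst \<psi>" "u = snd \<phi> r" by blast
    then show "in_chart \<psi> f (in_chart \<phi> (snd \<psi>) u) = in_chart \<phi> f u"
      using in_chart_at[OF N \<phi>'(1) r(1), of "snd \<psi>"] in_chart_at[OF N \<phi>'(1) r(1), of f]
        in_chart_at[OF N \<psi>'(1) r(3), of f] by simp
  qed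
  then show ?thesis by (simp add: frechet_derivative_at[symmetric])
qed

text \<open>Removes the choice of a chart from \<open>dd\<close>: the transformation rule of
  \<open>x\<close> compensates the chain rule for \<open>f\<close>.\<close>

lemma dd_eq:
  assumes "manifold N" "openin (mtop N) V" "smooth_fun N V f" "q \<in> V" "\<phi> \<in> charts_at N q" "x \<in> tspace N q"
  shows "dd N q x f = frechet_derivative (in_chart \<phi> f) (at (snd \<phi> q)) (x \<phi>)"
proof -
  let ?\<phi> = "SOME \<phi>. \<phi> \<in> charts_at N q"
  have \<phi>: "?\<phi> \<in> charts_at N q" by (rule someI[of "\<lambda>\<phi>. \<phi> \<in> charts_at N q", OF assms(5)])
  have "x \<phi> = frechet_derivative (in_chart ?\<phi> (snd \<phi>)) (at (snd ?\<phi> q)) (x ?\<phi>)"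
    by (rule tspaceD(2)[OF assms(6) \<phi> assms(5)])
  then show ?thesis
    unfolding dd_def Let_def by (simp add: frechet_derivative_chart_change[OF assms(1-4) \<phi> assms(5)])
qed

lemma frechet_derivative_cong_open:
  assumes "open S" "u \<in> S" "\<And>v. v \<in> S \<Longrightarrow> f v = g v"
  shows "frechet_derivative f (at u) = frechet_derivative g (at u)"
proof -
  have "(f has_derivative D) (at u) \<longleftrightarrow> (g has_derivative D) (at u)" for D
    using has_derivative_transform_within_open[OF _ assms(1,2), of f D UNIV g]
      has_derivative_transform_within_open[OF _ assms(1,2), of g D UNIV f] assms(3) by auto
  then show ?thesis by (simp add: frechet_derivative_def)
qed

lemma dd_cong:
  assumes "manifold N" "openin (mtop N) V" "q \<in> V" "\<And>r. r \<in> V \<Longrightarrow> f r = g r"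
  shows "dd N q x f = dd N q x g"
proof -
  let ?\<phi> = "SOME \<phi>. \<phi> \<in> charts_at N q"
  have \<phi>: "?\<phi> \<in> charts_at N q"
    using ex_chart_at[OF assms(1) openin_points[OF assms(2,3)]] by (rule someI_ex)
  have "frechet_derivative (in_chart ?\<phi> f) (at (snd ?\<phi> q)) = frechet_derivative (in_chart ?\<phi> g) (at (snd ?\<phi> q))"
  proof (rule frechet_derivative_cong_open[OF open_chart_image[OF assms(1) charts_atD(1)[OF \<phi>] assms(2)]])
    show "snd ?\<phi> q \<in> snd ?\<phi> ` (fst ?\<phi> \<inter> V)" using charts_atD(2)[OF \<phi>] assms(3) by blast
    fix u assume "u \<in> snd ?\<phi> ` (fst ?\<phi> \<inter> V)"
    then obtain r where "r \<in> fst ?\<phi>" "r \<in> V" "u = snd ?\<phi> r" by blast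
    then show "in_chart ?\<phi> f u = in_chart ?\<phi> g u"
      using assms(4) in_chart_at[OF assms(1) charts_atD(1)[OF \<phi>], of r f]
        in_chart_at[OF assms(1) charts_atD(1)[OF \<phi>], of r g] by simp
  qed
  then show ?thesis by (simp add: dd_def)
qed

section \<open>Sum, product and chain rules for directional derivatives\<close>

context
  fixes N :: "('a, 'n::finite) mfd" and V :: "'a set" and q :: 'a and x :: "('a, 'n) tvec"
  assumes N: "manifold N" and V: "openin (mtop N) V" and q: "q \<in> V" and x: "x \<in> tspace N q"
begin

lemma dd_const: "dd N q x (\<lambda>r. c::'b::euclidean_space) = 0"
  by (simp add: dd_def in_chart_def comp_def)

lemma dd_compose:
  fixes f :: "'a \<Rightarrow> 'b::euclidean_space" and F :: "'b \<Rightarrow> 'c::euclidean_space"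
  assumes "smooth_fun N V f" "(F has_derivative F') (at (f q))"
  shows "dd N q x (\<lambda>r. F (f r)) = F' (dd N q x f)"
proof -
  let ?\<phi> = "SOME \<phi>. \<phi> \<in> charts_at N q"
  have \<phi>: "?\<phi> \<in> charts_at N q"
    using ex_chart_at[OF N openin_points[OF V q]] by (rule someI_ex)
  have "((\<lambda>u. F (in_chart ?\<phi> f u)) has_derivative
      (\<lambda>a. F' (frechet_derivative (in_chart ?\<phi> f) (at (snd ?\<phi> q)) a))) (at (snd ?\<phi> q))"
    by (rule has_derivative_compose[OF has_derivative_in_chart[OF N V assms(1) q \<phi>]])
       (simp add: assms(2) in_chart_at[OF N charts_atD[OF \<phi>]])
  then have "(in_chart ?\<phi> (\<lambda>r. F (f r)) has_derivative
      (\<lambda>a. F' (frechet_derivative (in_chart ?\<phi> f) (at (snd ?\<phi> q)) a))) (at (snd ?\<phi> q))"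
    by (simp add: in_chart_def comp_def)
  then show ?thesis by (simp add: dd_def Let_def frechet_derivative_at[symmetric])
qed

lemma dd_linear:
  fixes f :: "'a \<Rightarrow> 'b::euclidean_space" and h :: "'b \<Rightarrow> 'c::euclidean_space"
  assumes "linear h" "smooth_fun N V f"
  shows "dd N q x (\<lambda>r. h (f r)) = h (dd N q x f)"
  using assms by (intro dd_compose linear_imp_has_derivative)

lemma dd_add:
  fixes f g :: "'a \<Rightarrow> 'b::euclidean_space"
  assumes "smooth_fun N V f" "smooth_fun N V g"
  shows "dd N q x (\<lambda>r. f r + g r) = dd N q x f + dd N q x g"
proof -
  let ?\<phi> = "SOME \<phi>. \<phi> \<in> charts_at N q"
  have \<phi>: "?\<phi> \<in> charts_at N q"
    using ex_chart_at[OF N openin_points[OF V q]] by (rule someI_ex)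
  have "((\<lambda>u. in_chart ?\<phi> f u + in_chart ?\<phi> g u) has_derivative
      (\<lambda>a. frechet_derivative (in_chart ?\<phi> f) (at (snd ?\<phi> q)) a
        + frechet_derivative (in_chart ?\<phi> g) (at (snd ?\<phi> q)) a)) (at (snd ?\<phi> q))"
    by (intro has_derivative_add has_derivative_in_chart[OF N V _ q \<phi>] assms)
  moreover have "(\<lambda>u. in_chart ?\<phi> f u + in_chart ?\<phi> g u) = in_chart ?\<phi> (\<lambda>r. f r + g r)"
    by (simp add: in_chart_def comp_def)
  ultimately show ?thesis by (simp add: dd_def Let_def frechet_derivative_at[symmetric])
qed

lemma dd_sum:
  fixes f :: "'i \<Rightarrow> 'a \<Rightarrow> 'b::euclidean_space"
  assumes "\<And>i. i \<in> I \<Longrightarrow> smooth_fun N V (f i)"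
  shows "dd N q x (\<lambda>r. \<Sum>i\<in>I. f i r) = (\<Sum>i\<in>I. dd N q x (f i))"
  using assms
proof (induction I rule: infinite_finite_induct)
  case (insert i I)
  then show ?case
    using dd_add[of "f i" "\<lambda>r. \<Sum>i\<in>I. f i r"] smooth_fun_sum[OF N V, of I f] by simp
qed (simp_all add: dd_const)

lemma dd_scaleR:
  fixes f :: "'a \<Rightarrow> real" and g :: "'a \<Rightarrow> 'b::euclidean_space"
  assumes "smooth_fun N V f" "smooth_fun N V g"
  shows "dd N q x (\<lambda>r. f r *\<^sub>R g r) = dd N q x f *\<^sub>R g q + f q *\<^sub>R dd N q x g"
proof -
  let ?\<phi> = "SOME \<phi>. \<phi> \<in> charts_at N q"
  have \<phi>: "?\<phi> \<in> charts_at N q"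
    using ex_chart_at[OF N openin_points[OF V q]] by (rule someI_ex)
  have "((\<lambda>u. in_chart ?\<phi> f u *\<^sub>R in_chart ?\<phi> g u) has_derivative
      (\<lambda>a. in_chart ?\<phi> f (snd ?\<phi> q) *\<^sub>R frechet_derivative (in_chart ?\<phi> g) (at (snd ?\<phi> q)) a
        + frechet_derivative (in_chart ?\<phi> f) (at (snd ?\<phi> q)) a *\<^sub>R in_chart ?\<phi> g (snd ?\<phi> q))) (at (snd ?\<phi> q))"
    by (intro has_derivative_scaleR has_derivative_in_chart[OF N V _ q \<phi>] assms)
  moreover have "(\<lambda>u. in_chart ?\<phi> f u *\<^sub>R in_chart ?\<phi> g u) = in_chart ?\<phi> (\<lambda>r. f r *\<^sub>R g r)"
    by (simp add: in_chart_def comp_def)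
  moreover have "in_chart ?\<phi> f (snd ?\<phi> q) = f q" "in_chart ?\<phi> g (snd ?\<phi> q) = g q"
    by (simp_all add: in_chart_at[OF N charts_atD[OF \<phi>]])
  ultimately show ?thesis by (simp add: dd_def Let_def frechet_derivative_at[symmetric])
qed

lemma dd_mult:
  fixes f g :: "'a \<Rightarrow> real"
  assumes "smooth_fun N V f" "smooth_fun N V g"
  shows "dd N q x (\<lambda>r. f r * g r) = dd N q x f * g q + f q * dd N q x g"
  using dd_scaleR[OF assms] by simp

lemma dd_vec_nth:
  fixes f :: "'a \<Rightarrow> 'b::euclidean_space ^ 'm::finite"
  assumes "smooth_fun N V f"
  shows "dd N q x (\<lambda>r. f r $ i) = dd N q x f $ i"
  by (rule dd_linear[of "\<lambda>v. v $ i"]) (auto intro: linearI assms)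

lemma dd_matrix_vector_mult:
  fixes A :: "'a \<Rightarrow> real ^ 'k::finite ^ 'm::finite"
  assumes "smooth_fun N V A" "smooth_fun N V f"
  shows "dd N q x (\<lambda>r. A r *v f r) = dd N q x A *v f q + A q *v dd N q x f"
proof -
  have sm: "smooth_fun N V (\<lambda>r. A r $ i $ j)" "smooth_fun N V (\<lambda>r. f r $ j)" "smooth_fun N V (\<lambda>r. A r $ i)" for i j
    by (intro smooth_fun_vec_nth[OF N V] assms)+
  have "dd N q x (\<lambda>r. A r *v f r) $ i = (dd N q x A *v f q + A q *v dd N q x f) $ i" for i
  proof -
    have "dd N q x (\<lambda>r. A r *v f r) $ i = dd N q x (\<lambda>r. \<Sum>j\<in>UNIV. A r $ i $ j * f r $ j)"
      using dd_vec_nth[OF smooth_fun_matrix_vector_mult[OF N V assms], of i]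
      by (simp add: matrix_vector_mult_def)
    also have "\<dots> = (\<Sum>j\<in>UNIV. dd N q x A $ i $ j * f q $ j + A q $ i $ j * dd N q x f $ j)"
      by (simp add: dd_sum smooth_fun_mult[OF N V] sm dd_mult dd_vec_nth assms)
    finally show ?thesis by (simp add: matrix_vector_mult_def sum.distrib)
  qed
  then show ?thesis by (simp add: vec_eq_iff)
qed

lemma dd_inner:
  fixes f g :: "'a \<Rightarrow> real ^ 'm::finite"
  assumes "smooth_fun N V f" "smooth_fun N V g"
  shows "dd N q x (\<lambda>r. f r \<bullet> g r) = dd N q x f \<bullet> g q + f q \<bullet> dd N q x g"
proof -
  have sm: "smooth_fun N V (\<lambda>r. f r $ j)" "smooth_fun N V (\<lambda>r. g r $ j)" for j
    by (intro smooth_fun_vec_nth[OF N V] assms)+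
  show ?thesis
    by (simp add: inner_vec_def dd_sum smooth_fun_mult[OF N V] sm dd_mult dd_vec_nth assms sum.distrib)
qed

end

lemma dd_lincomb:
  fixes f :: "'a \<Rightarrow> 'b::euclidean_space"
  assumes N: "manifold N" and V: "openin (mtop N) V" and q: "q \<in> V" and f: "smooth_fun N V f"
    and x: "x \<in> tspace N q" "y \<in> tspace N q"
  shows "dd N q (a *\<^sub>R x + b *\<^sub>R y) f = a *\<^sub>R dd N q x f + b *\<^sub>R dd N q y f"
proof -
  obtain \<phi> where \<phi>: "\<phi> \<in> charts_at N q" using ex_chart_at[OF N openin_points[OF V q]] by blast
  note D = linear_frechet_derivative[OF differentiableI[OF has_derivative_in_chart[OF N V f q \<phi>]]]
  have "a *\<^sub>R x + b *\<^sub>R y \<in> tspace N q" by (intro tspace_add tspace_scaleR N x)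
  then show ?thesis
    using linear_add[OF D] linear_cmul[OF D] by (simp add: dd_eq[OF N V f q \<phi>] x scaleR_fun_def)
qed

section \<open>Derivatives along smooth fields and the Lie bracket\<close>

lemma tfield_openin: "tfield N M V s \<Longrightarrow> openin (mtop N) V"
  and tfield_tspace: "tfield N M V s \<Longrightarrow> q \<in> V \<Longrightarrow> s q \<in> tspace M q"
  and tfield_smooth: "tfield N M V s \<Longrightarrow> \<psi> \<in> atlas M \<Longrightarrow> smooth_fun N (V \<inter> fst \<psi>) (\<lambda>q. s q \<psi>)"
  by (simp_all add: tfield_def)

lemma dd_eq_on_chart:
  fixes f :: "'a \<Rightarrow> 'b::euclidean_space"
  assumes N: "manifold N" and X: "tfield N N V X" and f: "smooth_fun N V f"
    and \<phi>: "\<phi> \<in> atlas N" and q: "q \<in> V" "q \<in> fst \<phi>"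
  shows "dd N q (X q) f
    = (\<Sum>b\<in>Basis. (X q \<phi> \<bullet> b) *\<^sub>R frechet_derivative (in_chart \<phi> f) (at (snd \<phi> q)) b)"
proof -
  note V = tfield_openin[OF X]
  have \<phi>': "\<phi> \<in> charts_at N q" using \<phi> q by (intro charts_atI)
  have "linear (frechet_derivative (in_chart \<phi> f) (at (snd \<phi> q)))"
    by (rule linear_frechet_derivative[OF differentiableI[OF has_derivative_in_chart[OF N V f q(1) \<phi>']]])
  then show ?thesis
    using dd_eq[OF N V f q(1) \<phi>' tfield_tspace[OF X q(1)]] linear_eq_basis_sum by metis
qed

lemma smooth_frechet_in_chart:
  fixes f :: "'a \<Rightarrow> 'b::euclidean_space"
  assumes N: "manifold N" and V: "openin (mtop N) V" and f: "smooth_fun N V f" and \<phi>: "\<phi> \<in> atlas N"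
  shows "smooth_fun N (V \<inter> fst \<phi>) (\<lambda>q. frechet_derivative (in_chart \<phi> f) (at (snd \<phi> q)) b)"
proof -
  have "openin (mtop N) (V \<inter> fst \<phi>)" using N V \<phi> by (intro openin_Int_chart)
  then show ?thesis
    by (rule smooth_fun_compose[OF N _ open_chart_image[OF N \<phi> V] _ C_inf_frechet[OF smooth_funD[OF f \<phi>]]])
       (use smooth_fun_chart[OF N _ \<phi>] \<open>openin (mtop N) (V \<inter> fst \<phi>)\<close> in auto)
qed

lemma smooth_fun_dd:
  fixes f :: "'a \<Rightarrow> 'b::euclidean_space"
  assumes N: "manifold N" and X: "tfield N N V X" and f: "smooth_fun N V f"
  shows "smooth_fun N V (\<lambda>q. dd N q (X q) f)"
proof (rule smooth_fun_local[OF N])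
  note V = tfield_openin[OF X]
  fix p assume p: "p \<in> V"
  obtain \<phi> where \<phi>: "\<phi> \<in> charts_at N p" using ex_chart_at[OF N openin_points[OF V p]] by blast
  note \<phi>' = charts_atD[OF \<phi>]
  let ?W = "V \<inter> fst \<phi>"
  have W: "openin (mtop N) ?W" using N V \<phi>' by (intro openin_Int_chart)
  have "smooth_fun N ?W (\<lambda>q. X q \<phi> \<bullet> b)" for b
    by (rule smooth_fun_linear[OF N W, of "\<lambda>y. y \<bullet> b" "\<lambda>q. X q \<phi>"])
       (auto intro: linearI tfield_smooth[OF X \<phi>'(1)] simp: inner_add_left)
  then have "smooth_fun N ?W (\<lambda>q. \<Sum>b\<in>Basis. (X q \<phi> \<bullet> b) *\<^sub>R frechet_derivative (in_chart \<phi> f) (at (snd \<phi> q)) b)"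
    by (intro smooth_fun_sum[OF N W] smooth_fun_scaleR[OF N W] smooth_frechet_in_chart[OF N V f \<phi>'(1)])
  moreover have "dd N q (X q) f = (\<Sum>b\<in>Basis. (X q \<phi> \<bullet> b) *\<^sub>R frechet_derivative (in_chart \<phi> f) (at (snd \<phi> q)) b)"
    if "q \<in> ?W" for q
    using that dd_eq_on_chart[OF N X f \<phi>'(1)] by simp
  ultimately have "smooth_fun N ?W (\<lambda>q. dd N q (X q) f)"
    using smooth_fun_cong[OF N W] by (metis (no_types, lifting))
  then show "\<exists>W. openin (mtop N) W \<and> p \<in> W \<and> smooth_fun N W (\<lambda>q. dd N q (X q) f)"
    using W p \<phi>'(2) by blast
qed

lemma tfieldI:
  assumes "openin (mtop N) V" "\<And>q. q \<in> V \<Longrightarrow> s q \<in> tspace M q"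
    "\<And>\<psi>. \<psi> \<in> atlas M \<Longrightarrow> smooth_fun N (V \<inter> fst \<psi>) (\<lambda>q. s q \<psi>)"
  shows "tfield N M V s"
  using assms unfolding tfield_def by blast

lemma tfield_subset: "tfield N M V s \<Longrightarrow> openin (mtop N) W \<Longrightarrow> W \<subseteq> V \<Longrightarrow> tfield N M W s"
  by (rule tfieldI) (auto intro: tfield_tspace smooth_fun_subset[OF tfield_smooth])

lemma tfield_cong:
  assumes "manifold N" "manifold M" "tfield N M V s" "\<And>q. q \<in> V \<Longrightarrow> s q = t q"
    "\<And>\<psi>. \<psi> \<in> atlas M \<Longrightarrow> openin (mtop N) (V \<inter> fst \<psi>)"
  shows "tfield N M V t"
proof (rule tfieldI)
  show "openin (mtop N) V" by (rule tfield_openin[OF assms(3)])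
  show "t q \<in> tspace M q" if "q \<in> V" for q using tfield_tspace[OF assms(3) that] assms(4)[OF that] by simp
  fix \<psi> assume \<psi>: "\<psi> \<in> atlas M"
  show "smooth_fun N (V \<inter> fst \<psi>) (\<lambda>q. t q \<psi>)"
    using tfield_smooth[OF assms(3) \<psi>] assms(4)
      smooth_fun_cong[OF assms(1) assms(5)[OF \<psi>], of "\<lambda>q. s q \<psi>" "\<lambda>q. t q \<psi>"] by simp
qed

text \<open>In the chart, \<open>X (Y f)\<close> consists of the derivative of \<open>f\<close>
  along the derivative of the components of \<open>Y\<close>, and of the second derivative of
  \<open>f\<close> contracted with the components of both fields. The second kind of term cancels by
  \<open>second_derivative_symmetric\<close>. Vector values of \<open>f\<close> are allowed so that
  a chart map can be inserted.\<close>

lemma dd_commutator_chart: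
  fixes f :: "'a \<Rightarrow> 'b::euclidean_space"
  assumes N: "manifold N" and X: "tfield N N V X" and Y: "tfield N N V Y" and f: "smooth_fun N V f"
    and \<phi>: "\<phi> \<in> charts_at N p" and p: "p \<in> V"
  shows "dd N p (X p) (\<lambda>q. dd N q (Y q) f) - dd N p (Y p) (\<lambda>q. dd N q (X q) f)
    = frechet_derivative (in_chart \<phi> f) (at (snd \<phi> p))
        (dd N p (X p) (\<lambda>q. Y q \<phi>) - dd N p (Y p) (\<lambda>q. X q \<phi>))"
proof -
  note V = tfield_openin[OF X] and \<phi>' = charts_atD[OF \<phi>]
  let ?W = "V \<inter> fst \<phi>" and ?u = "snd \<phi> p" and ?S = "snd \<phi> ` (fst \<phi> \<inter> V)"
  let ?F = "\<lambda>b q. frechet_derivative (in_chart \<phi> f) (at (snd \<phi> q)) b"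
  let ?H = "\<lambda>b v. frechet_derivative (\<lambda>u. frechet_derivative (in_chart \<phi> f) (at u) b) (at ?u) v"
  have W: "openin (mtop N) ?W" and pW: "p \<in> ?W"
    using N V \<phi>' p by (auto intro: openin_Int_chart)
  have S: "open ?S" and uS: "?u \<in> ?S" and fS: "C_inf ?S (in_chart \<phi> f)"
    using open_chart_image[OF N \<phi>'(1) V] smooth_funD[OF f \<phi>'(1)] p \<phi>'(2) by auto
  have smF: "smooth_fun N ?W (?F b)" for b by (rule smooth_frechet_in_chart[OF N V f \<phi>'(1)])
  have Hlin: "linear (?H b)" for b
    by (rule linear_frechet_derivative[OF C_inf_differentiable[OF C_inf_frechet[OF fS] S uS]])
  have ddF: "dd N p x (?F b) = ?H b (x \<phi>)" if x: "x \<in> tspace N p" for x b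
  proof -
    have "dd N p x (?F b) = frechet_derivative (in_chart \<phi> (?F b)) (at ?u) (x \<phi>)"
      by (rule dd_eq[OF N W smF pW \<phi> x])
    moreover have "frechet_derivative (in_chart \<phi> (?F b)) (at ?u)
        = frechet_derivative (\<lambda>u. frechet_derivative (in_chart \<phi> f) (at u) b) (at ?u)"
    proof (rule frechet_derivative_cong_open[OF S uS])
      fix v assume "v \<in> ?S"
      then obtain r where "r \<in> fst \<phi>" "v = snd \<phi> r" by blast
      then show "in_chart \<phi> (?F b) v = frechet_derivative (in_chart \<phi> f) (at v) b"
        using in_chart_at[OF N \<phi>'(1), of r "?F b"] by simp
    qed
    ultimately show ?thesis by simp
  qed
  have expand: "dd N p (Z p) (\<lambda>q. dd N q (Y q) f) = ?F (dd N p (Z p) (\<lambda>q. Y q \<phi>)) p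
      + (\<Sum>b\<in>Basis. \<Sum>c\<in>Basis. ((Y p \<phi> \<bullet> b) * (Z p \<phi> \<bullet> c)) *\<^sub>R ?H b c)"
    if Z: "tfield N N V Z" and Y: "tfield N N V Y" for Z Y
  proof -
    note z = tfield_tspace[OF Z p]
    have smY: "smooth_fun N ?W (\<lambda>q. Y q \<phi>)" by (rule tfield_smooth[OF Y \<phi>'(1)])
    have lin: "linear (\<lambda>y::real^'c. y \<bullet> b)" for b by (auto intro: linearI simp: inner_add_left)
    have smYb: "smooth_fun N ?W (\<lambda>q. Y q \<phi> \<bullet> b)" for b
      by (rule smooth_fun_linear[OF N W lin smY])
    have "dd N p (Z p) (\<lambda>q. dd N q (Y q) f) = dd N p (Z p) (\<lambda>q. \<Sum>b\<in>Basis. (Y q \<phi> \<bullet> b) *\<^sub>R ?F b q)"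
      using dd_eq_on_chart[OF N Y f \<phi>'(1)] by (intro dd_cong[OF N W pW]) auto
    also have "\<dots> = (\<Sum>b\<in>Basis. dd N p (Z p) (\<lambda>q. (Y q \<phi> \<bullet> b) *\<^sub>R ?F b q))"
      by (rule dd_sum[OF N W pW z]) (intro smooth_fun_scaleR[OF N W] smYb smF)
    also have "\<dots> = (\<Sum>b\<in>Basis. (dd N p (Z p) (\<lambda>q. Y q \<phi>) \<bullet> b) *\<^sub>R ?F b p + (Y p \<phi> \<bullet> b) *\<^sub>R ?H b (Z p \<phi>))"
      by (intro sum.cong refl)
         (simp add: dd_scaleR[OF N W pW z smYb smF] dd_linear[OF N W pW z lin smY] ddF[OF z])
    also have "\<dots> = (\<Sum>b\<in>Basis. (dd N p (Z p) (\<lambda>q. Y q \<phi>) \<bullet> b) *\<^sub>R ?F b p)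
        + (\<Sum>b\<in>Basis. \<Sum>c\<in>Basis. ((Y p \<phi> \<bullet> b) * (Z p \<phi> \<bullet> c)) *\<^sub>R ?H b c)"
      unfolding sum.distrib linear_eq_basis_sum[OF Hlin, of _ "Z p \<phi>"]
      by (simp add: scaleR_sum_right)
    also have "(\<Sum>b\<in>Basis. (dd N p (Z p) (\<lambda>q. Y q \<phi>) \<bullet> b) *\<^sub>R ?F b p) = ?F (dd N p (Z p) (\<lambda>q. Y q \<phi>)) p"
      by (rule linear_eq_basis_sum[OF linear_frechet_derivative[OF C_inf_differentiable[OF fS S uS]], symmetric])
    finally show ?thesis .
  qed
  have sym: "?H b c = ?H c b" for b c by (rule second_derivative_symmetric[OF S fS uS])
  have "(\<Sum>b\<in>Basis. \<Sum>c\<in>Basis. ((Y p \<phi> \<bullet> b) * (X p \<phi> \<bullet> c)) *\<^sub>R ?H b c)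
      = (\<Sum>c\<in>Basis. \<Sum>b\<in>Basis. ((Y p \<phi> \<bullet> b) * (X p \<phi> \<bullet> c)) *\<^sub>R ?H b c)"
    by (rule sum.swap)
  also have "\<dots> = (\<Sum>b\<in>Basis. \<Sum>c\<in>Basis. ((X p \<phi> \<bullet> b) * (Y p \<phi> \<bullet> c)) *\<^sub>R ?H b c)"
    by (intro sum.cong refl) (subst sym, simp add: mult.commute)
  finally show ?thesis
    using expand[OF X Y] expand[OF Y X]
      linear_diff[OF linear_frechet_derivative[OF C_inf_differentiable[OF fS S uS]]] by simp
qed

lemma frechet_derivative_chart_self:
  assumes N: "manifold N" and \<phi>: "\<phi> \<in> charts_at N q"
  shows "frechet_derivative (in_chart \<phi> (snd \<phi>)) (at (snd \<phi> q)) a = a"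
proof -
  note \<phi>' = charts_atD[OF \<phi>]
  have "frechet_derivative (in_chart \<phi> (snd \<phi>)) (at (snd \<phi> q)) = frechet_derivative (\<lambda>u. u) (at (snd \<phi> q))"
  proof (rule frechet_derivative_cong_open[OF open_chart_image[OF N \<phi>'(1) openin_chart[OF N \<phi>'(1)]]])
    show "snd \<phi> q \<in> snd \<phi> ` (fst \<phi> \<inter> fst \<phi>)" using \<phi>' by simp
    fix v assume "v \<in> snd \<phi> ` (fst \<phi> \<inter> fst \<phi>)"
    then obtain r where "r \<in> fst \<phi>" "v = snd \<phi> r" by blast
    then show "in_chart \<phi> (snd \<phi>) v = v" using in_chart_at[OF N \<phi>'(1), of r "snd \<phi>"] by simp
  qed
  then show ?thesis by simp
qed

lemma dd_chart:
  assumes N: "manifold N" and \<phi>: "\<phi> \<in> charts_at N q" and x: "x \<in> tspace N q"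
  shows "dd N q x (snd \<phi>) = x \<phi>"
  using dd_eq[OF N openin_chart[OF N charts_atD(1)[OF \<phi>]]
      smooth_fun_chart[OF N openin_chart[OF N charts_atD(1)[OF \<phi>]] charts_atD(1)[OF \<phi>] order_refl]
      charts_atD(2)[OF \<phi>] \<phi> x] frechet_derivative_chart_self[OF N \<phi>] by simp

text \<open>\<open>dd_commutator_chart\<close> is applied with \<open>f = snd \<psi>\<close>. Since
  the derivative of a chart map along a field is the component of that field, the left-hand side
  becomes the component of the bracket in \<open>\<psi>\<close>, and the right-hand side the
  transform of its component in \<open>\<phi>\<close>.\<close>

lemma bracket_tspace:
  assumes N: "manifold N" and X: "tfield N N V X" and Y: "tfield N N V Y" and p: "p \<in> V"
  shows "bracket N X Y p \<in> tspace N p"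
proof (rule tspaceI)
  fix \<phi> \<psi> assume \<phi>: "\<phi> \<in> charts_at N p" and \<psi>: "\<psi> \<in> charts_at N p"
  note \<psi>' = charts_atD[OF \<psi>]
  let ?W = "V \<inter> fst \<psi>"
  have W: "openin (mtop N) ?W" by (rule openin_Int_chart[OF N \<psi>'(1) tfield_openin[OF X]])
  have pW: "p \<in> ?W" using p \<psi>' by simp
  note XW = tfield_subset[OF X W Int_lower1] and YW = tfield_subset[OF Y W Int_lower1]
  have "dd N p (X p) (\<lambda>q. dd N q (Y q) (snd \<psi>)) - dd N p (Y p) (\<lambda>q. dd N q (X q) (snd \<psi>))
      = frechet_derivative (in_chart \<phi> (snd \<psi>)) (at (snd \<phi> p)) (bracket N X Y p \<phi>)"
    using dd_commutator_chart[OF N XW YW smooth_fun_chart[OF N W \<psi>'(1) Int_lower2] \<phi> pW] \<phi>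
    by (simp add: bracket_def)
  moreover have "dd N p (Z p) (\<lambda>q. dd N q (U q) (snd \<psi>)) = dd N p (Z p) (\<lambda>q. U q \<psi>)"
    if "tfield N N V U" for Z U
    by (rule dd_cong[OF N W pW]) (auto intro!: dd_chart[OF N] charts_atI \<psi>'(1) tfield_tspace[OF that])
  ultimately show "bracket N X Y p \<psi> = frechet_derivative (in_chart \<phi> (snd \<psi>)) (at (snd \<phi> p)) (bracket N X Y p \<phi>)"
    using \<psi> X Y by (simp add: bracket_def)
qed (simp add: bracket_def)

lemma dd_bracket:
  fixes f :: "'a \<Rightarrow> 'b::euclidean_space"
  assumes N: "manifold N" and X: "tfield N N V X" and Y: "tfield N N V Y" and f: "smooth_fun N V f" and p: "p \<in> V"
  shows "dd N p (bracket N X Y p) f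
    = dd N p (X p) (\<lambda>q. dd N q (Y q) f) - dd N p (Y p) (\<lambda>q. dd N q (X q) f)"
proof -
  note V = tfield_openin[OF X]
  obtain \<phi> where \<phi>: "\<phi> \<in> charts_at N p" using ex_chart_at[OF N openin_points[OF V p]] by blast
  show ?thesis
    unfolding dd_commutator_chart[OF N X Y f \<phi> p] dd_eq[OF N V f p \<phi> bracket_tspace[OF N X Y p]]
    using \<phi> by (simp add: bracket_def)
qed

section \<open>Coordinate vector fields and submanifolds\<close>

text \<open>The tangent vector at \<open>q\<close> with components \<open>a\<close> in the chart
  \<open>\<phi>\<close>; for fixed \<open>a\<close> this is a coordinate field with constant
  coefficients.\<close>

definition chart_vec ::
    "('a, 'm::finite) mfd \<Rightarrow> ('a, 'm) chart \<Rightarrow> real ^ 'm \<Rightarrow> 'a \<Rightarrow> ('a, 'm) tvec" where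
  "chart_vec M \<phi> a q = (\<lambda>\<psi>. if \<psi> \<in> charts_at M q
     then frechet_derivative (in_chart \<phi> (snd \<psi>)) (at (snd \<phi> q)) a else 0)"

lemma chart_vec_same: "manifold M \<Longrightarrow> \<phi> \<in> charts_at M q \<Longrightarrow> chart_vec M \<phi> a q \<phi> = a"
  by (simp add: chart_vec_def frechet_derivative_chart_self)

lemma chart_vec_tspace:
  assumes M: "manifold M" and \<phi>: "\<phi> \<in> charts_at M q"
  shows "chart_vec M \<phi> a q \<in> tspace M q"
proof (rule tspaceI)
  fix \<psi> \<theta> assume \<psi>: "\<psi> \<in> charts_at M q" and \<theta>: "\<theta> \<in> charts_at M q"
  note \<theta>' = charts_atD[OF \<theta>]
  show "chart_vec M \<phi> a q \<theta>
    = frechet_derivative (in_chart \<psi> (snd \<theta>)) (at (snd \<psi> q)) (chart_vec M \<phi> a q \<psi>)"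
    using frechet_derivative_chart_change[OF M openin_chart[OF M \<theta>'(1)]
      smooth_fun_chart[OF M openin_chart[OF M \<theta>'(1)] \<theta>'(1) order_refl] \<theta>'(2) \<phi> \<psi>] \<psi> \<theta>
    by (simp add: chart_vec_def)
qed (simp add: chart_vec_def)

lemma chart_vec_eq:
  assumes "manifold M" "\<phi> \<in> charts_at M q" "v \<in> tspace M q"
  shows "chart_vec M \<phi> (v \<phi>) q = v"
  by (rule tspace_eqI[OF chart_vec_tspace assms(3,2)]) (simp_all add: assms chart_vec_same)

lemma chart_vec_add:
  assumes "manifold M" "\<phi> \<in> charts_at M q"
  shows "chart_vec M \<phi> (a + b) q = chart_vec M \<phi> a q + chart_vec M \<phi> b q"
  by (rule tspace_eqI[OF chart_vec_tspace tspace_add assms(2)])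
     (simp_all add: assms chart_vec_same chart_vec_tspace)

lemma chart_vec_scaleR:
  assumes "manifold M" "\<phi> \<in> charts_at M q"
  shows "chart_vec M \<phi> (r *\<^sub>R a) q = r *\<^sub>R chart_vec M \<phi> a q"
  by (rule tspace_eqI[OF chart_vec_tspace tspace_scaleR assms(2)])
     (simp_all add: assms chart_vec_same chart_vec_tspace scaleR_fun_def)

section \<open>The inclusion of a submanifold and fields along it\<close>

locale submfd =
  fixes N :: "('a, 'n::finite) mfd" and M :: "('a, 'm::finite) mfd"
  assumes submanifold: "submanifold N M"
begin

lemma N: "manifold N" and M: "manifold M" and points_subset: "points N \<subseteq> points M"
  using submanifold by (simp_all add: submanifold_def)

lemma openin_restrict: "openin (mtop M) U \<Longrightarrow> openin (mtop N) (U \<inter> points N)"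
  using submanifold by (auto simp: submanifold_def openin_subtopology)

lemma openin_Int_chart_M:
  assumes "openin (mtop N) V" "\<psi> \<in> atlas M"
  shows "openin (mtop N) (V \<inter> fst \<psi>)"
proof -
  have "V \<inter> fst \<psi> = V \<inter> (fst \<psi> \<inter> points N)" using openin_subset[OF assms(1)] by (auto simp: points_def)
  then show ?thesis using openin_restrict[OF openin_chart[OF M assms(2)]] assms(1) by auto
qed

lemma smooth_chart_M:
  assumes "openin (mtop N) V" "\<psi> \<in> atlas M" "V \<subseteq> fst \<psi>"
  shows "smooth_fun N V (snd \<psi>)"
proof (rule smooth_fun_subset[of N "fst \<psi> \<inter> points N"])
  show "smooth_fun N (fst \<psi> \<inter> points N) (snd \<psi>)"
    using submanifold assms(2) unfolding submanifold_def by blast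
  show "V \<subseteq> fst \<psi> \<inter> points N"
    using openin_subset[OF assms(1)] assms(3) by (simp add: points_def)
qed

lemma smooth_in_chart_M:
  assumes V: "openin (mtop N) V" and U: "openin (mtop M) U" and f: "smooth_fun M U f"
    and \<psi>: "\<psi> \<in> atlas M" "V \<subseteq> fst \<psi>" and VU: "V \<subseteq> U"
  shows "smooth_fun N V (\<lambda>q. in_chart \<psi> f (snd \<psi> q))"
  by (rule smooth_fun_compose[OF N V open_chart_image[OF M \<psi>(1) U] _ smooth_funD[OF f \<psi>(1)] smooth_chart_M[OF V \<psi>]])
     (use VU \<psi>(2) in auto)

lemma smooth_fun_restrict:
  assumes V: "openin (mtop N) V" and U: "openin (mtop M) U" and f: "smooth_fun M U f" and VU: "V \<subseteq> U"
  shows "smooth_fun N V f"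
proof (rule smooth_fun_local[OF N])
  fix q assume q: "q \<in> V"
  then obtain \<psi> where \<psi>: "\<psi> \<in> charts_at M q" using ex_chart_at[OF M openin_points[OF U]] VU by blast
  note \<psi>' = charts_atD[OF \<psi>]
  let ?W = "V \<inter> fst \<psi>"
  have W: "openin (mtop N) ?W" by (rule openin_Int_chart_M[OF V \<psi>'(1)])
  have "smooth_fun N ?W (\<lambda>q. in_chart \<psi> f (snd \<psi> q))"
    by (rule smooth_in_chart_M[OF W U f \<psi>'(1)]) (use VU in auto)
  then have "smooth_fun N ?W f"
    using smooth_fun_cong[OF N W, of "\<lambda>q. in_chart \<psi> f (snd \<psi> q)" f] in_chart_at[OF M \<psi>'(1), of _ f] by auto
  then show "\<exists>W. openin (mtop N) W \<and> q \<in> W \<and> smooth_fun N W f" using W q \<psi>'(2) by blast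
qed

text \<open>Chain rule for the restriction of \<open>f\<close> to \<open>N\<close>, written as
  \<open>in_chart \<psi> f \<circ> snd \<psi>\<close>. For \<open>f\<close> the map of another chart
  of \<open>M\<close> it becomes the transformation rule that makes \<open>dincl N M q x\<close> a
  tangent vector of \<open>M\<close>.\<close>

lemma dd_in_chart_M:
  assumes U: "openin (mtop M) U" and f: "smooth_fun M U f" and q: "q \<in> U" "q \<in> points N" and x: "x \<in> tspace N q"
    and \<psi>: "\<psi> \<in> charts_at M q"
  shows "frechet_derivative (in_chart \<psi> f) (at (snd \<psi> q)) (dd N q x (snd \<psi>)) = dd N q x f"
proof -
  note \<psi>' = charts_atD[OF \<psi>]
  let ?W = "(U \<inter> points N) \<inter> fst \<psi>"
  have W: "openin (mtop N) ?W" by (rule openin_Int_chart_M[OF openin_restrict[OF U] \<psi>'(1)])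
  have qW: "q \<in> ?W" using q \<psi>' by simp
  have "dd N q x f = dd N q x (\<lambda>r. in_chart \<psi> f (snd \<psi> r))"
    by (rule dd_cong[OF N W qW]) (simp add: in_chart_at[OF M \<psi>'(1)])
  also have "\<dots> = frechet_derivative (in_chart \<psi> f) (at (snd \<psi> q)) (dd N q x (snd \<psi>))"
    by (rule dd_compose[OF N W qW x smooth_chart_M[OF W \<psi>'(1) Int_lower2]
        has_derivative_in_chart[OF M U f q(1) \<psi>]])
  finally show ?thesis by simp
qed

lemma dincl_chart: "\<psi> \<in> charts_at M q \<Longrightarrow> dincl N M q x \<psi> = dd N q x (snd \<psi>)"
  by (simp add: dincl_def)

lemma dincl_tspace:
  assumes "q \<in> points N" "x \<in> tspace N q"
  shows "dincl N M q x \<in> tspace M q"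
proof (rule tspaceI)
  fix \<phi> \<psi> assume \<phi>: "\<phi> \<in> charts_at M q" and \<psi>: "\<psi> \<in> charts_at M q"
  note \<psi>' = charts_atD[OF \<psi>]
  show "dincl N M q x \<psi> = frechet_derivative (in_chart \<phi> (snd \<psi>)) (at (snd \<phi> q)) (dincl N M q x \<phi>)"
    using dd_in_chart_M[OF openin_chart[OF M \<psi>'(1)] smooth_fun_chart[OF M openin_chart[OF M \<psi>'(1)] \<psi>'(1) order_refl]
       \<psi>'(2) assms \<phi>] by (simp add: dincl_chart \<phi> \<psi>)
qed (simp add: dincl_def)

lemma dd_restrict:
  assumes U: "openin (mtop M) U" and f: "smooth_fun M U f" and q: "q \<in> U" "q \<in> points N" and x: "x \<in> tspace N q"
  shows "dd M q (dincl N M q x) f = dd N q x f"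
proof -
  obtain \<psi> where \<psi>: "\<psi> \<in> charts_at M q" using ex_chart_at[OF M openin_points[OF U q(1)]] by blast
  show ?thesis
    using dd_eq[OF M U f q(1) \<psi> dincl_tspace[OF q(2) x]] dd_in_chart_M[OF U f q x \<psi>] dincl_chart[OF \<psi>] by simp
qed

lemma dincl_lincomb:
  assumes q: "q \<in> points N" and x: "x \<in> tspace N q" "y \<in> tspace N q"
  shows "dincl N M q (a *\<^sub>R x + b *\<^sub>R y) = a *\<^sub>R dincl N M q x + b *\<^sub>R dincl N M q y"
proof
  fix \<psi>
  show "dincl N M q (a *\<^sub>R x + b *\<^sub>R y) \<psi> = (a *\<^sub>R dincl N M q x + b *\<^sub>R dincl N M q y) \<psi>"
  proof (cases "\<psi> \<in> charts_at M q")
    case True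
    note \<psi>' = charts_atD[OF True]
    let ?W = "points N \<inter> fst \<psi>"
    have W: "openin (mtop N) ?W"
      by (rule openin_Int_chart_M[OF _ \<psi>'(1)]) (simp add: points_def)
    show ?thesis
      using dd_lincomb[OF N W _ smooth_chart_M[OF W \<psi>'(1) Int_lower2] x] q \<psi>'(2)
      by (simp add: dincl_chart[OF True] scaleR_fun_def)
  qed (simp add: dincl_def scaleR_fun_def)
qed

lemma inj_on_dincl: "q \<in> points N \<Longrightarrow> inj_on (dincl N M q) (tspace N q)"
  using submanifold by (simp add: submanifold_def)

lemma tfield_local:
  assumes V: "openin (mtop N) V"
    and "\<And>q. q \<in> V \<Longrightarrow> \<exists>W. q \<in> W \<and> W \<subseteq> V \<and> tfield N M W s"
  shows "tfield N M V s"
proof (rule tfieldI[OF V])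
  fix q assume "q \<in> V"
  then obtain W where "q \<in> W" "tfield N M W s" using assms(2) by blast
  then show "s q \<in> tspace M q" using tfield_tspace[of N M W s q] by blast
next
  fix \<psi> assume \<psi>: "\<psi> \<in> atlas M"
  show "smooth_fun N (V \<inter> fst \<psi>) (\<lambda>q. s q \<psi>)"
  proof (rule smooth_fun_local[OF N])
    fix q assume "q \<in> V \<inter> fst \<psi>"
    then obtain W where W: "q \<in> W" "W \<subseteq> V" "tfield N M W s" "q \<in> fst \<psi>" using assms(2) by blast
    then show "\<exists>W. openin (mtop N) W \<and> q \<in> W \<and> smooth_fun N W (\<lambda>q. s q \<psi>)"
      using openin_Int_chart_M[OF tfield_openin[OF W(3)] \<psi>] tfield_smooth[OF W(3) \<psi>] by blast
  qed
qed

lemma tfield_eq_on: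
  assumes "tfield N M V s" "\<And>q. q \<in> V \<Longrightarrow> s q = t q"
  shows "tfield N M V t"
  by (rule tfield_cong[OF N M assms openin_Int_chart_M[OF tfield_openin[OF assms(1)]]])

lemma tfield_chart_vec:
  assumes V: "openin (mtop N) V" and \<psi>: "\<psi> \<in> atlas M" "V \<subseteq> fst \<psi>" and a: "smooth_fun N V a"
  shows "tfield N M V (\<lambda>q. chart_vec M \<psi> (a q) q)"
proof (rule tfieldI[OF V])
  fix q assume q: "q \<in> V"
  then show "chart_vec M \<psi> (a q) q \<in> tspace M q"
    using \<psi> by (intro chart_vec_tspace[OF M] charts_atI) auto
next
  fix \<theta> assume \<theta>: "\<theta> \<in> atlas M"
  let ?W = "V \<inter> fst \<theta>"
  let ?F = "\<lambda>b q. frechet_derivative (in_chart \<psi> (snd \<theta>)) (at (snd \<psi> q)) b"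
  have W: "openin (mtop N) ?W" by (rule openin_Int_chart_M[OF V \<theta>])
  have S: "open (snd \<psi> ` (fst \<psi> \<inter> fst \<theta>))" by (rule open_chart_image[OF M \<psi>(1) openin_chart[OF M \<theta>]])
  have F: "C_inf (snd \<psi> ` (fst \<psi> \<inter> fst \<theta>)) (in_chart \<psi> (snd \<theta>))"
    by (rule smooth_funD[OF smooth_fun_chart[OF M openin_chart[OF M \<theta>] \<theta> order_refl] \<psi>(1)])
  have smF: "smooth_fun N ?W (?F b)" for b
    by (rule smooth_fun_compose[OF N W S _ C_inf_frechet[OF F] smooth_chart_M[OF W \<psi>(1)]])
       (use \<psi>(2) in auto)
  have sma: "smooth_fun N ?W (\<lambda>q. a q \<bullet> b)" for b
    by (rule smooth_fun_linear[OF N W, of "\<lambda>y. y \<bullet> b" a])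
       (auto intro: linearI smooth_fun_subset[OF a] simp: inner_add_left)
  have "smooth_fun N ?W (\<lambda>q. \<Sum>b\<in>Basis. (a q \<bullet> b) *\<^sub>R ?F b q)"
    by (intro smooth_fun_sum[OF N W] smooth_fun_scaleR[OF N W] sma smF)
  moreover have "(\<Sum>b\<in>Basis. (a q \<bullet> b) *\<^sub>R ?F b q) = chart_vec M \<psi> (a q) q \<theta>" if "q \<in> ?W" for q
  proof -
    have \<psi>q: "\<psi> \<in> charts_at M q" and \<theta>q: "\<theta> \<in> charts_at M q" using that \<psi> \<theta> by (auto intro: charts_atI)
    show ?thesis
      using linear_eq_basis_sum[OF linear_transition[OF M \<psi>q \<theta>q], of "a q"] \<theta>q by (simp add: chart_vec_def)
  qed
  ultimately show "smooth_fun N ?W (\<lambda>q. chart_vec M \<psi> (a q) q \<theta>)"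
    using smooth_fun_cong[OF N W, of "\<lambda>q. \<Sum>b\<in>Basis. (a q \<bullet> b) *\<^sub>R ?F b q" "\<lambda>q. chart_vec M \<psi> (a q) q \<theta>"] by blast
qed

text \<open>Components in one chart covering \<open>V\<close> suffice, because the components in any
  other chart arise from them through the Jacobian of the coordinate change, which is
  smooth.\<close>

lemma tfield_chartI:
  assumes V: "openin (mtop N) V" and \<psi>: "\<psi> \<in> atlas M" "V \<subseteq> fst \<psi>"
    and s: "\<And>q. q \<in> V \<Longrightarrow> s q \<in> tspace M q" and sm: "smooth_fun N V (\<lambda>q. s q \<psi>)"
  shows "tfield N M V s"
proof (rule tfield_eq_on[OF tfield_chart_vec[OF V \<psi> sm]])
  fix q assume "q \<in> V"
  then show "chart_vec M \<psi> (s q \<psi>) q = s q"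
    using \<psi> s by (intro chart_vec_eq[OF M] charts_atI) auto
qed

lemma tfield_dincl:
  assumes X: "tfield N N V X"
  shows "tfield N M V (\<lambda>q. dincl N M q (X q))"
proof (rule tfieldI[OF tfield_openin[OF X]])
  note V = tfield_openin[OF X]
  show "dincl N M q (X q) \<in> tspace M q" if "q \<in> V" for q
    by (rule dincl_tspace[OF openin_points[OF V that] tfield_tspace[OF X that]])
  fix \<psi> assume \<psi>: "\<psi> \<in> atlas M"
  let ?W = "V \<inter> fst \<psi>"
  have W: "openin (mtop N) ?W" by (rule openin_Int_chart_M[OF V \<psi>])
  have "smooth_fun N ?W (\<lambda>q. dd N q (X q) (snd \<psi>))"
    by (rule smooth_fun_dd[OF N tfield_subset[OF X W Int_lower1] smooth_chart_M[OF W \<psi> Int_lower2]])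
  then show "smooth_fun N ?W (\<lambda>q. dincl N M q (X q) \<psi>)"
    using smooth_fun_cong[OF N W, of "\<lambda>q. dd N q (X q) (snd \<psi>)" "\<lambda>q. dincl N M q (X q) \<psi>"] dincl_chart charts_atI[OF \<psi>]
    by auto
qed

lemma tfield_restrict:
  assumes X: "tfield M M U X" and V: "openin (mtop N) V" "V \<subseteq> U"
  shows "tfield N M V X"
proof (rule tfieldI[OF V(1)])
  show "X q \<in> tspace M q" if "q \<in> V" for q using tfield_tspace[OF X] that V(2) by blast
  fix \<psi> assume \<psi>: "\<psi> \<in> atlas M"
  show "smooth_fun N (V \<inter> fst \<psi>) (\<lambda>q. X q \<psi>)"
    by (rule smooth_fun_restrict[OF openin_Int_chart_M[OF V(1) \<psi>] openin_Int_chart[OF M \<psi> tfield_openin[OF X]] tfield_smooth[OF X \<psi>]])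
       (use V(2) in auto)
qed

end

lemma dincl_self:
  assumes M: "manifold M" and x: "x \<in> tspace M p"
  shows "dincl M M p x = x"
proof
  fix \<psi>
  show "dincl M M p x \<psi> = x \<psi>"
    using dd_chart[OF M _ x, of \<psi>] tspaceD(1)[OF x, of \<psi>] by (simp add: dincl_def)
qed

text \<open>Makes the lemmas on fields along a submanifold available for vector fields on a single
  manifold, both for \<open>M\<close> and for \<open>N\<close>.\<close>

lemma submfd_self:
  assumes M: "manifold M"
  shows "submfd M M"
proof
  have "inj_on (dincl M M p) (tspace M p)" for p
    by (rule inj_onI) (simp add: dincl_self[OF M])
  moreover have "smooth_fun M (fst \<psi> \<inter> points M) (snd \<psi>)" if "\<psi> \<in> atlas M" for \<psi>
    by (rule smooth_fun_chart[OF M _ that]) (auto simp: points_def intro!: openin_Int openin_chart[OF M that])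
  ultimately show "submanifold M M"
    using M by (simp add: submanifold_def points_def)
qed

section \<open>Frames and induced connections in a chart\<close>

lemma sum_fun_at: "(\<Sum>i\<in>I. g i) z = (\<Sum>i\<in>I. g i z)"
  by (induction I rule: infinite_finite_induct) auto

text \<open>Jacobi's formula: multiplication by \<open>B\<close> moves \<open>A\<close> to the
  identity matrix, where the derivative of the determinant is the trace, and \<open>det A\<close>
  undoes the factor introduced by \<open>B\<close>.\<close>

lemma has_derivative_det:
  fixes A B :: "real^'n^'n"
  assumes "B ** A = mat 1"
  shows "(det has_derivative (\<lambda>H. det A * trace (B ** H))) (at A)"
proof -
  have AB: "A ** B = mat 1" using assms matrix_left_right_inverse by metis
  have lin: "linear (\<lambda>X::real^'n^'n. B ** X)"
    by (auto intro!: linearI simp: matrix_matrix_mult_def vec_eq_iff sum.distrib sum_distrib_left algebra_simps)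
  have "((\<lambda>X. det (B ** X)) has_derivative (\<lambda>H. trace (B ** H))) (at A)"
    by (rule has_derivative_compose[OF linear_imp_has_derivative[OF lin]])
       (simp add: assms has_derivative_det_mat_1)
  then have "((\<lambda>X. det A * det (B ** X)) has_derivative (\<lambda>H. det A * trace (B ** H))) (at A)"
    by (rule has_derivative_mult_right)
  moreover have "det A * det (B ** X) = det X" for X
    by (metis AB det_mul matrix_mul_assoc matrix_mul_lid)
  ultimately show ?thesis by simp
qed

text \<open>Near \<open>y\<close> the sign is constant, so the absolute value may be replaced by
  multiplication with \<open>sgn y\<close>.\<close>

lemma has_derivative_abs_powr:
  assumes "y \<noteq> (0::real)"
  shows "((\<lambda>y. \<bar>y\<bar> powr k) has_derivative (\<lambda>h. k * \<bar>y\<bar> powr k / y * h)) (at y)"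
proof -
  let ?S = "if y > 0 then {0<..} else {..<0::real}"
  have "((\<lambda>z. (sgn y * z) powr k) has_derivative (\<lambda>h. k * \<bar>y\<bar> powr k / y * h)) (at y)"
    using assms by (auto intro!: derivative_eq_intros simp: powr_diff sgn_if abs_if field_simps)
  then show ?thesis
    by (rule has_derivative_transform_within_open[of _ _ _ _ ?S]) (use assms in \<open>auto simp: sgn_if split: if_splits\<close>)
qed

lemma has_derivative_abs_det_powr:
  fixes A B :: "real^'n^'n"
  assumes "B ** A = mat 1"
  shows "((\<lambda>X. \<bar>det X\<bar> powr k) has_derivative (\<lambda>H. k * \<bar>det A\<bar> powr k * trace (B ** H))) (at A)"
proof -
  have "det A \<noteq> 0" by (metis assms det_I det_mul mult_zero_right zero_neq_one)
  then show ?thesis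
    using has_derivative_compose[OF has_derivative_det[OF assms] has_derivative_abs_powr] by (simp add: mult.assoc)
qed

section \<open>Frames and weighted fibres in a chart\<close>

definition chart_frame :: "('a, 'm::finite) mfd \<Rightarrow> ('a, 'm) chart \<Rightarrow> 'a \<Rightarrow> ('a, 'm) frame" where
  "chart_frame M \<psi> q = (\<lambda>i. chart_vec M \<psi> (axis i 1) q)"

definition frame_mat :: "('a, 'm::finite) chart \<Rightarrow> ('a, 'm) frame \<Rightarrow> real ^ 'm ^ 'm" where
  "frame_mat \<psi> f = (\<chi> i j. f j \<psi> $ i)"

lemma frame_mat_mult: "frame_mat \<psi> f *v a = (\<Sum>i\<in>UNIV. a $ i *\<^sub>R f i \<psi>)"
  by (simp add: frame_mat_def matrix_vector_mult_def vec_eq_iff mult.commute)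

lemma frame_sum_chart: "(\<Sum>i\<in>UNIV. a $ i *\<^sub>R f i) \<psi> = frame_mat \<psi> f *v a"
  by (simp add: sum_fun_at scaleR_fun_def frame_mat_mult)

lemma frame_mat_act: "frame_mat \<psi> (frame_act f A) = frame_mat \<psi> f ** A"
  by (simp add: frame_mat_def frame_act_def matrix_matrix_mult_def vec_eq_iff sum_fun_at scaleR_fun_def mult.commute)

lemma inv_if_invertible:
  fixes A :: "real^'n^'n"
  assumes "invertible A"
  obtains B where "B ** A = mat 1" "A ** B = mat 1" "\<And>v. B *v (A *v v) = v" "\<And>v. A *v (B *v v) = v"
proof -
  obtain B where "A ** B = mat 1" "B ** A = mat 1" using assms by (auto simp: invertible_def)
  then show ?thesis using that[of B] by (simp add: matrix_vector_mul_assoc)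
qed

text \<open>Trivialisation of \<open>E \<otimes> L\<^sup>k\<close> by the coordinate frame: the
  equivariant function whose value on \<open>chart_frame M \<psi> q\<close>, a frame with matrix 1,
  is \<open>a\<close>.\<close>

definition chart_weighted ::
    "('a, 'm::finite) mfd \<Rightarrow> ('a, 'm) chart \<Rightarrow> real \<Rightarrow> 'a \<Rightarrow> 'v::real_vector \<Rightarrow> ('a, 'm) frame \<Rightarrow> 'v" where
  "chart_weighted M \<psi> k q a = (\<lambda>f. if frame_at M q f
     then \<bar>det (frame_mat \<psi> f)\<bar> powr (- (k / real CARD('m))) *\<^sub>R a else 0)"

context
  fixes M :: "('a, 'm::finite) mfd" and \<psi> :: "('a, 'm) chart" and q :: 'a
  assumes M: "manifold M" and \<psi>: "\<psi> \<in> charts_at M q"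
begin

lemma frame_sum_tspace:
  assumes "\<And>i. f i \<in> tspace M q"
  shows "(\<Sum>i\<in>UNIV. (a :: real^'m) $ i *\<^sub>R f i) \<in> tspace M q"
  by (rule tspace_sum[OF M]) (auto intro: tspace_scaleR[OF M] assms)

lemma eq_frame_sum_iff:
  assumes "\<And>i. f i \<in> tspace M q" "v \<in> tspace M q"
  shows "v = (\<Sum>i\<in>UNIV. (a :: real^'m) $ i *\<^sub>R f i) \<longleftrightarrow> frame_mat \<psi> f *v a = v \<psi>"
proof
  assume v: "v = (\<Sum>i\<in>UNIV. a $ i *\<^sub>R f i)"
  show "frame_mat \<psi> f *v a = v \<psi>" unfolding v by (rule frame_sum_chart[symmetric])
next
  assume "frame_mat \<psi> f *v a = v \<psi>"
  then show "v = (\<Sum>i\<in>UNIV. a $ i *\<^sub>R f i)"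
    by (intro tspace_eqI[OF assms(2) frame_sum_tspace[OF assms(1)] \<psi>]) (simp only: frame_sum_chart)
qed

text \<open>The component in \<open>\<psi>\<close> identifies \<open>tspace M q\<close> with
  \<open>real ^ 'm\<close>; unique expansion in \<open>f\<close> then says that multiplication by
  the matrix of \<open>f\<close> is bijective.\<close>

lemma frame_at_iff: "frame_at M q f \<longleftrightarrow> (\<forall>i. f i \<in> tspace M q) \<and> invertible (frame_mat \<psi> f)"
proof (cases "\<forall>i. f i \<in> tspace M q")
  case True
  have "(\<forall>v\<in>tspace M q. \<exists>!a :: real ^ 'm. v = (\<Sum>i\<in>UNIV. a $ i *\<^sub>R f i))
      \<longleftrightarrow> (\<forall>v\<in>tspace M q. \<exists>!a. frame_mat \<psi> f *v a = v \<psi>)"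
    using eq_frame_sum_iff[of f] True by (intro ball_cong refl) simp
  also have "\<dots> \<longleftrightarrow> (\<forall>b. \<exists>!a. frame_mat \<psi> f *v a = b)"
  proof
    assume L: "\<forall>v\<in>tspace M q. \<exists>!a. frame_mat \<psi> f *v a = v \<psi>"
    show "\<forall>b. \<exists>!a. frame_mat \<psi> f *v a = b"
    proof
      fix b
      show "\<exists>!a. frame_mat \<psi> f *v a = b"
        using bspec[OF L chart_vec_tspace[OF M \<psi>, of b]] chart_vec_same[OF M \<psi>, of b] by simp
    qed
  qed blast
  also have "\<dots> \<longleftrightarrow> invertible (frame_mat \<psi> f)"
    unfolding invertible_eq_bij bij_iff ..
  finally show ?thesis using True by (simp add: frame_at_def)
next
  case False
  then show ?thesis unfolding frame_at_def by blast
qed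

lemma frame_coord_chart:
  assumes f: "frame_at M q f" and v: "v \<in> tspace M q"
  shows "frame_mat \<psi> f *v frame_coord f v = v \<psi>"
proof -
  have "\<exists>!a. v = (\<Sum>i\<in>UNIV. (a :: real^'m) $ i *\<^sub>R f i)" using f v unfolding frame_at_def by blast
  then have "v = (\<Sum>i\<in>UNIV. frame_coord f v $ i *\<^sub>R f i)"
    unfolding frame_coord_def by (rule theI')
  then show ?thesis using f v eq_frame_sum_iff[of f v] by (simp add: frame_at_def)
qed

lemma chart_frame_mat: "frame_mat \<psi> (chart_frame M \<psi> q) = mat 1"
  by (simp add: frame_mat_def chart_frame_def chart_vec_same[OF M \<psi>] mat_def axis_def vec_eq_iff)

lemma chart_frame_at: "frame_at M q (chart_frame M \<psi> q)"
  unfolding frame_at_iff chart_frame_mat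
  by (auto simp: chart_frame_def chart_vec_tspace[OF M \<psi>] invertible_def)

lemma frame_act_tspace:
  assumes "\<And>i. f i \<in> tspace M q"
  shows "frame_act f A i \<in> tspace M q"
proof -
  have "frame_act f A i = (\<Sum>j\<in>UNIV. (\<chi> j. A $ j $ i) $ j *\<^sub>R f j)" by (simp add: frame_act_def)
  then show ?thesis using frame_sum_tspace[of f "\<chi> j. A $ j $ i"] assms by simp
qed

lemma frame_act_frame_at:
  assumes "frame_at M q f" "invertible A"
  shows "frame_at M q (frame_act f A)"
  using assms frame_act_tspace[of f] unfolding frame_at_iff frame_mat_act
  by (simp add: invertible_mult)

lemma frame_eq_act_chart_frame:
  assumes f: "\<And>i. f i \<in> tspace M q"
  shows "f = frame_act (chart_frame M \<psi> q) (frame_mat \<psi> f)"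
proof
  fix i
  have c: "\<And>i. chart_frame M \<psi> q i \<in> tspace M q" using chart_frame_at by (simp add: frame_at_iff)
  have "frame_mat \<psi> (frame_act (chart_frame M \<psi> q) (frame_mat \<psi> f)) = frame_mat \<psi> f"
    by (simp add: frame_mat_act chart_frame_mat)
  then have "f i \<psi> = frame_act (chart_frame M \<psi> q) (frame_mat \<psi> f) i \<psi>"
    by (simp add: frame_mat_def vec_eq_iff)
  then show "f i = frame_act (chart_frame M \<psi> q) (frame_mat \<psi> f) i"
    by (rule tspace_eqI[OF f frame_act_tspace[OF c] \<psi>])
qed

text \<open>Every frame is the coordinate frame acted on by its own matrix, so equivariance
  determines \<open>l\<close> by a single value.\<close>

lemma weighted_eq_chart_frame:
  assumes l: "l \<in> weighted M k q E" and f: "frame_at M q f"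
  shows "l f = \<bar>det (frame_mat \<psi> f)\<bar> powr (- (k / real CARD('m))) *\<^sub>R l (chart_frame M \<psi> q)"
proof -
  have "f = frame_act (chart_frame M \<psi> q) (frame_mat \<psi> f)" "invertible (frame_mat \<psi> f)"
    using f frame_eq_act_chart_frame[of f] by (simp_all add: frame_at_iff)
  moreover have "l (frame_act (chart_frame M \<psi> q) A) = \<bar>det A\<bar> powr (- (k / real CARD('m))) *\<^sub>R l (chart_frame M \<psi> q)"
    if "invertible A" for A
    using l chart_frame_at that by (simp add: weighted_def)
  ultimately show ?thesis by metis
qed

lemma weighted_eqI:
  assumes l: "l \<in> weighted M k q E" "l' \<in> weighted M k q E'"
    and eq: "l (chart_frame M \<psi> q) = l' (chart_frame M \<psi> q)"
  shows "l = l'"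
proof
  fix f
  show "l f = l' f"
  proof (cases "frame_at M q f")
    case True
    show ?thesis unfolding weighted_eq_chart_frame[OF l(1) True] weighted_eq_chart_frame[OF l(2) True] eq ..
  next
    case False
    then show ?thesis using l by (simp add: weighted_def)
  qed
qed

lemma chart_weighted_mem:
  assumes "\<And>r. r *\<^sub>R a \<in> E"
  shows "chart_weighted M \<psi> k q a \<in> weighted M k q E"
  using assms frame_act_frame_at
  by (auto simp: weighted_def chart_weighted_def frame_mat_act det_mul abs_mult powr_mult mult.commute)

lemma chart_weighted_chart_frame: "chart_weighted M \<psi> k q a (chart_frame M \<psi> q) = a"
  by (simp add: chart_weighted_def chart_frame_at chart_frame_mat)

end

section \<open>Connection matrices, pulled-back connections and connections on densities\<close>

definition christoffel ::
    "('a, 'm::finite) mfd \<Rightarrow> ('a, 'm, 'm) cderiv \<Rightarrow> ('a, 'm) chart \<Rightarrow> 'a \<Rightarrow> ('a, 'm) tvec \<Rightarrow> real ^ 'm ^ 'm" where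
  "christoffel M D \<psi> p v = frame_mat \<psi> (\<lambda>j. D p v (\<lambda>q. chart_frame M \<psi> q j))"

text \<open>Says that \<open>K\<close> is \<open>d + B\<close> at \<open>p\<close> in the chart.
  Keeping \<open>K\<close> abstract lets \<open>dens_conn_eq\<close> apply both to a connection on
  \<open>M\<close> and to its pull-back to \<open>N\<close>.\<close>

definition conn_form ::
    "('a, 'n::finite) mfd \<Rightarrow> ('a, 'm::finite) mfd \<Rightarrow> ('a, 'n, 'm) cderiv \<Rightarrow> ('a, 'm) chart \<Rightarrow>
     'a \<Rightarrow> ('a, 'n) tvec \<Rightarrow> real ^ 'm ^ 'm \<Rightarrow> bool" where
  "conn_form N M K \<psi> p x B \<longleftrightarrow> (\<forall>W s. tfield N M W s \<and> p \<in> W \<longrightarrow>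
     K p x s \<in> tspace M p \<and> K p x s \<psi> = dd N p x (\<lambda>q. s q \<psi>) + B *v s p \<psi>)"

lemma conn_formD:
  assumes "conn_form N M K \<psi> p x B" "tfield N M W s" "p \<in> W"
  shows "K p x s \<in> tspace M p" "K p x s \<psi> = dd N p x (\<lambda>q. s q \<psi>) + B *v s p \<psi>"
  using assms unfolding conn_form_def by blast+

lemma frame_field_frame_at: "frame_field N M W e \<Longrightarrow> q \<in> W \<Longrightarrow> frame_at M q (e q)"
  and frame_field_tfield: "frame_field N M W e \<Longrightarrow> tfield N M W (\<lambda>q. e q i)"
  by (simp_all add: frame_field_def)

lemma frame_field_openin: "frame_field N M W e \<Longrightarrow> openin (mtop N) W"
  using frame_field_tfield[of N M W e undefined] tfield_openin by blast

lemma connectionD: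
  assumes "connection M D" "tfield M M U s" "p \<in> U" "v \<in> tspace M p"
  shows "D p v s \<in> tspace M p"
    "w \<in> tspace M p \<Longrightarrow> D p (a *\<^sub>R v + b *\<^sub>R w) s = a *\<^sub>R D p v s + b *\<^sub>R D p w s"
    "tfield M M U t \<Longrightarrow> D p v (\<lambda>q. s q + t q) = D p v s + D p v t"
    "smooth_fun M U f \<Longrightarrow> D p v (\<lambda>q. f q *\<^sub>R s q) = dd M p v f *\<^sub>R s p + f p *\<^sub>R D p v s"
    "(\<And>q. q \<in> U \<Longrightarrow> s q = t q) \<Longrightarrow> D p v s = D p v t"
  using assms unfolding connection_def by blast+

lemma connection_tfield:
  "connection M D \<Longrightarrow> tfield M M U s \<Longrightarrow> tfield M M U X \<Longrightarrow> tfield M M U (\<lambda>q. D q (X q) s)"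
  unfolding connection_def by blast

context submfd
begin

lemma frame_field_chart_act:
  assumes V: "openin (mtop N) V" and \<psi>: "\<psi> \<in> atlas M" "V \<subseteq> fst \<psi>" and A: "invertible A"
  shows "frame_field N M V (\<lambda>q. frame_act (chart_frame M \<psi> q) A)"
  unfolding frame_field_def
proof (intro conjI allI ballI)
  show "frame_at M q (frame_act (chart_frame M \<psi> q) A)" if "q \<in> V" for q
    using that \<psi> by (intro frame_act_frame_at[OF M] chart_frame_at[OF M] A charts_atI) auto
  fix i
  show "tfield N M V (\<lambda>q. frame_act (chart_frame M \<psi> q) A i)"
  proof (rule tfield_chartI[OF V \<psi>])
    fix q assume q: "q \<in> V"
    then have \<psi>q: "\<psi> \<in> charts_at M q" using \<psi> by (intro charts_atI) auto
    show "frame_act (chart_frame M \<psi> q) A i \<in> tspace M q"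
      by (rule frame_act_tspace[OF M \<psi>q]) (use chart_frame_at[OF M \<psi>q] in \<open>simp add: frame_at_iff[OF M \<psi>q]\<close>)
  next
    have "frame_act (chart_frame M \<psi> q) A i \<psi> = column i A" if "q \<in> V" for q
    proof -
      have \<psi>q: "\<psi> \<in> charts_at M q" using \<psi> that by (intro charts_atI) auto
      have "frame_mat \<psi> (frame_act (chart_frame M \<psi> q) A) = A"
        by (simp add: frame_mat_act chart_frame_mat[OF M \<psi>q])
      then show ?thesis by (simp add: frame_mat_def vec_eq_iff column_def)
    qed
    then show "smooth_fun N V (\<lambda>q. frame_act (chart_frame M \<psi> q) A i \<psi>)"
      using smooth_fun_cong[OF N V, of "\<lambda>q. frame_act (chart_frame M \<psi> q) A i \<psi>" "\<lambda>q. column i A"]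
        smooth_fun_const by blast
  qed
qed

lemma frame_field_chart:
  assumes "openin (mtop N) V" "\<psi> \<in> atlas M" "V \<subseteq> fst \<psi>"
  shows "frame_field N M V (chart_frame M \<psi>)"
proof -
  have "frame_act f (mat 1) = f" for f :: "('a, 'm) frame"
    by (simp add: frame_act_def mat_def if_distrib[of "\<lambda>r. r *\<^sub>R _"] cong: if_cong)
  moreover have "invertible (mat 1 :: real^'m^'m)" by (auto simp: invertible_def)
  ultimately show ?thesis using frame_field_chart_act[OF assms, of "mat 1"] by simp
qed

lemma tfield_chart_frame:
  assumes "openin (mtop N) V" "\<psi> \<in> atlas M" "V \<subseteq> fst \<psi>"
  shows "tfield N M V (\<lambda>q. chart_frame M \<psi> q i)"
  by (rule frame_field_tfield[OF frame_field_chart[OF assms]])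

lemma smooth_frame_mat:
  assumes "frame_field N M W e" "\<psi> \<in> atlas M"
  shows "smooth_fun N (W \<inter> fst \<psi>) (\<lambda>q. frame_mat \<psi> (e q))"
proof -
  have W: "openin (mtop N) (W \<inter> fst \<psi>)" by (rule openin_Int_chart_M[OF frame_field_openin[OF assms(1)] assms(2)])
  show ?thesis
    unfolding frame_mat_def
    by (intro smooth_fun_vec_lambda[OF N W] smooth_fun_vec_nth[OF N W]
        tfield_smooth[OF frame_field_tfield[OF assms(1)] assms(2)])
qed

lemma smooth_frame_coord:
  assumes e: "frame_field N M W e" and s: "tfield N M V s" and \<psi>: "\<psi> \<in> atlas M"
  shows "smooth_fun N (W \<inter> V \<inter> fst \<psi>) (\<lambda>q. frame_coord (e q) (s q))"
proof -
  let ?U = "W \<inter> V \<inter> fst \<psi>"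
  have U: "openin (mtop N) ?U"
    by (intro openin_Int_chart_M openin_Int \<psi> frame_field_openin[OF e] tfield_openin[OF s])
  show ?thesis
  proof (rule smooth_fun_solve[OF N U])
    show "smooth_fun N ?U (\<lambda>q. frame_mat \<psi> (e q))"
      by (rule smooth_fun_subset[OF smooth_frame_mat[OF e \<psi>]]) auto
    have sol: "frame_mat \<psi> (e q) *v frame_coord (e q) (s q) = s q \<psi>" if "q \<in> ?U" for q
      using that frame_coord_chart[OF M charts_atI[OF \<psi>] frame_field_frame_at[OF e] tfield_tspace[OF s], of q] by simp
    have "smooth_fun N ?U (\<lambda>q. s q \<psi>)"
      by (rule smooth_fun_subset[OF tfield_smooth[OF s \<psi>]]) auto
    then show "smooth_fun N ?U (\<lambda>q. frame_mat \<psi> (e q) *v frame_coord (e q) (s q))"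
      using smooth_fun_cong[OF N U, of "\<lambda>q. frame_mat \<psi> (e q) *v frame_coord (e q) (s q)" "\<lambda>q. s q \<psi>"] sol by blast
    show "det (frame_mat \<psi> (e q)) \<noteq> 0" if "q \<in> ?U" for q
      using frame_field_frame_at[OF e, of q] that charts_atI[OF \<psi>, of q] frame_at_iff[OF M, of \<psi> q "e q"]
      by (simp add: invertible_det_nz)
  qed
qed

end

lemma connection_sum:
  assumes M: "manifold M" and D: "connection M D" and e: "\<And>j. j \<in> J \<Longrightarrow> tfield M M U (e j)"
    and a: "\<And>j. j \<in> J \<Longrightarrow> smooth_fun M U (a j)" and \<psi>: "\<psi> \<in> atlas M" "U \<subseteq> fst \<psi>"
    and U: "openin (mtop M) U" and p: "p \<in> U" and v: "v \<in> tspace M p" and J: "finite J"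
  shows "tfield M M U (\<lambda>q. \<Sum>j\<in>J. a j q *\<^sub>R e j q)"
    and "D p v (\<lambda>q. \<Sum>j\<in>J. a j q *\<^sub>R e j q) = (\<Sum>j\<in>J. dd M p v (a j) *\<^sub>R e j p + a j p *\<^sub>R D p v (e j))"
proof -
  interpret MM: submfd M M by (rule submfd_self[OF M])
  have tf: "tfield M M U (\<lambda>q. \<Sum>j\<in>I. a j q *\<^sub>R e j q)" if "I \<subseteq> J" for I
  proof (rule MM.tfield_chartI[OF U \<psi>])
    fix q assume q: "q \<in> U"
    have "\<psi> \<in> charts_at M q" using q \<psi> by (intro charts_atI) auto
    then have "0 \<in> tspace M q" using tspace_zero[OF M chart_vec_tspace[OF M]] by blast
    then show "(\<Sum>j\<in>I. a j q *\<^sub>R e j q) \<in> tspace M q"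
      by (rule tspace_sum[OF M]) (use e that q in \<open>auto intro!: tspace_scaleR[OF M] tfield_tspace\<close>)
  next
    have "smooth_fun M U (\<lambda>q. e j q \<psi>)" if "j \<in> J" for j
      using smooth_fun_subset[OF tfield_smooth[OF e[OF that] \<psi>(1)]] \<psi>(2) by blast
    then have "smooth_fun M U (\<lambda>q. \<Sum>j\<in>I. a j q *\<^sub>R e j q \<psi>)"
      using that by (intro smooth_fun_sum[OF M U] smooth_fun_scaleR[OF M U] a) auto
    then show "smooth_fun M U (\<lambda>q. (\<Sum>j\<in>I. a j q *\<^sub>R e j q) \<psi>)"
      by (simp add: sum_fun_at scaleR_fun_def)
  qed
  show "tfield M M U (\<lambda>q. \<Sum>j\<in>J. a j q *\<^sub>R e j q)" by (rule tf) simp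
  have tm: "tfield M M U (\<lambda>q. a j q *\<^sub>R e j q)" if "j \<in> J" for j
    using tf[of "{j}"] that by simp
  have "D p v (\<lambda>q. \<Sum>j\<in>I. a j q *\<^sub>R e j q) = (\<Sum>j\<in>I. dd M p v (a j) *\<^sub>R e j p + a j p *\<^sub>R D p v (e j))"
    if "finite I" "I \<subseteq> J" for I
    using that
  proof (induction I rule: finite_induct)
    case empty
    \<comment> \<open>The empty sum is treated as the function 0 times the zero section, on which
      the Leibniz rule gives 0.\<close>
    have "D p v (\<lambda>q. (0::real) *\<^sub>R (0 :: ('a, 'b) tvec)) = dd M p v (\<lambda>q. 0::real) *\<^sub>R 0 + 0 *\<^sub>R D p v (\<lambda>q. 0)"
      by (rule connectionD(4)[OF D _ p v]) (use tf[of "{}"] smooth_fun_const in auto)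
    then show ?case by (simp only: sum.empty scaleR_zero_right scaleR_zero_left add_0_left)
  next
    case (insert i I)
    have "D p v (\<lambda>q. a i q *\<^sub>R e i q + (\<Sum>j\<in>I. a j q *\<^sub>R e j q))
        = D p v (\<lambda>q. a i q *\<^sub>R e i q) + D p v (\<lambda>q. \<Sum>j\<in>I. a j q *\<^sub>R e j q)"
      using insert by (intro connectionD(3)[OF D _ p v] tm tf) auto
    moreover have "D p v (\<lambda>q. a i q *\<^sub>R e i q) = dd M p v (a i) *\<^sub>R e i p + a i p *\<^sub>R D p v (e i)"
      using insert by (intro connectionD(4)[OF D _ p v] e a) auto
    moreover have "D p v (\<lambda>q. \<Sum>j\<in>I. a j q *\<^sub>R e j q)
        = (\<Sum>j\<in>I. dd M p v (a j) *\<^sub>R e j p + a j p *\<^sub>R D p v (e j))"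
      by (rule insert.IH) (use insert.prems in auto)
    ultimately show ?case by (simp only: sum.insert[OF insert.hyps])
  qed
  from this[OF J order_refl]
  show "D p v (\<lambda>q. \<Sum>j\<in>J. a j q *\<^sub>R e j q) = (\<Sum>j\<in>J. dd M p v (a j) *\<^sub>R e j p + a j p *\<^sub>R D p v (e j))" .
qed

text \<open>Leibniz rule for the expansion of \<open>s\<close> in the coordinate frame. The
  expansion holds only on the chart domain, and locality of \<open>D\<close> allows the replacement
  there.\<close>

lemma conn_form_christoffel:
  assumes M: "manifold M" and D: "connection M D" and \<psi>: "\<psi> \<in> charts_at M p" and v: "v \<in> tspace M p"
  shows "conn_form M M D \<psi> p v (christoffel M D \<psi> p v)"
  unfolding conn_form_def
proof (intro allI impI)
  interpret MM: submfd M M by (rule submfd_self[OF M])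
  fix W s assume *: "tfield M M W s \<and> p \<in> W"
  note \<psi>' = charts_atD[OF \<psi>]
  let ?U = "W \<inter> fst \<psi>" and ?e = "\<lambda>j q. chart_frame M \<psi> q j"
  have U: "openin (mtop M) ?U" using * by (intro openin_Int_chart[OF M \<psi>'(1)] tfield_openin[of M M W s]) simp
  have pU: "p \<in> ?U" using * \<psi>' by simp
  have s: "tfield M M ?U s" by (rule tfield_subset[OF _ U]) (use * in auto)
  have sm: "smooth_fun M ?U (\<lambda>q. s q \<psi>)" using * tfield_smooth \<psi>' by blast
  have sm': "smooth_fun M ?U (\<lambda>q. s q \<psi> $ j)" for j by (rule smooth_fun_vec_nth[OF M U sm])
  have e: "tfield M M ?U (?e j)" for j by (rule MM.tfield_chart_frame[OF U \<psi>'(1)]) simp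
  have exp: "s q = (\<Sum>j\<in>UNIV. (s q \<psi>) $ j *\<^sub>R ?e j q)" if "q \<in> ?U" for q
  proof -
    have \<psi>q: "\<psi> \<in> charts_at M q" using that \<psi>' by (intro charts_atI) auto
    have "\<And>i. chart_frame M \<psi> q i \<in> tspace M q"
      using chart_frame_at[OF M \<psi>q] by (simp add: frame_at_iff[OF M \<psi>q])
    then show ?thesis
      using eq_frame_sum_iff[OF M \<psi>q, of "chart_frame M \<psi> q" "s q" "s q \<psi>"] tfield_tspace[OF s that]
        chart_frame_mat[OF M \<psi>q] by simp
  qed
  have "D p v s = D p v (\<lambda>q. \<Sum>j\<in>UNIV. (s q \<psi>) $ j *\<^sub>R ?e j q)"
    by (rule connectionD(5)[OF D s pU v]) (rule exp)
  also have "\<dots> = (\<Sum>j\<in>UNIV. dd M p v (\<lambda>q. s q \<psi> $ j) *\<^sub>R ?e j p + s p \<psi> $ j *\<^sub>R D p v (?e j))"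
    by (rule connection_sum(2)[OF M D e sm' \<psi>'(1) Int_lower2 U pU v finite])
  also have "\<dots> = (\<Sum>j\<in>UNIV. dd M p v (\<lambda>q. s q \<psi>) $ j *\<^sub>R ?e j p) + (\<Sum>j\<in>UNIV. s p \<psi> $ j *\<^sub>R D p v (?e j))"
    by (simp only: sum.distrib dd_vec_nth[OF M U pU v sm])
  finally have "D p v s \<psi> = frame_mat \<psi> (chart_frame M \<psi> p) *v dd M p v (\<lambda>q. s q \<psi>)
     + frame_mat \<psi> (\<lambda>j. D p v (?e j)) *v s p \<psi>"
    by (simp only: plus_fun_def frame_sum_chart)
  then show "D p v s \<in> tspace M p \<and> D p v s \<psi> = dd M p v (\<lambda>q. s q \<psi>) + christoffel M D \<psi> p v *v s p \<psi>"
    using connectionD(1)[OF D s pU v] by (simp add: chart_frame_mat[OF M \<psi>] christoffel_def)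
qed

lemma christoffel_lincomb:
  assumes M: "manifold M" and D: "connection M D" and \<psi>: "\<psi> \<in> charts_at M p"
    and v: "v \<in> tspace M p" "w \<in> tspace M p"
  shows "christoffel M D \<psi> p (a *\<^sub>R v + b *\<^sub>R w) = a *\<^sub>R christoffel M D \<psi> p v + b *\<^sub>R christoffel M D \<psi> p w"
proof -
  note \<psi>' = charts_atD[OF \<psi>]
  have "D p (a *\<^sub>R v + b *\<^sub>R w) (\<lambda>q. chart_frame M \<psi> q j) = a *\<^sub>R D p v (\<lambda>q. chart_frame M \<psi> q j) + b *\<^sub>R D p w (\<lambda>q. chart_frame M \<psi> q j)" for j
    by (rule connectionD(2)[OF D _ \<psi>'(2) v])
       (rule submfd.tfield_chart_frame[OF submfd_self[OF M] openin_chart[OF M \<psi>'(1)] \<psi>'(1) order_refl])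
  then show ?thesis by (simp add: christoffel_def frame_mat_def vec_eq_iff scaleR_fun_def)
qed

lemma smooth_christoffel:
  assumes M: "manifold M" and D: "connection M D" and \<psi>: "\<psi> \<in> atlas M" and X: "tfield M M U X"
  shows "smooth_fun M (U \<inter> fst \<psi>) (\<lambda>q. christoffel M D \<psi> q (X q))"
proof -
  let ?U = "U \<inter> fst \<psi>"
  have U: "openin (mtop M) ?U" by (rule openin_Int_chart[OF M \<psi> tfield_openin[OF X]])
  have "tfield M M ?U (\<lambda>q. D q (X q) (\<lambda>r. chart_frame M \<psi> r j))" for j
    by (rule connection_tfield[OF D submfd.tfield_chart_frame[OF submfd_self[OF M] U \<psi> Int_lower2]
        tfield_subset[OF X U Int_lower1]])
  then have "smooth_fun M ?U (\<lambda>q. D q (X q) (\<lambda>r. chart_frame M \<psi> r j) \<psi>)" for j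
    by (rule smooth_fun_subset[OF tfield_smooth[OF _ \<psi>]]) auto
  then show ?thesis
    unfolding christoffel_def frame_mat_def
    by (intro smooth_fun_vec_lambda[OF M U] smooth_fun_vec_nth[OF M U])
qed

context submfd
begin

text \<open>Let \<open>F\<close> be the matrix of a frame \<open>e\<close> and \<open>c\<close> the
  coordinates of \<open>s\<close> in it, so that \<open>F c\<close> gives the components of
  \<open>s\<close>. The defining expression becomes
  \<open>F dc + (dF + B F) c = d(F c) + B (F c)\<close>, in which the frame no longer occurs; hence
  the description is satisfied by one vector only.\<close>

lemma conn_form_pull_conn:
  assumes D: "connection M D" and \<psi>: "\<psi> \<in> charts_at M p" and p: "p \<in> points N" and x: "x \<in> tspace N p"
  shows "conn_form N M (pull_conn N M D) \<psi> p x (christoffel M D \<psi> p (dincl N M p x))"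
  unfolding conn_form_def
proof (intro allI impI)
  fix V s assume *: "tfield N M V s \<and> p \<in> V"
  then have s: "tfield N M V s" and pV: "p \<in> V" by simp_all
  note \<psi>' = charts_atD[OF \<psi>] and V = tfield_openin[OF s]
  let ?v = "dincl N M p x"
  let ?B = "christoffel M D \<psi> p ?v"
  let ?w = "chart_vec M \<psi> (dd N p x (\<lambda>q. s q \<psi>) + ?B *v s p \<psi>) p"
  let ?E = "\<lambda>e. \<Sum>i\<in>UNIV. dd N p x (\<lambda>q. frame_coord (e q) (s q) $ i) *\<^sub>R e p i
                    + frame_coord (e p) (s p) $ i *\<^sub>R D p ?v (\<lambda>q. e q i)"
  have v: "?v \<in> tspace M p" by (rule dincl_tspace[OF p x])
  have key: "?E e = ?w" if e: "frame_field M M W e" and pW: "p \<in> W" for W e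
  proof (rule tspace_eqI[OF _ chart_vec_tspace[OF M \<psi>] \<psi>])
    have W: "openin (mtop M) W" by (rule frame_field_openin[OF e])
    let ?U = "(W \<inter> points N) \<inter> V \<inter> fst \<psi>"
    have U: "openin (mtop N) ?U" by (intro openin_Int_chart_M openin_Int V openin_restrict W \<psi>')
    have pU: "p \<in> ?U" using pW pV p \<psi>' by simp
    have ep: "e p i \<in> tspace M p" for i by (rule tfield_tspace[OF frame_field_tfield[OF e] pW])
    have De: "D p ?v (\<lambda>q. e q i) \<in> tspace M p" for i
      by (rule connectionD(1)[OF D frame_field_tfield[OF e] pW v])
    show "?E e \<in> tspace M p"
      by (rule tspace_sum[OF M v]) (intro tspace_add[OF M] tspace_scaleR[OF M] ep De)
    have eN: "frame_field N M (W \<inter> points N) e"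
      unfolding frame_field_def
      using tfield_restrict[OF frame_field_tfield[OF e] openin_restrict[OF W] Int_lower1] frame_field_frame_at[OF e]
      by blast
    let ?c = "\<lambda>q. frame_coord (e q) (s q)" and ?F = "\<lambda>q. frame_mat \<psi> (e q)"
    have c: "smooth_fun N ?U ?c" by (rule smooth_frame_coord[OF eN s \<psi>'(1)])
    have F: "smooth_fun N ?U ?F" by (rule smooth_fun_subset[OF smooth_frame_mat[OF eN \<psi>'(1)]]) auto
    have FM: "smooth_fun M (W \<inter> fst \<psi>) ?F"
      by (rule submfd.smooth_frame_mat[OF submfd_self[OF M] e \<psi>'(1)])
    have WM: "openin (mtop M) (W \<inter> fst \<psi>)" by (rule openin_Int_chart[OF M \<psi>'(1) W])
    have sol: "?F q *v ?c q = s q \<psi>" if "q \<in> ?U" for q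
      using that frame_coord_chart[OF M charts_atI[OF \<psi>'(1)] frame_field_frame_at[OF e] tfield_tspace[OF s], of q] by simp
    \<comment> \<open>The frame lives on an open set of \<open>M\<close>, so its derivative along
      \<open>N\<close> is the derivative in \<open>M\<close> along the included vector. This links
      the derivative of the coordinates on \<open>N\<close> with the action of \<open>D\<close> on
      \<open>M\<close>.\<close>
    have dF: "dd N p x ?F = dd M p ?v ?F"
      using dd_restrict[OF WM FM _ p x] pU by simp
    have De\<psi>: "D p ?v (\<lambda>q. e q i) \<psi> = column i (dd M p ?v ?F + ?B ** ?F p)" for i
    proof -
      have "D p ?v (\<lambda>q. e q i) \<psi> = dd M p ?v (\<lambda>q. e q i \<psi>) + ?B *v e p i \<psi>"
        by (rule conn_formD(2)[OF conn_form_christoffel[OF M D \<psi> v] frame_field_tfield[OF e] pW])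
      moreover have "dd M p ?v (\<lambda>q. e q i \<psi>) = column i (dd M p ?v ?F)"
      proof -
        have lin: "linear (\<lambda>A::real^'m^'m. column i A)"
          by (auto intro!: linearI simp: column_def vec_eq_iff)
        have "dd M p ?v (\<lambda>q. column i (?F q)) = column i (dd M p ?v ?F)"
          by (rule dd_linear[OF M WM _ v lin FM]) (use pU in auto)
        moreover have "(\<lambda>q. column i (?F q)) = (\<lambda>q. e q i \<psi>)"
          by (simp add: column_def frame_mat_def fun_eq_iff vec_eq_iff)
        ultimately show ?thesis by simp
      qed
      moreover have "?B *v e p i \<psi> = column i (?B ** ?F p)"
        by (simp add: vec_eq_iff column_def matrix_vector_mult_def matrix_matrix_mult_def frame_mat_def)
      ultimately show ?thesis by (simp add: column_def vec_eq_iff)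
    qed
    have "?E e \<psi> = (\<Sum>i\<in>UNIV. dd N p x ?c $ i *\<^sub>R e p i \<psi>) + (\<Sum>i\<in>UNIV. ?c p $ i *\<^sub>R D p ?v (\<lambda>q. e q i) \<psi>)"
      by (simp add: sum_fun_at scaleR_fun_def sum.distrib dd_vec_nth[OF N U pU x c])
    also have "(\<Sum>i\<in>UNIV. dd N p x ?c $ i *\<^sub>R e p i \<psi>) = ?F p *v dd N p x ?c"
      by (simp add: frame_mat_mult)
    also have "(\<Sum>i\<in>UNIV. ?c p $ i *\<^sub>R D p ?v (\<lambda>q. e q i) \<psi>) = (dd M p ?v ?F + ?B ** ?F p) *v ?c p"
      by (simp add: De\<psi> matrix_mult_sum scalar_mult_eq_scaleR)
    also have "?F p *v dd N p x ?c + (dd M p ?v ?F + ?B ** ?F p) *v ?c p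
        = dd N p x (\<lambda>q. ?F q *v ?c q) + ?B *v (?F p *v ?c p)"
      by (simp add: dd_matrix_vector_mult[OF N U pU x F c] dF matrix_vector_mult_add_rdistrib
          matrix_vector_mul_assoc)
    also have "dd N p x (\<lambda>q. ?F q *v ?c q) = dd N p x (\<lambda>q. s q \<psi>)"
      by (rule dd_cong[OF N U pU sol])
    also have "?F p *v ?c p = s p \<psi>" by (rule sol[OF pU])
    finally show "?E e \<psi> = ?w \<psi>" unfolding chart_vec_same[OF M \<psi>] .
  qed
  \<comment> \<open>The coordinate frame shows that the universally quantified condition is not
    vacuous, which gives uniqueness.\<close>
  have ff: "frame_field M M (fst \<psi>) (chart_frame M \<psi>)"
    by (rule submfd.frame_field_chart[OF submfd_self[OF M] openin_chart[OF M \<psi>'(1)] \<psi>'(1) order_refl])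
  have "pull_conn N M D p x s = ?w"
    unfolding pull_conn_def
  proof (rule the_equality)
    show "\<forall>W e. p \<in> W \<and> frame_field M M W e \<longrightarrow> ?w = ?E e"
      by (intro allI impI, elim conjE) (rule key[symmetric])
    show "w = ?w" if "\<forall>W e. p \<in> W \<and> frame_field M M W e \<longrightarrow> w = ?E e" for w
      by (rule trans[OF that[rule_format, OF conjI[OF \<psi>'(2) ff]] key[OF ff \<psi>'(2)]])
  qed
  then show "pull_conn N M D p x s \<in> tspace M p \<and>
      pull_conn N M D p x s \<psi> = dd N p x (\<lambda>q. s q \<psi>) + ?B *v s p \<psi>"
    by (simp add: chart_vec_tspace[OF M \<psi>] chart_vec_same[OF M \<psi>])
qed

lemma dens_section_openin: "dens_section N M k V l \<Longrightarrow> openin (mtop N) V"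
  and dens_section_mem: "dens_section N M k V l \<Longrightarrow> q \<in> V \<Longrightarrow> l q \<in> weighted M k q UNIV"
  and dens_section_smooth: "dens_section N M k V l \<Longrightarrow> frame_field N M W e \<Longrightarrow> W \<subseteq> V \<Longrightarrow> smooth_fun N W (\<lambda>q. l q (e q))"
  by (simp_all add: dens_section_def density_space_def)

text \<open>Let \<open>F\<close> be the matrix of a frame field \<open>e\<close> and
  \<open>G\<close> its inverse at \<open>p\<close>. The factor
  \<open>\<bar>det F\<bar> powr (- (k / m))\<close> in \<open>l q (e q)\<close> contributes
  \<open>- (k / m) tr (G dF)\<close>, whereas the connection matrix in the frame \<open>e\<close> is
  \<open>G dF + G B F\<close>, with trace \<open>tr (G dF) + tr B\<close>. The terms with
  \<open>dF\<close> cancel, so all frames through \<open>f\<close> give the same value.\<close>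

lemma dens_conn_eq:
  assumes K: "conn_form N M K \<psi> p x B" and l: "dens_section N M k V l" and p: "p \<in> V"
    and \<psi>: "\<psi> \<in> charts_at M p" and x: "x \<in> tspace N p"
  shows "dens_conn N M k K p x l = chart_weighted M \<psi> k p
    (dd N p x (\<lambda>q. l q (chart_frame M \<psi> q)) + k / real CARD('m) * trace B * l p (chart_frame M \<psi> p))"
    (is "_ = chart_weighted M \<psi> k p ?L")
proof
  fix f
  note \<psi>' = charts_atD[OF \<psi>] and V = dens_section_openin[OF l]
  let ?k = "- (k / real CARD('m))"
  let ?E = "\<lambda>e. dd N p x (\<lambda>q. l q (e q))
           + (k / real CARD('m)) * (\<Sum>j\<in>UNIV. frame_coord f (K p x (\<lambda>q. e q j)) $ j) * l p f"
  show "dens_conn N M k K p x l f = chart_weighted M \<psi> k p ?L f"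
  proof (cases "frame_at M p f")
    case f: True
    let ?r = "\<bar>det (frame_mat \<psi> f)\<bar> powr ?k * ?L"
    have finv: "invertible (frame_mat \<psi> f)" using f by (simp add: frame_at_iff[OF M \<psi>])
    obtain G where G: "G ** frame_mat \<psi> f = mat 1" "frame_mat \<psi> f ** G = mat 1" "\<And>v. G *v (frame_mat \<psi> f *v v) = v"
      using inv_if_invertible[OF finv] by metis
    have key: "?E e = ?r" if pW: "p \<in> W" and e: "frame_field N M W e" and ep: "e p = f" for W e
    proof -
      have W: "openin (mtop N) W" by (rule frame_field_openin[OF e])
      let ?U = "(W \<inter> V) \<inter> fst \<psi>"
      have U: "openin (mtop N) ?U" by (intro openin_Int_chart_M openin_Int V W \<psi>')
      have pU: "p \<in> ?U" using pW p \<psi>' by simp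
      let ?F = "\<lambda>q. frame_mat \<psi> (e q)" and ?lam = "\<lambda>q. l q (chart_frame M \<psi> q)"
      have F: "smooth_fun N ?U ?F" by (rule smooth_fun_subset[OF smooth_frame_mat[OF e \<psi>'(1)]]) auto
      have sml: "smooth_fun N ?U ?lam"
        by (rule dens_section_smooth[OF l frame_field_chart[OF U \<psi>'(1)]]) auto
      have Finv: "invertible (?F q)" if "q \<in> ?U" for q
        using frame_field_frame_at[OF e, of q] that charts_atI[OF \<psi>'(1), of q] frame_at_iff[OF M, of \<psi> q "e q"] by simp
      have smdet: "smooth_fun N ?U (\<lambda>q. \<bar>det (?F q)\<bar> powr ?k)"
        by (rule smooth_fun_abs_powr[OF N U smooth_fun_det[OF N U F]]) (use Finv in \<open>simp add: invertible_det_nz\<close>)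
      have le: "l q (e q) = \<bar>det (?F q)\<bar> powr ?k * ?lam q" if "q \<in> ?U" for q
        using weighted_eq_chart_frame[OF M charts_atI[OF \<psi>'(1)] dens_section_mem[OF l] frame_field_frame_at[OF e], of q] that
        by simp
      have ddet: "dd N p x (\<lambda>q. \<bar>det (?F q)\<bar> powr ?k) = ?k * \<bar>det (?F p)\<bar> powr ?k * trace (G ** dd N p x ?F)"
        by (rule dd_compose[OF N U pU x F has_derivative_abs_det_powr]) (simp add: ep G)
      have Ke: "frame_coord f (K p x (\<lambda>q. e q j)) = G *v column j (dd N p x ?F + B ** ?F p)" for j
      proof -
        have "K p x (\<lambda>q. e q j) \<psi> = dd N p x (\<lambda>q. e q j \<psi>) + B *v e p j \<psi>"
          by (rule conn_formD(2)[OF K frame_field_tfield[OF e] pW])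
        moreover have "dd N p x (\<lambda>q. e q j \<psi>) = column j (dd N p x ?F)"
        proof -
          have lin: "linear (\<lambda>A::real^'m^'m. column j A)"
            by (auto intro!: linearI simp: column_def vec_eq_iff)
          have "dd N p x (\<lambda>q. column j (?F q)) = column j (dd N p x ?F)"
            by (rule dd_linear[OF N U pU x lin F])
          moreover have "(\<lambda>q. column j (?F q)) = (\<lambda>q. e q j \<psi>)"
            by (simp add: column_def frame_mat_def fun_eq_iff vec_eq_iff)
          ultimately show ?thesis by simp
        qed
        moreover have "B *v e p j \<psi> = column j (B ** ?F p)"
          by (simp add: vec_eq_iff column_def matrix_vector_mult_def matrix_matrix_mult_def frame_mat_def)
        ultimately have "K p x (\<lambda>q. e q j) \<psi> = column j (dd N p x ?F + B ** ?F p)"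
          by (simp add: column_def vec_eq_iff)
        moreover have "frame_mat \<psi> f *v frame_coord f (K p x (\<lambda>q. e q j)) = K p x (\<lambda>q. e q j) \<psi>"
          by (rule frame_coord_chart[OF M \<psi> f conn_formD(1)[OF K frame_field_tfield[OF e] pW]])
        ultimately show ?thesis using G(3) by metis
      qed
      have "(\<Sum>j\<in>UNIV. (G *v column j A) $ j) = trace (G ** A)" for A :: "real^'m^'m"
        by (simp add: trace_def matrix_vector_mult_def matrix_matrix_mult_def column_def)
      then have tr: "(\<Sum>j\<in>UNIV. frame_coord f (K p x (\<lambda>q. e q j)) $ j) = trace (G ** dd N p x ?F) + trace B"
      proof -
        have "trace (G ** (B ** frame_mat \<psi> f)) = trace ((B ** frame_mat \<psi> f) ** G)" by (rule trace_mul_sym)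
        also have "\<dots> = trace B" by (simp add: matrix_mul_assoc[symmetric] G)
        finally show ?thesis
          by (simp add: Ke \<open>\<And>A. (\<Sum>j\<in>UNIV. (G *v column j A) $ j) = trace (G ** A)\<close> ep matrix_add_ldistrib trace_add)
      qed
      have "dd N p x (\<lambda>q. l q (e q)) = dd N p x (\<lambda>q. \<bar>det (?F q)\<bar> powr ?k * ?lam q)"
        by (rule dd_cong[OF N U pU le])
      also have "\<dots> = ?k * \<bar>det (?F p)\<bar> powr ?k * trace (G ** dd N p x ?F) * ?lam p + \<bar>det (?F p)\<bar> powr ?k * dd N p x ?lam"
        by (simp only: dd_mult[OF N U pU x smdet sml] ddet)
      finally show ?thesis
        using le[OF pU] by (simp add: tr ep algebra_simps)
    qed
    \<comment> \<open>The given frame \<open>f\<close> at \<open>p\<close> is extended by keeping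
      its matrix with respect to the coordinate frame constant.\<close>
    let ?e = "\<lambda>q. frame_act (chart_frame M \<psi> q) (frame_mat \<psi> f)"
    have U: "openin (mtop N) (V \<inter> fst \<psi>)" by (rule openin_Int_chart_M[OF V \<psi>'(1)])
    have e: "frame_field N M (V \<inter> fst \<psi>) ?e" by (rule frame_field_chart_act[OF U \<psi>'(1) Int_lower2 finv])
    have ep: "?e p = f"
      using frame_eq_act_chart_frame[OF M \<psi>, of f] f by (simp add: frame_at_iff[OF M \<psi>])
    have pU: "p \<in> V \<inter> fst \<psi>" using p \<psi>' by simp
    have "(THE r. \<forall>W e. p \<in> W \<and> frame_field N M W e \<and> e p = f \<longrightarrow> r = ?E e) = ?r"
    proof (rule the_equality)
      show "\<forall>W e. p \<in> W \<and> frame_field N M W e \<and> e p = f \<longrightarrow> ?r = ?E e"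
        by (intro allI impI, elim conjE) (rule key[symmetric])
      show "r = ?r" if "\<forall>W e. p \<in> W \<and> frame_field N M W e \<and> e p = f \<longrightarrow> r = ?E e" for r
        by (rule trans[OF that[rule_format, OF conjI[OF pU conjI[OF e ep]]] key[OF pU e ep]])
    qed
    then show ?thesis using f by (simp add: dens_conn_def chart_weighted_def)
  qed (simp add: dens_conn_def chart_weighted_def)
qed

end

section \<open>The metric in a chart and Weyl structures\<close>

lemma linear_eq_axis_sum:
  fixes h :: "real ^ 'm \<Rightarrow> 'b::real_vector"
  assumes "linear h"
  shows "h a = (\<Sum>i\<in>UNIV. a $ i *\<^sub>R h (axis i 1))"
proof -
  have "h a = h (\<Sum>i\<in>UNIV. a $ i *\<^sub>R axis i 1)"
    using basis_expansion[of a] by (simp add: scalar_mult_eq_scaleR)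
  then show ?thesis by (simp only: linear_sum[OF assms] linear_cmul[OF assms])
qed

locale conf_mfd =
  fixes M :: "('a, 'm::finite) mfd" and c :: "('a, 'm) conf"
  assumes man: "manifold M" and conf: "conformal_structure M c"
begin

definition gram :: "('a, 'm) chart \<Rightarrow> 'a \<Rightarrow> real ^ 'm ^ 'm" where
  "gram \<psi> q = (\<chi> i j. c q (chart_frame M \<psi> q i) (chart_frame M \<psi> q j) (chart_frame M \<psi> q))"

definition metric :: "('a, 'm) chart \<Rightarrow> 'a \<Rightarrow> real ^ 'm \<Rightarrow> real ^ 'm \<Rightarrow> real" where
  "metric \<psi> q a b = a \<bullet> (gram \<psi> q *v b)"

lemma metric_simps:
  "metric \<psi> q (a + a') b = metric \<psi> q a b + metric \<psi> q a' b"
  "metric \<psi> q (a - a') b = metric \<psi> q a b - metric \<psi> q a' b"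
  "metric \<psi> q (r *\<^sub>R a) b = r * metric \<psi> q a b"
  "metric \<psi> q a (b + b') = metric \<psi> q a b + metric \<psi> q a b'"
  "metric \<psi> q a (b - b') = metric \<psi> q a b - metric \<psi> q a b'"
  "metric \<psi> q a (r *\<^sub>R b) = r * metric \<psi> q a b"
  by (simp_all add: metric_def inner_add_left inner_add_right inner_diff_left inner_diff_right
      matrix_vector_right_distrib matrix_vector_mult_diff_distrib matrix_vector_mult_scaleR)

lemma c_mem:
  assumes "p \<in> points M" "v \<in> tspace M p" "w \<in> tspace M p"
  shows "c p v w \<in> weighted M 2 p UNIV"
  using conf assms unfolding conformal_structure_def density_space_def by blast

lemma c_sym:
  assumes "p \<in> points M" "v \<in> tspace M p" "w \<in> tspace M p"
  shows "c p v w = c p w v"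
  using conf assms unfolding conformal_structure_def by blast

lemma c_lincomb:
  assumes "p \<in> points M" "u \<in> tspace M p" "v \<in> tspace M p" "w \<in> tspace M p"
  shows "c p (a *\<^sub>R u + b *\<^sub>R v) w = a *\<^sub>R c p u w + b *\<^sub>R c p v w"
  using conf assms unfolding conformal_structure_def by blast

lemma c_pos:
  assumes "p \<in> points M" "frame_at M p f" "v \<in> tspace M p" "v \<noteq> 0"
  shows "c p v v f > 0"
  using conf assms unfolding conformal_structure_def by blast

lemma c_section: "tfield M M U X \<Longrightarrow> tfield M M U Y \<Longrightarrow> dens_section M M 2 U (\<lambda>q. c q (X q) (Y q))"
  using conjunct2[OF conf[unfolded conformal_structure_def]] by blast

lemma charts_at_points: "\<psi> \<in> charts_at M q \<Longrightarrow> q \<in> points M"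
  using openin_points[OF openin_chart[OF man charts_atD(1)] charts_atD(2)] .

context
  fixes \<psi> :: "('a, 'm) chart" and q :: 'a
  assumes \<psi>: "\<psi> \<in> charts_at M q"
begin

text \<open>Both arguments are expanded in the coordinate frame. Linearity is given in the first
  argument and is carried to the second by symmetry.\<close>

lemma c_chart:
  assumes v: "v \<in> tspace M q" and w: "w \<in> tspace M q"
  shows "c q v w (chart_frame M \<psi> q) = metric \<psi> q (v \<psi>) (w \<psi>)"
proof -
  note q = charts_at_points[OF \<psi>] and T = chart_vec_tspace[OF man \<psi>]
  let ?f = "chart_frame M \<psi> q" and ?e = "\<lambda>a. chart_vec M \<psi> a q"
  have lin: "linear (\<lambda>a. c q (?e a) u ?f)" if u: "u \<in> tspace M q" for u
  proof (rule linearI)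
    fix a b r
    show "c q (?e (a + b)) u ?f = c q (?e a) u ?f + c q (?e b) u ?f"
      using c_lincomb[OF q T T u, of 1 a 1 b] by (simp add: chart_vec_add[OF man \<psi>])
    show "c q (?e (r *\<^sub>R a)) u ?f = r *\<^sub>R c q (?e a) u ?f"
    proof -
      have "c q (r *\<^sub>R ?e a) u = r *\<^sub>R c q (?e a) u"
        using c_lincomb[OF q T T u, of r a 0 a] by (simp only: scaleR_zero_left add_0_right)
      then show ?thesis unfolding chart_vec_scaleR[OF man \<psi>] by (simp only: scaleR_fun_def)
    qed
  qed
  have "c q v w ?f = c q (?e (v \<psi>)) w ?f" by (simp add: chart_vec_eq[OF man \<psi> v])
  also have "\<dots> = (\<Sum>i\<in>UNIV. v \<psi> $ i *\<^sub>R c q (?f i) w ?f)"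
    using linear_eq_axis_sum[OF lin[OF w], of "v \<psi>"] by (simp add: chart_frame_def)
  also have "\<dots> = (\<Sum>i\<in>UNIV. v \<psi> $ i *\<^sub>R (\<Sum>j\<in>UNIV. w \<psi> $ j *\<^sub>R c q (?f i) (?f j) ?f))"
  proof (intro sum.cong refl arg_cong2[where f = scaleR])
    fix i
    have fi: "?f j \<in> tspace M q" for j by (simp add: chart_frame_def T)
    have "c q (?f i) w ?f = c q (?e (w \<psi>)) (?f i) ?f"
      using c_sym[OF q fi w] by (simp add: chart_vec_eq[OF man \<psi> w])
    also have "\<dots> = (\<Sum>j\<in>UNIV. w \<psi> $ j *\<^sub>R c q (?e (axis j 1)) (?f i) ?f)"
      by (rule linear_eq_axis_sum[OF lin[OF fi]])
    also have "\<dots> = (\<Sum>j\<in>UNIV. w \<psi> $ j *\<^sub>R c q (?f i) (?f j) ?f)"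
      using c_sym[OF q fi fi] by (simp add: chart_frame_def)
    finally show "c q (?f i) w ?f = (\<Sum>j\<in>UNIV. w \<psi> $ j *\<^sub>R c q (?f i) (?f j) ?f)" .
  qed
  finally show ?thesis
    by (simp add: metric_def gram_def inner_vec_def matrix_vector_mult_def mult.commute)
qed

lemma metric_sym: "metric \<psi> q a b = metric \<psi> q b a"
proof -
  note T = chart_vec_tspace[OF man \<psi>]
  show ?thesis
    using c_chart[OF T T, of a b] c_chart[OF T T, of b a] c_sym[OF charts_at_points[OF \<psi>] T T, of a b]
    by (simp add: chart_vec_same[OF man \<psi>])
qed

lemma metric_pos:
  assumes "a \<noteq> 0"
  shows "metric \<psi> q a a > 0"
proof -
  note T = chart_vec_tspace[OF man \<psi>]
  have "chart_vec M \<psi> a q \<noteq> 0"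
    using chart_vec_same[OF man \<psi>, of a] assms by auto
  from c_pos[OF charts_at_points[OF \<psi>] chart_frame_at[OF man \<psi>] T this]
  show ?thesis using c_chart[OF T T, of a a] by (simp add: chart_vec_same[OF man \<psi>])
qed

lemma metric_eq_0_iff: "metric \<psi> q a a = 0 \<longleftrightarrow> a = 0"
proof (cases "a = 0")
  case False
  then show ?thesis using metric_pos[of a] by simp
qed (simp add: metric_def)

text \<open>A density is determined by its value on the coordinate frame, so orthogonality for
  \<open>c\<close> is orthogonality for the metric of the chart.\<close>

lemma c_eq_0_iff:
  assumes "v \<in> tspace M q" "w \<in> tspace M q"
  shows "c q v w = 0 \<longleftrightarrow> metric \<psi> q (v \<psi>) (w \<psi>) = 0"
proof -
  have "0 \<in> weighted M 2 q (UNIV :: real set)" by (simp add: weighted_def)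
  then have "c q v w = 0 \<longleftrightarrow> c q v w (chart_frame M \<psi> q) = 0"
    using weighted_eqI[OF man \<psi> c_mem[OF charts_at_points[OF \<psi>] assms], of 0 UNIV] by auto
  then show ?thesis by (simp add: c_chart[OF assms])
qed

end

lemma smooth_gram:
  assumes \<psi>: "\<psi> \<in> atlas M"
  shows "smooth_fun M (fst \<psi>) (gram \<psi>)"
proof -
  interpret MM: submfd M M by (rule submfd_self[OF man])
  note U = openin_chart[OF man \<psi>]
  note ff = MM.frame_field_chart[OF U \<psi> order_refl]
  have "smooth_fun M (fst \<psi>) (\<lambda>q. c q (chart_frame M \<psi> q i) (chart_frame M \<psi> q j) (chart_frame M \<psi> q))" for i j
    by (rule MM.dens_section_smooth[OF c_section[OF frame_field_tfield[OF ff] frame_field_tfield[OF ff]] ff order_refl])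
  then show ?thesis
    unfolding gram_def[abs_def] by (intro smooth_fun_vec_lambda[OF man U])
qed

section \<open>Weyl structures in a chart\<close>

lemma weyl_connection: "weyl_structure M c D \<Longrightarrow> connection M D"
  by (simp add: weyl_structure_def)

lemma tfield_const:
  assumes "\<psi> \<in> atlas M"
  shows "tfield M M (fst \<psi>) (chart_vec M \<psi> a)"
  using submfd.tfield_chart_vec[OF submfd_self[OF man] openin_chart[OF man assms] assms order_refl smooth_fun_const] .

lemma dd_chart_vec:
  assumes \<psi>: "\<psi> \<in> charts_at M p"
  shows "dd M p v (\<lambda>q. chart_vec M \<psi> a q \<psi>) = dd M p v (\<lambda>q. a)"
  by (rule dd_cong[OF man openin_chart[OF man charts_atD(1)[OF \<psi>]] charts_atD(2)[OF \<psi>]])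
     (simp add: chart_vec_same[OF man charts_atI[OF charts_atD(1)[OF \<psi>]]])

lemma connection_chart_vec:
  assumes D: "connection M D" and \<psi>: "\<psi> \<in> charts_at M p" and v: "v \<in> tspace M p"
  shows "D p v (chart_vec M \<psi> a) \<in> tspace M p" "D p v (chart_vec M \<psi> a) \<psi> = christoffel M D \<psi> p v *v a"
proof -
  note \<psi>' = charts_atD[OF \<psi>]
  note d = conn_formD[OF conn_form_christoffel[OF man D \<psi> v] tfield_const[OF \<psi>'(1)] \<psi>'(2), of a]
  show "D p v (chart_vec M \<psi> a) \<in> tspace M p" by (rule d(1))
  show "D p v (chart_vec M \<psi> a) \<psi> = christoffel M D \<psi> p v *v a"
    using d(2) dd_const[OF man openin_chart[OF man \<psi>'(1)] \<psi>'(2) v, of a]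
    by (simp add: dd_chart_vec[OF \<psi>] chart_vec_same[OF man \<psi>])
qed

text \<open>Vanishing torsion, tested on the fields with constant components extending
  \<open>v\<close> and \<open>w\<close>, whose bracket vanishes at \<open>p\<close> in the
  chart.\<close>

lemma christoffel_sym:
  assumes D: "weyl_structure M c D" and \<psi>: "\<psi> \<in> charts_at M p" and v: "v \<in> tspace M p" and w: "w \<in> tspace M p"
  shows "christoffel M D \<psi> p v *v w \<psi> = christoffel M D \<psi> p w *v v \<psi>"
proof -
  note \<psi>' = charts_atD[OF \<psi>]
  let ?X = "chart_vec M \<psi> (v \<psi>)" and ?Y = "chart_vec M \<psi> (w \<psi>)"
  have p: "?X p = v" "?Y p = w" by (simp_all add: chart_vec_eq[OF man \<psi>] v w)
  have eq: "D p (?X p) ?Y - D p (?Y p) ?X = bracket M ?X ?Y p"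
    using D tfield_const[OF \<psi>'(1)] \<psi>'(2) unfolding weyl_structure_def torsion_free_def by blast
  have "bracket M ?X ?Y p \<psi> = 0"
    using \<psi> dd_const[OF man openin_chart[OF man \<psi>'(1)] \<psi>'(2) v, of "w \<psi>"]
      dd_const[OF man openin_chart[OF man \<psi>'(1)] \<psi>'(2) w, of "v \<psi>"]
    by (simp add: bracket_def dd_chart_vec p)
  then have "D p v ?Y \<psi> - D p w ?X \<psi> = 0"
    using fun_cong[OF eq[unfolded p], of \<psi>] by (simp only: minus_apply)
  then show ?thesis
    by (simp add: connection_chart_vec(2)[OF weyl_connection[OF D] \<psi>] v w)
qed

text \<open>This is \<open>\<nabla>c = 0\<close> on fields with constant components, evaluated on
  the coordinate frame. The trace term is the connection on the density bundle in which
  \<open>c\<close> takes its values, and the 2 in its coefficient is the weight of that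
  bundle.\<close>

lemma metric_compatible:
  assumes D: "weyl_structure M c D" and \<psi>: "\<psi> \<in> charts_at M p" and v: "v \<in> tspace M p"
  defines "\<Gamma> \<equiv> christoffel M D \<psi> p v"
  shows "a \<bullet> (dd M p v (gram \<psi>) *v b) + 2 / real CARD('m) * trace \<Gamma> * metric \<psi> p a b
    = metric \<psi> p (\<Gamma> *v a) b + metric \<psi> p a (\<Gamma> *v b)"
proof -
  interpret MM: submfd M M by (rule submfd_self[OF man])
  note \<psi>' = charts_atD[OF \<psi>] and U = openin_chart[OF man charts_atD(1)[OF \<psi>]]
  note cD = weyl_connection[OF D] and T = chart_vec_tspace[OF man]
  let ?X = "chart_vec M \<psi> a" and ?Y = "chart_vec M \<psi> b" and ?f = "chart_frame M \<psi>"
  note tX = tfield_const[OF \<psi>'(1), of a] and tY = tfield_const[OF \<psi>'(1), of b]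
  have eq: "dens_conn M M 2 D p v (\<lambda>q. c q (?X q) (?Y q)) = c p (D p v ?X) (?Y p) + c p (?X p) (D p v ?Y)"
    using D tX tY \<psi>'(2) v unfolding weyl_structure_def by blast
  have lin: "linear (\<lambda>A::real^'m^'m. a \<bullet> (A *v b))"
    by (auto intro!: linearI simp: matrix_vector_mult_add_rdistrib inner_add_right scaleR_matrix_vector_assoc[symmetric])
  have "dd M p v (\<lambda>q. c q (?X q) (?Y q) (?f q)) = dd M p v (\<lambda>q. a \<bullet> (gram \<psi> q *v b))"
  proof (rule dd_cong[OF man U \<psi>'(2)])
    fix r assume "r \<in> fst \<psi>"
    then have r: "\<psi> \<in> charts_at M r" by (rule charts_atI[OF \<psi>'(1)])
    show "c r (?X r) (?Y r) (?f r) = a \<bullet> (gram \<psi> r *v b)"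
      using c_chart[OF r T[OF r] T[OF r]] by (simp add: chart_vec_same[OF man r] metric_def)
  qed
  also have "\<dots> = a \<bullet> (dd M p v (gram \<psi>) *v b)"
    by (rule dd_linear[OF man U \<psi>'(2) v lin smooth_gram[OF \<psi>'(1)]])
  finally have "dens_conn M M 2 D p v (\<lambda>q. c q (?X q) (?Y q)) (?f p)
      = a \<bullet> (dd M p v (gram \<psi>) *v b) + 2 / real CARD('m) * trace \<Gamma> * metric \<psi> p a b"
    unfolding MM.dens_conn_eq[OF conn_form_christoffel[OF man cD \<psi> v] c_section[OF tX tY] \<psi>'(2) \<psi> v]
    by (simp add: chart_weighted_chart_frame[OF man \<psi>] \<Gamma>_def c_chart[OF \<psi> T[OF \<psi>] T[OF \<psi>]] chart_vec_same[OF man \<psi>])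
  moreover have "(c p (D p v ?X) (?Y p) + c p (?X p) (D p v ?Y)) (?f p)
      = metric \<psi> p (\<Gamma> *v a) b + metric \<psi> p a (\<Gamma> *v b)"
    by (simp add: c_chart[OF \<psi>] T[OF \<psi>] connection_chart_vec[OF cD \<psi> v] chart_vec_same[OF man \<psi>] \<Gamma>_def)
  ultimately show ?thesis using eq by simp
qed

text \<open>Koszul's argument: the difference of two Weyl structures is determined by its trace.\<close>

lemma christoffel_difference:
  assumes D: "weyl_structure M c D" and D': "weyl_structure M c D'" and \<psi>: "\<psi> \<in> charts_at M p"
  defines "S \<equiv> \<lambda>u. christoffel M D' \<psi> p u - christoffel M D \<psi> p u"
  assumes u: "u \<in> tspace M p" and v: "v \<in> tspace M p" and w: "w \<in> tspace M p"
  shows "metric \<psi> p (S u *v v \<psi>) (w \<psi>) = 1 / real CARD('m) *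
    (trace (S u) * metric \<psi> p (v \<psi>) (w \<psi>) + trace (S v) * metric \<psi> p (u \<psi>) (w \<psi>)
      - trace (S w) * metric \<psi> p (u \<psi>) (v \<psi>))"
proof -
  define B where "B u v w = metric \<psi> p (S u *v v \<psi>) (w \<psi>)" for u v w
  define \<delta> where "\<delta> u = trace (S u) / real CARD('m)" for u
  define g where "g v w = metric \<psi> p (v \<psi>) (w \<psi>)" for v w :: "('a, 'm) tvec"
  have g: "g v w = g w v" for v w unfolding g_def by (rule metric_sym[OF \<psi>])
  have sym: "B u v w = B v u w" if "u \<in> tspace M p" "v \<in> tspace M p" for u v w
    using christoffel_sym[OF D \<psi> that] christoffel_sym[OF D' \<psi> that]
    by (simp add: B_def S_def matrix_vector_mult_diff_rdistrib)
  \<comment> \<open>Subtracting the compatibility of the two structures removes the derivative of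
    the Gram matrix.\<close>
  have skew: "B u v w + B u w v = 2 * \<delta> u * g v w" if u: "u \<in> tspace M p" for u v w
  proof -
    have "metric \<psi> p (S u *v v \<psi>) (w \<psi>) + metric \<psi> p (v \<psi>) (S u *v w \<psi>)
        = 2 / real CARD('m) * trace (S u) * metric \<psi> p (v \<psi>) (w \<psi>)"
      using metric_compatible[OF D \<psi> u, of "v \<psi>" "w \<psi>"] metric_compatible[OF D' \<psi> u, of "v \<psi>" "w \<psi>"]
      by (simp add: S_def matrix_vector_mult_diff_rdistrib metric_simps trace_sub algebra_simps diff_divide_distrib)
    then show ?thesis
      unfolding B_def g_def \<delta>_def using metric_sym[OF \<psi>, of "S u *v w \<psi>" "v \<psi>"] by simp
  qed
  \<comment> \<open>Half of the first two skew identities minus half of the third; the symmetry in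
    the first two arguments leaves only \<open>B u v w\<close>.\<close>
  have "B u v w = \<delta> u * g v w + \<delta> v * g u w - \<delta> w * g u v"
    using skew[OF u, of v w] skew[OF v, of u w] skew[OF w, of u v]
      sym[OF u v, of w] sym[OF u w, of v] sym[OF v w, of u] g[of v w] g[of u w] g[of u v] by linarith
  then show ?thesis by (simp add: B_def \<delta>_def g_def algebra_simps add_divide_distrib diff_divide_distrib)
qed

end

section \<open>The normal bundle\<close>

locale conf_submfd = submfd N M + conf_mfd M c
  for N :: "('a, 'n::finite) mfd" and M :: "('a, 'm::finite) mfd" and c :: "('a, 'm) conf"
begin

lemma ex_chart_M: "q \<in> points N \<Longrightarrow> \<exists>\<psi>. \<psi> \<in> charts_at M q"
  using ex_chart_at[OF M] points_subset by blast

lemma normal_iff: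
  assumes \<psi>: "\<psi> \<in> charts_at M q" and q: "q \<in> points N"
  shows "\<xi> \<in> normal_space N M c q \<longleftrightarrow> \<xi> \<in> tspace M q \<and> (\<forall>x\<in>tspace N q. metric \<psi> q (dincl N M q x \<psi>) (\<xi> \<psi>) = 0)"
  unfolding normal_space_def mem_Collect_eq using c_eq_0_iff[OF \<psi> dincl_tspace[OF q]] by blast

lemma normal_tspace: "\<xi> \<in> normal_space N M c q \<Longrightarrow> \<xi> \<in> tspace M q"
  by (simp add: normal_space_def)

lemma normal_lincomb:
  assumes q: "q \<in> points N" and "\<xi> \<in> normal_space N M c q" "\<zeta> \<in> normal_space N M c q"
  shows "a *\<^sub>R \<xi> + b *\<^sub>R \<zeta> \<in> normal_space N M c q"
proof -
  obtain \<psi> where \<psi>: "\<psi> \<in> charts_at M q" using ex_chart_M[OF q] by blast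
  show ?thesis
    using assms(2,3) unfolding normal_iff[OF \<psi> q]
    by (intro conjI ballI tspace_add[OF M] tspace_scaleR[OF M]) (simp_all add: scaleR_fun_def metric_simps)
qed

lemma normal_scaleR: "q \<in> points N \<Longrightarrow> \<xi> \<in> normal_space N M c q \<Longrightarrow> r *\<^sub>R \<xi> \<in> normal_space N M c q"
  using normal_lincomb[of q \<xi> \<xi> r 0] by (simp only: scaleR_zero_left add_0_right)

section \<open>The orthogonal splitting along the submanifold\<close>

definition jac :: "('a, 'n) chart \<Rightarrow> ('a, 'm) chart \<Rightarrow> 'a \<Rightarrow> real ^ 'n ^ 'm" where
  "jac \<phi> \<psi> q = (\<chi> i j. dincl N M q (chart_vec N \<phi> (axis j 1) q) \<psi> $ i)"

text \<open>The Gram matrix of the first fundamental form of \<open>N\<close> in the chart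
  \<open>\<phi>\<close>, for the metric that \<open>\<psi>\<close> selects in the conformal
  class.\<close>

definition tgram :: "('a, 'n) chart \<Rightarrow> ('a, 'm) chart \<Rightarrow> 'a \<Rightarrow> real ^ 'n ^ 'n" where
  "tgram \<phi> \<psi> q = transpose (jac \<phi> \<psi> q) ** (gram \<psi> q ** jac \<phi> \<psi> q)"

context
  fixes \<phi> :: "('a, 'n) chart" and \<psi> :: "('a, 'm) chart" and q :: 'a
  assumes \<phi>: "\<phi> \<in> charts_at N q" and \<psi>: "\<psi> \<in> charts_at M q"
begin

lemma q_N: "q \<in> points N"
  by (rule openin_points[OF openin_chart[OF N charts_atD(1)[OF \<phi>]] charts_atD(2)[OF \<phi>]])

lemma dincl_jac:
  assumes x: "x \<in> tspace N q"
  shows "dincl N M q x \<psi> = jac \<phi> \<psi> q *v x \<phi>"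
proof -
  note T = chart_vec_tspace[OF N \<phi>]
  have lin: "linear (\<lambda>a. dincl N M q (chart_vec N \<phi> a q) \<psi>)"
  proof (rule linearI)
    fix a b r
    show "dincl N M q (chart_vec N \<phi> (a + b) q) \<psi> = dincl N M q (chart_vec N \<phi> a q) \<psi> + dincl N M q (chart_vec N \<phi> b q) \<psi>"
      using fun_cong[OF dincl_lincomb[OF q_N T T, of 1 a 1 b], of \<psi>]
      unfolding chart_vec_add[OF N \<phi>] scaleR_one plus_fun_apply .
    show "dincl N M q (chart_vec N \<phi> (r *\<^sub>R a) q) \<psi> = r *\<^sub>R dincl N M q (chart_vec N \<phi> a q) \<psi>"
      using fun_cong[OF dincl_lincomb[OF q_N T T, of r a 0 a], of \<psi>]
      unfolding chart_vec_scaleR[OF N \<phi>] scaleR_zero_left add_0_right by (simp only: scaleR_fun_def)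
  qed
  have "dincl N M q x \<psi> = dincl N M q (chart_vec N \<phi> (x \<phi>) q) \<psi>" by (simp add: chart_vec_eq[OF N \<phi> x])
  also have "\<dots> = (\<Sum>j\<in>UNIV. x \<phi> $ j *\<^sub>R dincl N M q (chart_vec N \<phi> (axis j 1) q) \<psi>)"
    by (rule linear_eq_axis_sum[OF lin])
  also have "\<dots> = jac \<phi> \<psi> q *v x \<phi>"
    by (simp add: jac_def matrix_vector_mult_def vec_eq_iff mult.commute)
  finally show ?thesis .
qed

lemma metric_jac: "metric \<psi> q (jac \<phi> \<psi> q *v y) b = y \<bullet> (transpose (jac \<phi> \<psi> q) *v (gram \<psi> q *v b))"
  by (simp add: metric_def dot_lmul_matrix[symmetric] inner_commute)

lemma jac_eq_0D:
  assumes "jac \<phi> \<psi> q *v y = 0"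
  shows "y = 0"
proof -
  note T = chart_vec_tspace[OF N \<phi>]
  have "dincl N M q (chart_vec N \<phi> y q) \<psi> = dincl N M q (chart_vec N \<phi> 0 q) \<psi>"
    using assms by (simp add: dincl_jac[OF T] chart_vec_same[OF N \<phi>])
  then have "dincl N M q (chart_vec N \<phi> y q) = dincl N M q (chart_vec N \<phi> 0 q)"
    by (rule tspace_eqI[OF dincl_tspace[OF q_N T] dincl_tspace[OF q_N T] \<psi>])
  then have "chart_vec N \<phi> y q = chart_vec N \<phi> 0 q"
    using inj_on_dincl[OF q_N] T by (simp add: inj_on_eq_iff)
  then show ?thesis using chart_vec_same[OF N \<phi>] by metis
qed

lemma tgram_metric: "y \<bullet> (tgram \<phi> \<psi> q *v z) = metric \<psi> q (jac \<phi> \<psi> q *v y) (jac \<phi> \<psi> q *v z)"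
  unfolding metric_jac by (simp add: tgram_def matrix_vector_mul_assoc matrix_mul_assoc)

text \<open>A vector in the kernel has a tangential image of length 0; positivity of the metric and
  injectivity of the differential make it vanish.\<close>

lemma invertible_tgram: "invertible (tgram \<phi> \<psi> q)"
proof -
  have "y = 0" if "tgram \<phi> \<psi> q *v y = 0" for y
  proof -
    have "metric \<psi> q (jac \<phi> \<psi> q *v y) (jac \<phi> \<psi> q *v y) = 0" using that tgram_metric[of y y] by simp
    then show ?thesis using jac_eq_0D metric_eq_0_iff[OF \<psi>] by blast
  qed
  then show ?thesis
    unfolding invertible_left_inverse matrix_left_invertible_ker by blast
qed

text \<open>The tangential part solves the normal equation of orthogonal projection, with
  \<open>tgram\<close> as its matrix. The equation is kept in the conclusion because the smoothness
  of the tangential part is later derived from it.\<close>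

lemma ex_splitting:
  assumes w: "w \<in> tspace M q"
  shows "\<exists>x \<xi>. x \<in> tspace N q \<and> \<xi> \<in> normal_space N M c q \<and> w = dincl N M q x + \<xi>
    \<and> tgram \<phi> \<psi> q *v x \<phi> = transpose (jac \<phi> \<psi> q) *v (gram \<psi> q *v w \<psi>)"
proof -
  let ?r = "transpose (jac \<phi> \<psi> q) *v (gram \<psi> q *v w \<psi>)"
  obtain y where y: "tgram \<phi> \<psi> q *v y = ?r" using inv_if_invertible[OF invertible_tgram] by metis
  let ?x = "chart_vec N \<phi> y q"
  have x: "?x \<in> tspace N q" "?x \<phi> = y" by (simp_all add: chart_vec_tspace[OF N \<phi>] chart_vec_same[OF N \<phi>])
  have "w - dincl N M q ?x \<in> normal_space N M c q"
    unfolding normal_iff[OF \<psi> q_N]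
  proof (intro conjI ballI)
    show "w - dincl N M q ?x \<in> tspace M q" by (intro tspace_diff[OF M] w dincl_tspace[OF q_N] x)
    fix z assume z: "z \<in> tspace N q"
    have "metric \<psi> q (dincl N M q z \<psi>) (dincl N M q ?x \<psi>) = z \<phi> \<bullet> ?r"
      using tgram_metric[of "z \<phi>" y] by (simp add: dincl_jac z x y)
    moreover have "metric \<psi> q (dincl N M q z \<psi>) (w \<psi>) = z \<phi> \<bullet> ?r"
      by (simp only: dincl_jac[OF z] metric_jac)
    ultimately show "metric \<psi> q (dincl N M q z \<psi>) ((w - dincl N M q ?x) \<psi>) = 0"
      by (simp add: metric_simps)
  qed
  then show ?thesis
    using x y by (intro exI[of _ ?x] exI[of _ "w - dincl N M q ?x"]) simp
qed

end

text \<open>The difference of the two tangential parts is also a difference of normal vectors, hence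
  orthogonal to itself.\<close>

lemma splitting_unique:
  assumes q: "q \<in> points N" and x: "x \<in> tspace N q" "x' \<in> tspace N q"
    and \<xi>: "\<xi> \<in> normal_space N M c q" "\<xi>' \<in> normal_space N M c q"
    and eq: "dincl N M q x + \<xi> = dincl N M q x' + \<xi>'"
  shows "x = x'" "\<xi> = \<xi>'"
proof -
  obtain \<psi> where \<psi>: "\<psi> \<in> charts_at M q" using ex_chart_M[OF q] by blast
  have T: "1 *\<^sub>R x + (-1) *\<^sub>R x' \<in> tspace N q" by (intro tspace_add[OF N] tspace_scaleR[OF N] x)
  let ?d = "dincl N M q (1 *\<^sub>R x + (-1) *\<^sub>R x')"
  have dx: "?d \<psi> = dincl N M q x \<psi> - dincl N M q x' \<psi>"
    unfolding dincl_lincomb[OF q x] by (simp add: scaleR_fun_def)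
  have "dincl N M q x \<psi> + \<xi> \<psi> = dincl N M q x' \<psi> + \<xi>' \<psi>"
    using fun_cong[OF eq, of \<psi>] by (simp only: plus_fun_apply)
  then have "dincl N M q x \<psi> - dincl N M q x' \<psi> = \<xi>' \<psi> - \<xi> \<psi>" by (simp add: algebra_simps)
  with dx have d: "?d \<psi> = \<xi>' \<psi> - \<xi> \<psi>" by (rule trans)
  have "metric \<psi> q (?d \<psi>) (\<xi>' \<psi>) = 0" "metric \<psi> q (?d \<psi>) (\<xi> \<psi>) = 0"
    using \<xi> T unfolding normal_iff[OF \<psi> q] by blast+
  then have "metric \<psi> q (?d \<psi>) (?d \<psi>) = 0" unfolding d metric_simps(5) by simp
  then have d0: "?d \<psi> = 0" using metric_eq_0_iff[OF \<psi>] by blast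
  then have "dincl N M q x = dincl N M q x'"
    using dx by (intro tspace_eqI[OF dincl_tspace[OF q x(1)] dincl_tspace[OF q x(2)] \<psi>]) simp
  then show "x = x'" using inj_on_dincl[OF q] x by (simp add: inj_on_eq_iff)
  show "\<xi> = \<xi>'"
    using d d0 by (intro tspace_eqI[OF normal_tspace[OF \<xi>(1)] normal_tspace[OF \<xi>(2)] \<psi>]) simp
qed

lemma tan_part_eqI:
  assumes q: "q \<in> points N" and x: "x \<in> tspace N q" and \<xi>: "\<xi> \<in> normal_space N M c q"
  shows "tan_part N M c q (dincl N M q x + \<xi>) = x" "nor_part N M c q (dincl N M q x + \<xi>) = \<xi>"
proof -
  show "tan_part N M c q (dincl N M q x + \<xi>) = x"
    unfolding tan_part_def
  proof (rule the_equality)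
    show "x \<in> tspace N q \<and> (\<exists>\<zeta>\<in>normal_space N M c q. dincl N M q x + \<xi> = dincl N M q x + \<zeta>)"
      using x \<xi> by blast
    show "y = x" if "y \<in> tspace N q \<and> (\<exists>\<zeta>\<in>normal_space N M c q. dincl N M q x + \<xi> = dincl N M q y + \<zeta>)" for y
      using that splitting_unique(1)[OF q x _ \<xi>] by blast
  qed
  show "nor_part N M c q (dincl N M q x + \<xi>) = \<xi>"
    unfolding nor_part_def
  proof (rule the_equality)
    show "\<xi> \<in> normal_space N M c q \<and> (\<exists>y\<in>tspace N q. dincl N M q x + \<xi> = dincl N M q y + \<xi>)"
      using x \<xi> by blast
    show "\<zeta> = \<xi>" if "\<zeta> \<in> normal_space N M c q \<and> (\<exists>y\<in>tspace N q. dincl N M q x + \<xi> = dincl N M q y + \<zeta>)" for \<zeta>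
      using that splitting_unique(2)[OF q x _ \<xi>] by blast
  qed
qed

lemma splitting:
  assumes q: "q \<in> points N" and w: "w \<in> tspace M q"
  shows "tan_part N M c q w \<in> tspace N q" "nor_part N M c q w \<in> normal_space N M c q"
    "w = dincl N M q (tan_part N M c q w) + nor_part N M c q w"
proof -
  obtain \<psi> where \<psi>: "\<psi> \<in> charts_at M q" using ex_chart_M[OF q] by blast
  obtain \<phi> where \<phi>: "\<phi> \<in> charts_at N q" using ex_chart_at[OF N q] by blast
  obtain x \<xi> where x: "x \<in> tspace N q" and \<xi>: "\<xi> \<in> normal_space N M c q" and e: "w = dincl N M q x + \<xi>"
    using ex_splitting[OF \<phi> \<psi> w] by blast
  show "tan_part N M c q w \<in> tspace N q" "nor_part N M c q w \<in> normal_space N M c q"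
    "w = dincl N M q (tan_part N M c q w) + nor_part N M c q w"
    using x \<xi> unfolding e tan_part_eqI[OF q x \<xi>] by blast+
qed

lemma tan_part_solve:
  assumes \<phi>: "\<phi> \<in> charts_at N q" and \<psi>: "\<psi> \<in> charts_at M q" and w: "w \<in> tspace M q"
  shows "tgram \<phi> \<psi> q *v tan_part N M c q w \<phi> = transpose (jac \<phi> \<psi> q) *v (gram \<psi> q *v w \<psi>)"
proof -
  note q = q_N[OF \<phi> \<psi>]
  obtain x \<xi> where x: "x \<in> tspace N q" and \<xi>: "\<xi> \<in> normal_space N M c q" and e: "w = dincl N M q x + \<xi>"
    and s: "tgram \<phi> \<psi> q *v x \<phi> = transpose (jac \<phi> \<psi> q) *v (gram \<psi> q *v w \<psi>)"
    using ex_splitting[OF \<phi> \<psi> w] by blast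
  show ?thesis using s tan_part_eqI(1)[OF q x \<xi>] unfolding e[symmetric] by (simp only:)
qed

lemma nor_part_normal:
  assumes q: "q \<in> points N" and \<xi>: "\<xi> \<in> normal_space N M c q"
  shows "nor_part N M c q \<xi> = \<xi>"
proof -
  obtain \<phi> where "\<phi> \<in> charts_at N q" using ex_chart_at[OF N q] by blast
  then have 0: "0 \<in> tspace N q" using tspace_zero[OF N chart_vec_tspace[OF N]] by blast
  have "dincl N M q 0 = 0" using dincl_lincomb[OF q 0 0, of 0 0] by (simp only: scaleR_zero_left add_0_right)
  then show ?thesis using tan_part_eqI(2)[OF q 0 \<xi>] by (simp only: add_0_left)
qed

lemma nor_part_lincomb:
  assumes q: "q \<in> points N" and v: "v \<in> tspace M q" and w: "w \<in> tspace M q"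
  shows "nor_part N M c q (a *\<^sub>R v + b *\<^sub>R w) = a *\<^sub>R nor_part N M c q v + b *\<^sub>R nor_part N M c q w"
proof -
  let ?x = "a *\<^sub>R tan_part N M c q v + b *\<^sub>R tan_part N M c q w"
    and ?\<xi> = "a *\<^sub>R nor_part N M c q v + b *\<^sub>R nor_part N M c q w"
  note sv = splitting[OF q v] and sw = splitting[OF q w]
  have x: "?x \<in> tspace N q" by (intro tspace_add[OF N] tspace_scaleR[OF N] sv sw)
  have \<xi>: "?\<xi> \<in> normal_space N M c q" by (intro normal_lincomb[OF q] sv sw)
  have "a *\<^sub>R v + b *\<^sub>R w = a *\<^sub>R (dincl N M q (tan_part N M c q v) + nor_part N M c q v)
     + b *\<^sub>R (dincl N M q (tan_part N M c q w) + nor_part N M c q w)"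
    by (simp only: sv(3)[symmetric] sw(3)[symmetric])
  also have "\<dots> = dincl N M q ?x + ?\<xi>"
    unfolding dincl_lincomb[OF q sv(1) sw(1)] by (simp only: scaleR_add_right add_ac)
  finally show ?thesis using tan_part_eqI(2)[OF q x \<xi>] by (simp only:)
qed

text \<open>The tangential part of \<open>w\<close> is orthogonal to \<open>\<zeta>\<close>;
  projections may thus be dropped in products with normal vectors.\<close>

lemma nor_part_metric:
  assumes \<psi>: "\<psi> \<in> charts_at M q" and q: "q \<in> points N" and w: "w \<in> tspace M q" and \<zeta>: "\<zeta> \<in> normal_space N M c q"
  shows "metric \<psi> q (nor_part N M c q w \<psi>) (\<zeta> \<psi>) = metric \<psi> q (w \<psi>) (\<zeta> \<psi>)"
proof -
  note sw = splitting[OF q w]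
  have "w \<psi> = dincl N M q (tan_part N M c q w) \<psi> + nor_part N M c q w \<psi>"
    using fun_cong[OF sw(3), of \<psi>] by (simp only: plus_fun_apply)
  moreover have "metric \<psi> q (dincl N M q (tan_part N M c q w) \<psi>) (\<zeta> \<psi>) = 0"
    using \<zeta> sw(1) unfolding normal_iff[OF \<psi> q] by blast
  ultimately show ?thesis by (simp add: metric_simps)
qed

text \<open>The difference of the two vectors is itself normal and can be taken as the test
  vector.\<close>

lemma normal_eqI:
  assumes \<psi>: "\<psi> \<in> charts_at M q" and q: "q \<in> points N"
    and \<xi>: "\<xi> \<in> normal_space N M c q" "\<xi>' \<in> normal_space N M c q"
    and eq: "\<And>\<zeta>. \<zeta> \<in> normal_space N M c q \<Longrightarrow> metric \<psi> q (\<xi> \<psi>) (\<zeta> \<psi>) = metric \<psi> q (\<xi>' \<psi>) (\<zeta> \<psi>)"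
  shows "\<xi> = \<xi>'"
proof -
  have "1 *\<^sub>R \<xi> + (-1) *\<^sub>R \<xi>' \<in> normal_space N M c q" by (rule normal_lincomb[OF q \<xi>])
  moreover have "(1 *\<^sub>R \<xi> + (-1) *\<^sub>R \<xi>') \<psi> = \<xi> \<psi> - \<xi>' \<psi>" by (simp add: scaleR_fun_def)
  ultimately have "metric \<psi> q (\<xi> \<psi> - \<xi>' \<psi>) (\<xi> \<psi> - \<xi>' \<psi>) = 0"
    using eq[of "1 *\<^sub>R \<xi> + (-1) *\<^sub>R \<xi>'"] by (simp only: metric_simps(2))
  then show ?thesis
    using metric_eq_0_iff[OF \<psi>] by (intro tspace_eqI[OF normal_tspace[OF \<xi>(1)] normal_tspace[OF \<xi>(2)] \<psi>]) simp
qed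

text \<open>In charts of both manifolds the tangential part solves a linear system with smooth
  invertible matrix, so \<open>smooth_fun_solve\<close> applies.\<close>

lemma tfield_tan_part:
  assumes w: "tfield N M V w"
  shows "tfield N N V (\<lambda>q. tan_part N M c q (w q))"
proof (rule submfd.tfield_local[OF submfd_self[OF N]])
  show V: "openin (mtop N) V" by (rule tfield_openin[OF w])
  fix p assume p: "p \<in> V"
  note pN = openin_points[OF V p]
  obtain \<psi> where \<psi>: "\<psi> \<in> charts_at M p" using ex_chart_M[OF pN] by blast
  obtain \<phi> where \<phi>: "\<phi> \<in> charts_at N p" using ex_chart_at[OF N pN] by blast
  note \<psi>' = charts_atD[OF \<psi>] and \<phi>' = charts_atD[OF \<phi>]
  let ?W = "V \<inter> fst \<psi> \<inter> fst \<phi>"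
  have W: "openin (mtop N) ?W" by (intro openin_Int_chart[OF N \<phi>'(1)] openin_Int_chart_M[OF V \<psi>'(1)])
  have cW: "\<psi> \<in> charts_at M q" "\<phi> \<in> charts_at N q" "q \<in> points N" "w q \<in> tspace M q" if "q \<in> ?W" for q
    using that \<psi>' \<phi>' openin_points[OF W that] tfield_tspace[OF w] by (auto intro: charts_atI)
  have jac: "smooth_fun N ?W (jac \<phi> \<psi>)"
  proof -
    have t: "tfield N N (?W) (\<lambda>q. chart_vec N \<phi> (axis j 1) q)" for j
      by (rule submfd.tfield_chart_vec[OF submfd_self[OF N] W \<phi>'(1) _ smooth_fun_const]) auto
    have "smooth_fun N ?W (\<lambda>q. dincl N M q (chart_vec N \<phi> (axis j 1) q) \<psi>)" for j
      by (rule smooth_fun_subset[OF tfield_smooth[OF tfield_dincl[OF t] \<psi>'(1)]]) auto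
    then show ?thesis
      unfolding jac_def[abs_def] by (intro smooth_fun_vec_lambda[OF N W] smooth_fun_vec_nth[OF N W])
  qed
  have gram: "smooth_fun N ?W (gram \<psi>)"
    by (rule smooth_fun_restrict[OF W openin_chart[OF M \<psi>'(1)] smooth_gram[OF \<psi>'(1)]]) auto
  have tr: "smooth_fun N ?W (\<lambda>q. transpose (jac \<phi> \<psi> q))"
    unfolding transpose_def by (intro smooth_fun_vec_lambda[OF N W] smooth_fun_vec_nth[OF N W] jac)
  have tg: "smooth_fun N ?W (tgram \<phi> \<psi>)"
    unfolding tgram_def[abs_def] by (intro smooth_fun_matrix_mult[OF N W] tr gram jac)
  have sw: "smooth_fun N ?W (\<lambda>q. w q \<psi>)" by (rule smooth_fun_subset[OF tfield_smooth[OF w \<psi>'(1)]]) auto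
  have rhs: "smooth_fun N ?W (\<lambda>q. transpose (jac \<phi> \<psi> q) *v (gram \<psi> q *v w q \<psi>))"
    by (intro smooth_fun_matrix_vector_mult[OF N W] tr gram sw)
  have "smooth_fun N ?W (\<lambda>q. tan_part N M c q (w q) \<phi>)"
  proof (rule smooth_fun_solve[OF N W tg])
    show "smooth_fun N ?W (\<lambda>q. tgram \<phi> \<psi> q *v tan_part N M c q (w q) \<phi>)"
      using rhs tan_part_solve[OF cW(2,1,4)]
        smooth_fun_cong[OF N W, of "\<lambda>q. tgram \<phi> \<psi> q *v tan_part N M c q (w q) \<phi>"
          "\<lambda>q. transpose (jac \<phi> \<psi> q) *v (gram \<psi> q *v w q \<psi>)"] by blast
    show "det (tgram \<phi> \<psi> q) \<noteq> 0" if "q \<in> ?W" for q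
      using invertible_tgram[OF cW(2,1)[OF that]] by (simp add: invertible_det_nz)
  qed
  then have "tfield N N ?W (\<lambda>q. tan_part N M c q (w q))"
    by (intro submfd.tfield_chartI[OF submfd_self[OF N] W \<phi>'(1)] splitting(1) cW) auto
  then show "\<exists>W. p \<in> W \<and> W \<subseteq> V \<and> tfield N N W (\<lambda>q. tan_part N M c q (w q))"
    using p \<psi>' \<phi>' by (intro exI[of _ ?W]) auto
qed

lemma normal_section_nor_part:
  assumes w: "tfield N M V w"
  shows "normal_section N M c V (\<lambda>q. nor_part N M c q (w q))"
  unfolding normal_section_def
proof
  note V = tfield_openin[OF w] and t = tfield_dincl[OF tfield_tan_part[OF w]]
  have s: "nor_part N M c q (w q) \<in> normal_space N M c q"
    "w q = dincl N M q (tan_part N M c q (w q)) + nor_part N M c q (w q)" if "q \<in> V" for q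
    using splitting[OF openin_points[OF V that] tfield_tspace[OF w that]] by blast+
  show "\<forall>q\<in>V. nor_part N M c q (w q) \<in> normal_space N M c q" using s by blast
  show "tfield N M V (\<lambda>q. nor_part N M c q (w q))"
  proof (rule tfieldI[OF V])
    show "nor_part N M c q (w q) \<in> tspace M q" if "q \<in> V" for q
      by (rule normal_tspace[OF s(1)[OF that]])
    fix \<psi> assume \<psi>: "\<psi> \<in> atlas M"
    have W: "openin (mtop N) (V \<inter> fst \<psi>)" by (rule openin_Int_chart_M[OF V \<psi>])
    have "smooth_fun N (V \<inter> fst \<psi>) (\<lambda>q. w q \<psi> - dincl N M q (tan_part N M c q (w q)) \<psi>)"
      by (intro smooth_fun_diff[OF N W] tfield_smooth[OF w \<psi>] tfield_smooth[OF t \<psi>])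
    moreover have "w q \<psi> - dincl N M q (tan_part N M c q (w q)) \<psi> = nor_part N M c q (w q) \<psi>" if "q \<in> V \<inter> fst \<psi>" for q
      using fun_cong[OF s(2), of q \<psi>] that by (simp add: algebra_simps)
    ultimately show "smooth_fun N (V \<inter> fst \<psi>) (\<lambda>q. nor_part N M c q (w q) \<psi>)"
      using smooth_fun_cong[OF N W, of "\<lambda>q. w q \<psi> - dincl N M q (tan_part N M c q (w q)) \<psi>" "\<lambda>q. nor_part N M c q (w q) \<psi>"] by blast
  qed
qed

end

section \<open>The connection on the weightless normal bundle\<close>

lemma chart_weighted_eq:
  assumes "manifold M" "\<psi> \<in> charts_at M q" "l \<in> weighted M k q E"
  shows "l = chart_weighted M \<psi> k q (l (chart_frame M \<psi> q))"
proof
  fix f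
  show "l f = chart_weighted M \<psi> k q (l (chart_frame M \<psi> q)) f"
    using weighted_eq_chart_frame[OF assms, of f] assms(3)
    by (cases "frame_at M q f") (simp_all add: chart_weighted_def weighted_def)
qed

context conf_submfd
begin

text \<open>The form \<delta> pulled back to \<open>N\<close>: the difference of the connections
  that \<open>D'\<close> and \<open>D\<close> induce on \<open>L\<close>.\<close>

definition trace_diff ::
    "('a, 'm, 'm) cderiv \<Rightarrow> ('a, 'm, 'm) cderiv \<Rightarrow> ('a, 'm) chart \<Rightarrow> 'a \<Rightarrow> ('a, 'n) tvec \<Rightarrow> real" where
  "trace_diff D D' \<psi> p x = trace (christoffel M D' \<psi> p (dincl N M p x) - christoffel M D \<psi> p (dincl N M p x)) / real CARD('m)"

text \<open>The two remaining terms of the formula in \<open>christoffel_difference\<close> each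
  contain the product of the tangential vector with \<xi> or with \<zeta>, and vanish.\<close>

lemma christoffel_difference_normal:
  assumes D: "weyl_structure M c D" and D': "weyl_structure M c D'" and \<psi>: "\<psi> \<in> charts_at M p"
    and p: "p \<in> points N" and x: "x \<in> tspace N p"
    and \<xi>: "\<xi> \<in> normal_space N M c p" and \<zeta>: "\<zeta> \<in> normal_space N M c p"
  shows "metric \<psi> p ((christoffel M D' \<psi> p (dincl N M p x) - christoffel M D \<psi> p (dincl N M p x)) *v \<xi> \<psi>) (\<zeta> \<psi>)
    = trace_diff D D' \<psi> p x * metric \<psi> p (\<xi> \<psi>) (\<zeta> \<psi>)"
proof -
  have "metric \<psi> p (dincl N M p x \<psi>) (\<xi> \<psi>) = 0" "metric \<psi> p (dincl N M p x \<psi>) (\<zeta> \<psi>) = 0"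
    using \<xi> \<zeta> x unfolding normal_iff[OF \<psi> p] by blast+
  then show ?thesis
    using christoffel_difference[OF D D' \<psi> dincl_tspace[OF p x] normal_tspace[OF \<xi>] normal_tspace[OF \<zeta>]]
    by (simp add: trace_diff_def)
qed

text \<open>The parameter \<open>r\<close> serves two situations: 0 for the normal connection, and
  minus the trace difference for the weightless one, where the coefficient of \<xi> becomes
  0.\<close>

lemma nor_part_christoffel_difference:
  assumes D: "weyl_structure M c D" and D': "weyl_structure M c D'" and \<psi>: "\<psi> \<in> charts_at M p"
    and p: "p \<in> points N" and x: "x \<in> tspace N p" and \<xi>: "\<xi> \<in> normal_space N M c p"
    and w: "w \<in> tspace M p" "w' \<in> tspace M p"
    and eq: "w' \<psi> = w \<psi> + (christoffel M D' \<psi> p (dincl N M p x) - christoffel M D \<psi> p (dincl N M p x)) *v \<xi> \<psi>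
      + r *\<^sub>R \<xi> \<psi>"
  shows "nor_part N M c p w' = 1 *\<^sub>R nor_part N M c p w + (trace_diff D D' \<psi> p x + r) *\<^sub>R \<xi>"
proof (rule normal_eqI[OF \<psi> p splitting(2)[OF p w(2)]])
  show "1 *\<^sub>R nor_part N M c p w + (trace_diff D D' \<psi> p x + r) *\<^sub>R \<xi> \<in> normal_space N M c p"
    by (rule normal_lincomb[OF p splitting(2)[OF p w(1)] \<xi>])
  fix \<zeta> assume \<zeta>: "\<zeta> \<in> normal_space N M c p"
  have "metric \<psi> p (nor_part N M c p w' \<psi>) (\<zeta> \<psi>)
      = metric \<psi> p (w \<psi>) (\<zeta> \<psi>) + (trace_diff D D' \<psi> p x + r) * metric \<psi> p (\<xi> \<psi>) (\<zeta> \<psi>)"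
    unfolding nor_part_metric[OF \<psi> p w(2) \<zeta>] eq metric_simps
      christoffel_difference_normal[OF D D' \<psi> p x \<xi> \<zeta>] by (simp add: algebra_simps)
  also have "\<dots> = metric \<psi> p (nor_part N M c p w \<psi>) (\<zeta> \<psi>)
      + (trace_diff D D' \<psi> p x + r) * metric \<psi> p (\<xi> \<psi>) (\<zeta> \<psi>)"
    by (simp only: nor_part_metric[OF \<psi> p w(1) \<zeta>])
  also have "\<dots> = metric \<psi> p ((1 *\<^sub>R nor_part N M c p w + (trace_diff D D' \<psi> p x + r) *\<^sub>R \<xi>) \<psi>) (\<zeta> \<psi>)"
    by (simp add: scaleR_fun_def metric_simps)
  finally show "metric \<psi> p (nor_part N M c p w' \<psi>) (\<zeta> \<psi>)
      = metric \<psi> p ((1 *\<^sub>R nor_part N M c p w + (trace_diff D D' \<psi> p x + r) *\<^sub>R \<xi>) \<psi>) (\<zeta> \<psi>)" .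
qed

lemma pull_conn_chart:
  assumes D: "weyl_structure M c D" and \<psi>: "\<psi> \<in> charts_at M p" and s: "tfield N M V s" and p: "p \<in> V"
    and x: "x \<in> tspace N p"
  shows "pull_conn N M D p x s \<in> tspace M p"
    "pull_conn N M D p x s \<psi> = dd N p x (\<lambda>q. s q \<psi>) + christoffel M D \<psi> p (dincl N M p x) *v s p \<psi>"
  using conn_formD[OF conn_form_pull_conn[OF weyl_connection[OF D] \<psi> openin_points[OF tfield_openin[OF s] p] x] s p]
  by blast+

lemma normal_conn_difference:
  assumes D: "weyl_structure M c D" and D': "weyl_structure M c D'" and \<psi>: "\<psi> \<in> charts_at M p"
    and \<xi>: "normal_section N M c V \<xi>" and p: "p \<in> V" and x: "x \<in> tspace N p"
  shows "normal_conn N M c D' p x \<xi> = 1 *\<^sub>R normal_conn N M c D p x \<xi> + trace_diff D D' \<psi> p x *\<^sub>R \<xi> p"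
proof -
  have t: "tfield N M V \<xi>" and n: "\<xi> p \<in> normal_space N M c p" using \<xi> p by (auto simp: normal_section_def)
  note pN = openin_points[OF tfield_openin[OF t] p]
  have "nor_part N M c p (pull_conn N M D' p x \<xi>) = 1 *\<^sub>R nor_part N M c p (pull_conn N M D p x \<xi>)
      + (trace_diff D D' \<psi> p x + 0) *\<^sub>R \<xi> p"
    by (rule nor_part_christoffel_difference[OF D D' \<psi> pN x n pull_conn_chart(1)[OF D \<psi> t p x] pull_conn_chart(1)[OF D' \<psi> t p x]])
       (simp add: pull_conn_chart(2)[OF D \<psi> t p x] pull_conn_chart(2)[OF D' \<psi> t p x] matrix_vector_mult_diff_rdistrib)
  then show ?thesis unfolding normal_conn_def by (simp only: add_0_right)
qed

text \<open>For tangential \<open>u\<close> the difference of the induced derivatives of \<open>u\<close> along itself has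
  product \<open>\<delta>(u) g(u, u)\<close> with \<open>u\<close>.\<close>

lemma induced_weyl_eq_imp_trace_diff:
  assumes D: "weyl_structure M c D" and D': "weyl_structure M c D'" and \<psi>: "\<psi> \<in> charts_at M p"
    and p: "p \<in> points N" and x: "x \<in> tspace N p"
    and eq: "\<And>V Y. tfield N N V Y \<Longrightarrow> p \<in> V \<Longrightarrow> induced_weyl N M c D p x Y = induced_weyl N M c D' p x Y"
  shows "trace_diff D D' \<psi> p x = 0"
proof -
  obtain \<phi> where \<phi>: "\<phi> \<in> charts_at N p" using ex_chart_at[OF N p] by blast
  note \<phi>' = charts_atD[OF \<phi>]
  \<comment> \<open>The hypothesis on the induced structures speaks of fields, so \<open>x\<close>
    is extended to a field on \<open>N\<close> with constant components.\<close>
  let ?Y = "chart_vec N \<phi> (x \<phi>)"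
  have Y: "tfield N N (fst \<phi>) ?Y"
    by (rule submfd.tfield_chart_vec[OF submfd_self[OF N] openin_chart[OF N \<phi>'(1)] \<phi>'(1) order_refl smooth_fun_const])
  have Yp: "?Y p = x" by (rule chart_vec_eq[OF N \<phi> x])
  let ?u = "dincl N M p x" and ?s = "\<lambda>q. dincl N M q (?Y q)"
  note s = tfield_dincl[OF Y] and uT = dincl_tspace[OF p x]
  note pc = pull_conn_chart[OF D \<psi> s \<phi>'(2) x] and pc' = pull_conn_chart[OF D' \<psi> s \<phi>'(2) x]
  let ?w = "pull_conn N M D p x ?s" and ?w' = "pull_conn N M D' p x ?s"
  note sw = splitting[OF p pc(1)] and sw' = splitting[OF p pc'(1)]
  have t: "tan_part N M c p ?w = tan_part N M c p ?w'"
    using eq[OF Y \<phi>'(2)] by (simp add: induced_weyl_def)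
  have dw: "?w' \<psi> - ?w \<psi> = (christoffel M D' \<psi> p ?u - christoffel M D \<psi> p ?u) *v ?u \<psi>"
    unfolding pc pc' Yp by (simp add: matrix_vector_mult_diff_rdistrib)
  \<comment> \<open>The tangential parts agree by hypothesis, so the two derivatives differ by a
    normal vector, which has product 0 with \<open>?u\<close>.\<close>
  have "?w' \<psi> - ?w \<psi> = nor_part N M c p ?w' \<psi> - nor_part N M c p ?w \<psi>"
    using fun_cong[OF sw(3), of \<psi>] fun_cong[OF sw'(3), of \<psi>] unfolding plus_fun_apply t by simp
  moreover have "metric \<psi> p (?u \<psi>) (nor_part N M c p ?w' \<psi>) = 0" "metric \<psi> p (?u \<psi>) (nor_part N M c p ?w \<psi>) = 0"
    using sw(2) sw'(2) x unfolding normal_iff[OF \<psi> p] by blast+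
  ultimately have "metric \<psi> p (?u \<psi>) (?w' \<psi> - ?w \<psi>) = 0" by (simp add: metric_simps)
  then have "metric \<psi> p ((christoffel M D' \<psi> p ?u - christoffel M D \<psi> p ?u) *v ?u \<psi>) (?u \<psi>) = 0"
    unfolding dw by (subst metric_sym[OF \<psi>])
  then have 0: "trace_diff D D' \<psi> p x * metric \<psi> p (?u \<psi>) (?u \<psi>) = 0"
    using christoffel_difference[OF D D' \<psi> uT uT uT] by (auto simp: trace_diff_def)
  show ?thesis
  proof (cases "?u = 0")
    case True
    \<comment> \<open>Here the product with \<open>?u\<close> carries no information; instead
      linearity in the direction makes both matrices vanish.\<close>
    have "christoffel M D \<psi> p 0 = 0" if "weyl_structure M c D" for D
      using christoffel_lincomb[OF M weyl_connection[OF that] \<psi> uT uT, of 0 0]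
      by (simp only: scaleR_zero_left add_0_right)
    then have "christoffel M D \<psi> p ?u = 0" "christoffel M D' \<psi> p ?u = 0" unfolding True using D D' by blast+
    then show ?thesis by (simp add: trace_diff_def trace_def)
  next
    case False
    have "?u \<psi> \<noteq> 0"
    proof
      assume "?u \<psi> = 0"
      then have "?u = 0" by (intro tspace_eqI[OF uT tspace_zero[OF M uT] \<psi>]) simp
      then show False using False by simp
    qed
    then show ?thesis using 0 metric_eq_0_iff[OF \<psi>, of "?u \<psi>"] by simp
  qed
qed

section \<open>The weightless normal connection in a chart\<close>

definition wcoord :: "('a, 'm) chart \<Rightarrow> ('a \<Rightarrow> ('a, 'm) wvec) \<Rightarrow> 'a \<Rightarrow> real ^ 'm" where
  "wcoord \<psi> \<eta> q = \<eta> q (chart_frame M \<psi> q) \<psi>"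

text \<open>\<open>weyl_mat\<close> is the connection matrix of the metric connection \<open>D \<otimes> L\<^sup>-\<^sup>1\<close>.\<close>

definition weyl_mat :: "('a, 'm, 'm) cderiv \<Rightarrow> ('a, 'm) chart \<Rightarrow> 'a \<Rightarrow> ('a, 'n) tvec \<Rightarrow> real ^ 'm ^ 'm" where
  "weyl_mat D \<psi> p x = christoffel M D \<psi> p (dincl N M p x)
     - (trace (christoffel M D \<psi> p (dincl N M p x)) / real CARD('m)) *\<^sub>R mat 1"

text \<open>The derivative of a weightless normal section whose value on the coordinate frame has
  the components \<open>h\<close>. The result is again a tangent vector of \<open>M\<close>, the
  value of the derivative on the coordinate frame, which is what \<open>nor_part\<close> can be
  applied to.\<close>

definition wcov :: "('a, 'm, 'm) cderiv \<Rightarrow> ('a, 'm) chart \<Rightarrow> 'a \<Rightarrow> ('a, 'n) tvec \<Rightarrow> ('a \<Rightarrow> real ^ 'm) \<Rightarrow> ('a, 'm) tvec" where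
  "wcov D \<psi> p x h = nor_part N M c p (chart_vec M \<psi> (dd N p x h + weyl_mat D \<psi> p x *v h p) p)"

lemma wnormal_section_openin: "wnormal_section N M c V \<eta> \<Longrightarrow> openin (mtop N) V"
  and wnormal_section_mem: "wnormal_section N M c V \<eta> \<Longrightarrow> q \<in> V \<Longrightarrow> \<eta> q \<in> weighted M (- 1) q (normal_space N M c q)"
  and wnormal_section_tfield: "wnormal_section N M c V \<eta> \<Longrightarrow> frame_field N M W e \<Longrightarrow> W \<subseteq> V \<Longrightarrow> tfield N M W (\<lambda>q. \<eta> q (e q))"
  by (simp_all add: wnormal_section_def wnormal_space_def)

lemma weighted_frame_mem: "l \<in> weighted M k q E \<Longrightarrow> frame_at M q f \<Longrightarrow> l f \<in> E"
  by (simp add: weighted_def)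

lemma wnormal_chart_frame:
  assumes "wnormal_section N M c V \<eta>" "q \<in> V" "\<psi> \<in> charts_at M q"
  shows "\<eta> q (chart_frame M \<psi> q) \<in> normal_space N M c q"
  by (rule weighted_frame_mem[OF wnormal_section_mem[OF assms(1,2)] chart_frame_at[OF M assms(3)]])

lemma normal_section_chart_frame:
  assumes \<eta>: "wnormal_section N M c V \<eta>" and \<psi>: "\<psi> \<in> atlas M"
  shows "normal_section N M c (V \<inter> fst \<psi>) (\<lambda>q. \<eta> q (chart_frame M \<psi> q))"
  unfolding normal_section_def
  using wnormal_section_tfield[OF \<eta> frame_field_chart[OF openin_Int_chart_M[OF wnormal_section_openin[OF \<eta>] \<psi>] \<psi> Int_lower2] Int_lower1]
    wnormal_chart_frame[OF \<eta> _ charts_atI[OF \<psi>]] by blast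

text \<open>A local section of \<open>L\<^sup>k\<close> without zeros; with \<open>k = - 1\<close>
  it provides the decomposition of a weightless section on which the tensor product connection is
  evaluated.\<close>

lemma dens_section_unit:
  assumes V: "openin (mtop N) V" and \<psi>: "\<psi> \<in> atlas M" "V \<subseteq> fst \<psi>"
  shows "dens_section N M k V (\<lambda>q. chart_weighted M \<psi> k q (1::real))"
  unfolding dens_section_def density_space_def
proof (intro conjI ballI allI impI V)
  show "chart_weighted M \<psi> k q (1::real) \<in> weighted M k q UNIV" if "q \<in> V" for q
    using that \<psi> by (intro chart_weighted_mem[OF M charts_atI]) auto
  fix W e assume *: "W \<subseteq> V \<and> frame_field N M W e"
  then have e: "frame_field N M W e" by blast
  have W: "openin (mtop N) W" by (rule frame_field_openin[OF e])
  have sub: "W \<inter> fst \<psi> = W" using * \<psi> by auto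
  have fa: "frame_at M q (e q)" if "q \<in> W" for q by (rule frame_field_frame_at[OF e that])
  have F: "smooth_fun N W (\<lambda>q. frame_mat \<psi> (e q))" using smooth_frame_mat[OF e \<psi>(1)] unfolding sub .
  have "smooth_fun N W (\<lambda>q. \<bar>det (frame_mat \<psi> (e q))\<bar> powr (- (k / real CARD('m))))"
  proof (rule smooth_fun_abs_powr[OF N W smooth_fun_det[OF N W F]])
    show "det (frame_mat \<psi> (e q)) \<noteq> 0" if "q \<in> W" for q
      using fa[OF that] frame_at_iff[OF M charts_atI[OF \<psi>(1)], of q "e q"] that sub by (auto simp: invertible_det_nz)
  qed
  then show "smooth_fun N W (\<lambda>q. chart_weighted M \<psi> k q (1::real) (e q))"
    using smooth_fun_cong[OF N W, of "\<lambda>q. \<bar>det (frame_mat \<psi> (e q))\<bar> powr (- (k / real CARD('m)))" "\<lambda>q. chart_weighted M \<psi> k q (1::real) (e q)"] fa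
    by (simp add: chart_weighted_def)
qed

lemma tensor_chart_weighted:
  "tensor \<xi> (chart_weighted M \<psi> k q (r::real)) = chart_weighted M \<psi> k q (r *\<^sub>R \<xi>)"
  by (simp add: fun_eq_iff tensor_def chart_weighted_def scaleR_fun_def)

text \<open>Let \<open>\<eta> = \<xi> \<otimes> l\<close> and let \<lambda> be the value of
  \<open>l\<close> on the coordinate frame. Then \<eta> has the components \<lambda>\<xi>, and the
  product rule gives \<lambda> times the normal derivative of \<xi> plus
  \<open>(d\<lambda> - \<tau> \<lambda>) \<xi>\<close>, with \<tau> the trace of the Christoffel
  matrix over \<open>m\<close>. This is \<open>wcov\<close> of the components, in which the
  decomposition is no longer visible.\<close>

lemma wnormal_conn_eq:
  assumes D: "weyl_structure M c D" and \<psi>: "\<psi> \<in> charts_at M p" and \<eta>: "wnormal_section N M c V \<eta>"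
    and p: "p \<in> V" and x: "x \<in> tspace N p"
  shows "wnormal_conn N M c D p x \<eta> = chart_weighted M \<psi> (- 1) p (wcov D \<psi> p x (wcoord \<psi> \<eta>))"
proof -
  note \<psi>' = charts_atD[OF \<psi>] and V = wnormal_section_openin[OF \<eta>]
  note pN = openin_points[OF V p]
  let ?\<Gamma> = "christoffel M D \<psi> p (dincl N M p x)" and ?h = "wcoord \<psi> \<eta>"
  let ?\<tau> = "trace ?\<Gamma> / real CARD('m)"
  let ?r = "chart_weighted M \<psi> (- 1) p (wcov D \<psi> p x ?h)"
  let ?E = "\<lambda>\<xi> l. tensor (normal_conn N M c D p x \<xi>) (l p) + tensor (\<xi> p) (dens_conn N M (- 1) (pull_conn N M D) p x l)"
  have key: "?r = ?E \<xi> l" if pW: "p \<in> W" and \<xi>: "normal_section N M c W \<xi>" and l: "dens_section N M (- 1) W l"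
    and dec: "\<forall>q\<in>W. \<eta> q = tensor (\<xi> q) (l q)" for W \<xi> l
  proof -
    have t: "tfield N M W \<xi>" and n: "\<xi> p \<in> normal_space N M c p" using \<xi> pW by (auto simp: normal_section_def)
    let ?lam = "\<lambda>q. l q (chart_frame M \<psi> q)" and ?U = "W \<inter> fst \<psi>"
    have U: "openin (mtop N) ?U" by (rule openin_Int_chart_M[OF tfield_openin[OF t] \<psi>'(1)])
    have pU: "p \<in> ?U" using pW \<psi>' by simp
    have sml: "smooth_fun N ?U ?lam" by (rule dens_section_smooth[OF l frame_field_chart[OF U \<psi>'(1)]]) auto
    have smx: "smooth_fun N ?U (\<lambda>q. \<xi> q \<psi>)" by (rule tfield_smooth[OF t \<psi>'(1)])
    have h: "?h q = ?lam q *\<^sub>R \<xi> q \<psi>" if "q \<in> ?U" for q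
      using dec that by (simp add: wcoord_def tensor_def scaleR_fun_def)
    have dh: "dd N p x ?h = dd N p x ?lam *\<^sub>R \<xi> p \<psi> + ?lam p *\<^sub>R dd N p x (\<lambda>q. \<xi> q \<psi>)"
      unfolding dd_scaleR[OF N U pU x sml smx, symmetric] by (rule dd_cong[OF N U pU h])
    have dl: "dens_conn N M (- 1) (pull_conn N M D) p x l = chart_weighted M \<psi> (- 1) p (dd N p x ?lam - ?\<tau> * ?lam p)"
      using dens_conn_eq[OF conn_form_pull_conn[OF weyl_connection[OF D] \<psi> pN x] l pW \<psi> x] by simp
    have lp: "l p = chart_weighted M \<psi> (- 1) p (?lam p)"
      by (rule chart_weighted_eq[OF M \<psi> dens_section_mem[OF l pW]])
    let ?w = "pull_conn N M D p x \<xi>"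
    note w = pull_conn_chart[OF D \<psi> t pW x]
    have "wcov D \<psi> p x ?h = nor_part N M c p (?lam p *\<^sub>R ?w + (dd N p x ?lam - ?\<tau> * ?lam p) *\<^sub>R \<xi> p)"
    proof -
      have "chart_vec M \<psi> (dd N p x ?h + weyl_mat D \<psi> p x *v ?h p) p
          = ?lam p *\<^sub>R ?w + (dd N p x ?lam - ?\<tau> * ?lam p) *\<^sub>R \<xi> p" (is "?L = ?R")
      proof (rule tspace_eqI[OF chart_vec_tspace[OF M \<psi>] _ \<psi>])
        show "?R \<in> tspace M p" by (intro tspace_add[OF M] tspace_scaleR[OF M] w(1) normal_tspace[OF n])
        show "?L \<psi> = ?R \<psi>"
          unfolding chart_vec_same[OF M \<psi>] dh h[OF pU] weyl_mat_def plus_fun_apply scaleR_fun_def w(2)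
          by (simp add: matrix_vector_mult_diff_rdistrib matrix_vector_mult_scaleR scaleR_matrix_vector_assoc[symmetric]
              algebra_simps scaleR_left_diff_distrib)
      qed
      then show ?thesis unfolding wcov_def by (rule arg_cong)
    qed
    also have "\<dots> = ?lam p *\<^sub>R normal_conn N M c D p x \<xi> + (dd N p x ?lam - ?\<tau> * ?lam p) *\<^sub>R \<xi> p"
      unfolding nor_part_lincomb[OF pN w(1) normal_tspace[OF n]] nor_part_normal[OF pN n] normal_conn_def ..
    finally have wc: "wcov D \<psi> p x ?h = \<dots>" .
    have "?E \<xi> l = chart_weighted M \<psi> (- 1) p (?lam p *\<^sub>R normal_conn N M c D p x \<xi>)
       + chart_weighted M \<psi> (- 1) p ((dd N p x ?lam - ?\<tau> * ?lam p) *\<^sub>R \<xi> p)"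
      by (subst lp, subst dl) (simp only: tensor_chart_weighted)
    also have "\<dots> = ?r"
    proof
      fix f
      show "(chart_weighted M \<psi> (- 1) p (?lam p *\<^sub>R normal_conn N M c D p x \<xi>)
       + chart_weighted M \<psi> (- 1) p ((dd N p x ?lam - ?\<tau> * ?lam p) *\<^sub>R \<xi> p)) f = ?r f"
        unfolding wc plus_fun_apply[of _ _ f] chart_weighted_def
        by (cases "frame_at M p f") (simp_all only: if_True if_False scaleR_add_right add_0_right)
    qed
    finally show ?thesis by (rule sym)
  qed
  \<comment> \<open>The value of \<eta> on the coordinate frame, tensored with the unit density, is
    one admissible decomposition; it gives uniqueness in the description.\<close>
  let ?U = "V \<inter> fst \<psi>" and ?\<xi> = "\<lambda>q. \<eta> q (chart_frame M \<psi> q)" and ?l = "\<lambda>q. chart_weighted M \<psi> (- 1) q (1::real)"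
  have U: "openin (mtop N) ?U" by (rule openin_Int_chart_M[OF V \<psi>'(1)])
  have pU: "p \<in> ?U" using p \<psi>' by simp
  have dec: "\<eta> q = tensor (?\<xi> q) (?l q)" if "q \<in> ?U" for q
    unfolding tensor_chart_weighted scaleR_one
    using that by (intro chart_weighted_eq[OF M charts_atI[OF \<psi>'(1)] wnormal_section_mem[OF \<eta>]]) auto
  note \<xi> = normal_section_chart_frame[OF \<eta> \<psi>'(1)] and l = dens_section_unit[OF U \<psi>'(1) Int_lower2, of "- 1"]
  show ?thesis
    unfolding wnormal_conn_def
  proof (rule the_equality)
    show "\<forall>V \<xi> l. p \<in> V \<and> normal_section N M c V \<xi> \<and> dens_section N M (- 1) V l \<and> (\<forall>q\<in>V. \<eta> q = tensor (\<xi> q) (l q)) \<longrightarrow> ?r = ?E \<xi> l"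
      by (intro allI impI, elim conjE) (rule key)
    show "r = ?r" if "\<forall>V \<xi> l. p \<in> V \<and> normal_section N M c V \<xi> \<and> dens_section N M (- 1) V l \<and> (\<forall>q\<in>V. \<eta> q = tensor (\<xi> q) (l q)) \<longrightarrow> r = ?E \<xi> l" for r
    proof -
      have "r = ?E ?\<xi> ?l" using that pU \<xi> l dec by blast
      also have "\<dots> = ?r" by (rule key[OF pU \<xi> l, symmetric]) (use dec in blast)
      finally show ?thesis .
    qed
  qed
qed

text \<open>Changing the Weyl structure adds \<delta> through the normal part of the Christoffel
  difference and subtracts \<delta> through the trace removed in \<open>weyl_mat\<close>.\<close>

lemma wcov_independent:
  assumes D: "weyl_structure M c D" and D': "weyl_structure M c D'" and \<psi>: "\<psi> \<in> charts_at M p"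
    and p: "p \<in> points N" and x: "x \<in> tspace N p" and \<xi>: "\<xi> \<in> normal_space N M c p" and h: "h p = \<xi> \<psi>"
  shows "wcov D \<psi> p x h = wcov D' \<psi> p x h"
proof -
  let ?w = "\<lambda>D. chart_vec M \<psi> (dd N p x h + weyl_mat D \<psi> p x *v h p) p"
  have "nor_part N M c p (?w D') = 1 *\<^sub>R nor_part N M c p (?w D) + (trace_diff D D' \<psi> p x + - trace_diff D D' \<psi> p x) *\<^sub>R \<xi>"
    by (rule nor_part_christoffel_difference[OF D D' \<psi> p x \<xi> chart_vec_tspace[OF M \<psi>] chart_vec_tspace[OF M \<psi>]])
       (simp add: chart_vec_same[OF M \<psi>] h weyl_mat_def trace_diff_def matrix_vector_mult_diff_rdistrib trace_sub
          scaleR_matrix_vector_assoc[symmetric] scaleR_left_diff_distrib diff_divide_distrib)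
  then show ?thesis unfolding wcov_def by (simp only: add.right_inverse scaleR_zero_left add_0_right scaleR_one)
qed

lemma wnormal_conn_independent:
  assumes D: "weyl_structure M c D" and D': "weyl_structure M c D'" and \<eta>: "wnormal_section N M c V \<eta>"
    and p: "p \<in> V" and x: "x \<in> tspace N p"
  shows "wnormal_conn N M c D p x \<eta> = wnormal_conn N M c D' p x \<eta>"
proof -
  note pN = openin_points[OF wnormal_section_openin[OF \<eta>] p]
  obtain \<psi> where \<psi>: "\<psi> \<in> charts_at M p" using ex_chart_M[OF pN] by blast
  show ?thesis
    unfolding wnormal_conn_eq[OF D \<psi> \<eta> p x] wnormal_conn_eq[OF D' \<psi> \<eta> p x]
    by (subst wcov_independent[OF D D' \<psi> pN x wnormal_chart_frame[OF \<eta> p \<psi>]]) (simp_all add: wcoord_def)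
qed

end

section \<open>Curvature\<close>

context conf_submfd
begin

section \<open>The matrix of the weightless connection and its smoothness\<close>

definition nor_mat :: "('a, 'm) chart \<Rightarrow> 'a \<Rightarrow> real ^ 'm ^ 'm" where
  "nor_mat \<psi> q = (\<chi> i j. nor_part N M c q (chart_vec M \<psi> (axis j 1) q) \<psi> $ i)"

lemma nor_part_nor_mat:
  assumes \<psi>: "\<psi> \<in> charts_at M q" and q: "q \<in> points N" and w: "w \<in> tspace M q"
  shows "nor_part N M c q w \<psi> = nor_mat \<psi> q *v w \<psi>"
proof -
  note T = chart_vec_tspace[OF M \<psi>]
  have lin: "linear (\<lambda>a. nor_part N M c q (chart_vec M \<psi> a q) \<psi>)"
  proof (rule linearI)
    fix a b r
    show "nor_part N M c q (chart_vec M \<psi> (a + b) q) \<psi> = nor_part N M c q (chart_vec M \<psi> a q) \<psi> + nor_part N M c q (chart_vec M \<psi> b q) \<psi>"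
      using fun_cong[OF nor_part_lincomb[OF q T T, of 1 a 1 b], of \<psi>]
      unfolding chart_vec_add[OF M \<psi>] scaleR_one plus_fun_apply .
    show "nor_part N M c q (chart_vec M \<psi> (r *\<^sub>R a) q) \<psi> = r *\<^sub>R nor_part N M c q (chart_vec M \<psi> a q) \<psi>"
      using fun_cong[OF nor_part_lincomb[OF q T T, of r a 0 a], of \<psi>]
      unfolding chart_vec_scaleR[OF M \<psi>] scaleR_zero_left add_0_right by (simp only: scaleR_fun_def)
  qed
  have "nor_part N M c q w \<psi> = nor_part N M c q (chart_vec M \<psi> (w \<psi>) q) \<psi>" by (simp add: chart_vec_eq[OF M \<psi> w])
  also have "\<dots> = (\<Sum>j\<in>UNIV. w \<psi> $ j *\<^sub>R nor_part N M c q (chart_vec M \<psi> (axis j 1) q) \<psi>)"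
    by (rule linear_eq_axis_sum[OF lin])
  also have "\<dots> = nor_mat \<psi> q *v w \<psi>"
    by (simp add: nor_mat_def matrix_vector_mult_def vec_eq_iff mult.commute)
  finally show ?thesis .
qed

lemma openin_points_chart: "\<psi> \<in> atlas M \<Longrightarrow> openin (mtop N) (points N \<inter> fst \<psi>)"
  by (rule openin_Int_chart_M) (simp_all add: points_def)

lemma smooth_nor_mat:
  assumes \<psi>: "\<psi> \<in> atlas M"
  shows "smooth_fun N (points N \<inter> fst \<psi>) (nor_mat \<psi>)"
proof -
  let ?U = "points N \<inter> fst \<psi>"
  have U: "openin (mtop N) ?U" by (rule openin_points_chart[OF \<psi>])
  have "tfield N M ?U (\<lambda>q. nor_part N M c q (chart_vec M \<psi> a q))" for a
    using normal_section_nor_part[OF tfield_chart_vec[OF U \<psi> Int_lower2 smooth_fun_const[of N ?U a]]]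
    by (simp add: normal_section_def)
  then have "smooth_fun N ?U (\<lambda>q. nor_part N M c q (chart_vec M \<psi> a q) \<psi>)" for a
    by (rule smooth_fun_subset[OF tfield_smooth[OF _ \<psi>]]) auto
  then show ?thesis
    unfolding nor_mat_def[abs_def] by (intro smooth_fun_vec_lambda[OF N U] smooth_fun_vec_nth[OF N U])
qed

text \<open>On sections \<open>h\<close> fixed by the normal projection \<open>P\<close>, the derivative
  \<open>P (x(h) + B h)\<close> equals \<open>x(h) + (P B - x(P)) h\<close>.\<close>

definition conn_mat :: "('a, 'm, 'm) cderiv \<Rightarrow> ('a, 'm) chart \<Rightarrow> 'a \<Rightarrow> ('a, 'n) tvec \<Rightarrow> real ^ 'm ^ 'm" where
  "conn_mat D \<psi> p x = nor_mat \<psi> p ** weyl_mat D \<psi> p x - dd N p x (nor_mat \<psi>)"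

lemma smooth_wcoord:
  assumes \<eta>: "wnormal_section N M c V \<eta>" and \<psi>: "\<psi> \<in> atlas M"
  shows "smooth_fun N (V \<inter> fst \<psi>) (wcoord \<psi> \<eta>)"
proof -
  have "tfield N M (V \<inter> fst \<psi>) (\<lambda>q. \<eta> q (chart_frame M \<psi> q))"
    using normal_section_chart_frame[OF \<eta> \<psi>] by (simp add: normal_section_def)
  then show ?thesis
    unfolding wcoord_def[abs_def] by (rule smooth_fun_subset[OF tfield_smooth[OF _ \<psi>]]) auto
qed

text \<open>Differentiating \<open>h = P h\<close> gives \<open>P dh = dh - dP h\<close>, so the
  projection in front of the derivative can be traded for a term of order zero.\<close>

lemma wcov_chart:
  assumes \<eta>: "wnormal_section N M c V \<eta>" and p: "p \<in> V" and \<psi>: "\<psi> \<in> charts_at M p" and x: "x \<in> tspace N p"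
  shows "wcov D \<psi> p x (wcoord \<psi> \<eta>) \<psi> = dd N p x (wcoord \<psi> \<eta>) + conn_mat D \<psi> p x *v wcoord \<psi> \<eta> p"
proof -
  note \<psi>' = charts_atD[OF \<psi>] and V = wnormal_section_openin[OF \<eta>]
  let ?U = "V \<inter> fst \<psi>" and ?h = "wcoord \<psi> \<eta>"
  have U: "openin (mtop N) ?U" by (rule openin_Int_chart_M[OF V \<psi>'(1)])
  have pU: "p \<in> ?U" using p \<psi>' by simp
  note pN = openin_points[OF V p] and h = smooth_wcoord[OF \<eta> \<psi>'(1)]
  have P: "smooth_fun N ?U (nor_mat \<psi>)"
    by (rule smooth_fun_subset[OF smooth_nor_mat[OF \<psi>'(1)]]) (use openin_points[OF V] in auto)
  have "?h q = nor_mat \<psi> q *v ?h q" if q: "q \<in> ?U" for q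
  proof -
    have \<psi>q: "\<psi> \<in> charts_at M q" using q \<psi>' by (intro charts_atI) auto
    have n: "\<eta> q (chart_frame M \<psi> q) \<in> normal_space N M c q" using q by (intro wnormal_chart_frame[OF \<eta> _ \<psi>q]) simp
    show ?thesis
      using nor_part_nor_mat[OF \<psi>q openin_points[OF U q] normal_tspace[OF n]] nor_part_normal[OF openin_points[OF U q] n]
      by (simp add: wcoord_def)
  qed
  then have "dd N p x ?h = dd N p x (\<lambda>q. nor_mat \<psi> q *v ?h q)" by (rule dd_cong[OF N U pU])
  also have "\<dots> = dd N p x (nor_mat \<psi>) *v ?h p + nor_mat \<psi> p *v dd N p x ?h"
    by (rule dd_matrix_vector_mult[OF N U pU x P h])
  finally have dh: "nor_mat \<psi> p *v dd N p x ?h = dd N p x ?h - dd N p x (nor_mat \<psi>) *v ?h p"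
    by (simp add: algebra_simps)
  show ?thesis
    unfolding wcov_def nor_part_nor_mat[OF \<psi> pN chart_vec_tspace[OF M \<psi>]] chart_vec_same[OF M \<psi>]
    by (simp add: matrix_vector_right_distrib dh conn_mat_def matrix_vector_mult_diff_rdistrib matrix_vector_mul_assoc)
qed

lemma weyl_mat_lincomb:
  assumes D: "weyl_structure M c D" and \<psi>: "\<psi> \<in> charts_at M p" and p: "p \<in> points N"
    and x: "x \<in> tspace N p" "y \<in> tspace N p"
  shows "weyl_mat D \<psi> p (a *\<^sub>R x + b *\<^sub>R y) = a *\<^sub>R weyl_mat D \<psi> p x + b *\<^sub>R weyl_mat D \<psi> p y"
proof -
  have tr: "trace (a *\<^sub>R A + b *\<^sub>R B) = a * trace A + b * trace B" for A B :: "real^'m^'m"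
    by (simp add: trace_def sum.distrib sum_distrib_left)
  show ?thesis
    unfolding weyl_mat_def dincl_lincomb[OF p x] tr
      christoffel_lincomb[OF M weyl_connection[OF D] \<psi> dincl_tspace[OF p x(1)] dincl_tspace[OF p x(2)]]
    by (simp add: scaleR_diff_right add_divide_distrib scaleR_left_distrib)
qed

lemma conn_mat_lincomb:
  assumes D: "weyl_structure M c D" and \<psi>: "\<psi> \<in> charts_at M p" and p: "p \<in> points N"
    and x: "x \<in> tspace N p" "y \<in> tspace N p"
  shows "conn_mat D \<psi> p (a *\<^sub>R x + b *\<^sub>R y) = a *\<^sub>R conn_mat D \<psi> p x + b *\<^sub>R conn_mat D \<psi> p y"
proof -
  note \<psi>' = charts_atD[OF \<psi>]
  have "p \<in> points N \<inter> fst \<psi>" using p \<psi>' by simp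
  note dl = dd_lincomb[OF N openin_points_chart[OF \<psi>'(1)] this smooth_nor_mat[OF \<psi>'(1)] x]
  have lin: "A ** (a *\<^sub>R B + b *\<^sub>R C) = a *\<^sub>R (A ** B) + b *\<^sub>R (A ** C)" for A B C :: "real^'m^'m"
    by (simp add: matrix_matrix_mult_def vec_eq_iff sum.distrib sum_distrib_left algebra_simps)
  show ?thesis
    unfolding conn_mat_def weyl_mat_lincomb[OF D \<psi> p x] dl lin by (simp add: scaleR_diff_right)
qed

text \<open>Writes the connection form through its coefficient matrices in the chart of
  \<open>N\<close>; these depend on the point alone and can be differentiated.\<close>

lemma conn_mat_axis_sum:
  assumes D: "weyl_structure M c D" and \<psi>: "\<psi> \<in> charts_at M p" and \<phi>: "\<phi> \<in> charts_at N p" and x: "x \<in> tspace N p"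
  shows "conn_mat D \<psi> p x = (\<Sum>j\<in>UNIV. x \<phi> $ j *\<^sub>R conn_mat D \<psi> p (chart_vec N \<phi> (axis j 1) p))"
proof -
  note T = chart_vec_tspace[OF N \<phi>] and p = q_N[OF \<phi> \<psi>]
  have lin: "linear (\<lambda>a. conn_mat D \<psi> p (chart_vec N \<phi> a p))"
  proof (rule linearI)
    fix a b r
    show "conn_mat D \<psi> p (chart_vec N \<phi> (a + b) p) = conn_mat D \<psi> p (chart_vec N \<phi> a p) + conn_mat D \<psi> p (chart_vec N \<phi> b p)"
      using conn_mat_lincomb[OF D \<psi> p T T, of 1 a 1 b] unfolding chart_vec_add[OF N \<phi>] scaleR_one .
    show "conn_mat D \<psi> p (chart_vec N \<phi> (r *\<^sub>R a) p) = r *\<^sub>R conn_mat D \<psi> p (chart_vec N \<phi> a p)"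
      using conn_mat_lincomb[OF D \<psi> p T T, of r a 0 a]
      unfolding chart_vec_scaleR[OF N \<phi>] scaleR_zero_left add_0_right .
  qed
  show ?thesis
    using linear_eq_axis_sum[OF lin, of "x \<phi>"] unfolding chart_vec_eq[OF N \<phi> x] .
qed

text \<open>The included field is defined only along \<open>N\<close>, whereas
  \<open>smooth_christoffel\<close> concerns fields on open sets of \<open>M\<close>. The
  Christoffel matrix is therefore expanded in coordinate fields of \<open>M\<close>, restricted to
  \<open>N\<close>, with the components of the included field as coefficients.\<close>

lemma smooth_weyl_mat:
  assumes D: "weyl_structure M c D" and \<psi>: "\<psi> \<in> atlas M" and X: "tfield N N V X" and V: "V \<subseteq> fst \<psi>"
  shows "smooth_fun N V (\<lambda>q. weyl_mat D \<psi> q (X q))"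
proof -
  note Vo = tfield_openin[OF X] and cD = weyl_connection[OF D]
  let ?G = "\<lambda>a q. christoffel M D \<psi> q (chart_vec M \<psi> a q)"
  have \<psi>q: "\<psi> \<in> charts_at M q" if "q \<in> V" for q using that V \<psi> by (intro charts_atI) auto
  have G: "smooth_fun N V (?G a)" for a
  proof (rule smooth_fun_restrict[OF Vo openin_chart[OF M \<psi>] _ V])
    show "smooth_fun M (fst \<psi>) (?G a)"
      using smooth_christoffel[OF M cD \<psi> tfield_const[OF \<psi>, of a]] by simp
  qed
  have lin: "linear (\<lambda>a. ?G a q)" if q: "q \<in> V" for q
  proof (rule linearI)
    note T = chart_vec_tspace[OF M \<psi>q[OF q]]
    fix a b r
    show "?G (a + b) q = ?G a q + ?G b q"
      using christoffel_lincomb[OF M cD \<psi>q[OF q] T T, of 1 a 1 b] unfolding chart_vec_add[OF M \<psi>q[OF q]] scaleR_one .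
    show "?G (r *\<^sub>R a) q = r *\<^sub>R ?G a q"
      using christoffel_lincomb[OF M cD \<psi>q[OF q] T T, of r a 0 a]
      unfolding chart_vec_scaleR[OF M \<psi>q[OF q]] scaleR_zero_left add_0_right .
  qed
  have sX: "smooth_fun N V (\<lambda>q. dincl N M q (X q) \<psi>)"
    by (rule smooth_fun_subset[OF tfield_smooth[OF tfield_dincl[OF X] \<psi>]]) (use V in auto)
  have "smooth_fun N V (\<lambda>q. \<Sum>j\<in>UNIV. dincl N M q (X q) \<psi> $ j *\<^sub>R ?G (axis j 1) q)"
    by (intro smooth_fun_sum[OF N Vo] smooth_fun_scaleR[OF N Vo] smooth_fun_vec_nth[OF N Vo] sX G)
  moreover have "(\<Sum>j\<in>UNIV. dincl N M q (X q) \<psi> $ j *\<^sub>R ?G (axis j 1) q) = christoffel M D \<psi> q (dincl N M q (X q))"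
    if q: "q \<in> V" for q
    using linear_eq_axis_sum[OF lin[OF q], of "dincl N M q (X q) \<psi>"]
      chart_vec_eq[OF M \<psi>q[OF q] dincl_tspace[OF openin_points[OF Vo q] tfield_tspace[OF X q]]] by simp
  ultimately have C: "smooth_fun N V (\<lambda>q. christoffel M D \<psi> q (dincl N M q (X q)))"
    using smooth_fun_cong[OF N Vo, of "\<lambda>q. \<Sum>j\<in>UNIV. dincl N M q (X q) \<psi> $ j *\<^sub>R ?G (axis j 1) q"
        "\<lambda>q. christoffel M D \<psi> q (dincl N M q (X q))"] by blast
  have tr: "smooth_fun N V (\<lambda>q. (1 / real CARD('m)) * trace (christoffel M D \<psi> q (dincl N M q (X q))))"
    unfolding trace_def
    by (intro smooth_fun_mult[OF N Vo] smooth_fun_const smooth_fun_sum[OF N Vo] smooth_fun_vec_nth[OF N Vo] C)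
  have "smooth_fun N V (\<lambda>q. christoffel M D \<psi> q (dincl N M q (X q))
     - ((1 / real CARD('m)) * trace (christoffel M D \<psi> q (dincl N M q (X q)))) *\<^sub>R mat 1)"
    by (intro smooth_fun_diff[OF N Vo] C smooth_fun_scaleR[OF N Vo] tr smooth_fun_const)
  then show ?thesis by (simp add: weyl_mat_def)
qed

lemma smooth_conn_mat:
  assumes D: "weyl_structure M c D" and \<psi>: "\<psi> \<in> atlas M" and X: "tfield N N V X" and V: "V \<subseteq> fst \<psi>"
  shows "smooth_fun N V (\<lambda>q. conn_mat D \<psi> q (X q))"
proof -
  note Vo = tfield_openin[OF X]
  have P: "smooth_fun N V (nor_mat \<psi>)"
    by (rule smooth_fun_subset[OF smooth_nor_mat[OF \<psi>]]) (use V openin_points[OF Vo] in auto)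
  show ?thesis
    unfolding conn_mat_def
    by (intro smooth_fun_diff[OF N Vo] smooth_fun_matrix_mult[OF N Vo] P smooth_weyl_mat[OF D \<psi> X V] smooth_fun_dd[OF N X])
qed

text \<open>Smoothness in the coordinate frame suffices: the value on another frame differs by a
  power of the absolute determinant of its matrix, with exponent \<open>1 / m\<close> because the
  weight is -1.\<close>

lemma wnormal_sectionI:
  assumes V: "openin (mtop N) V" and mem: "\<And>q. q \<in> V \<Longrightarrow> \<eta> q \<in> weighted M (- 1) q (normal_space N M c q)"
    and sm: "\<And>p. p \<in> V \<Longrightarrow> \<exists>\<psi> W. \<psi> \<in> charts_at M p \<and> openin (mtop N) W \<and> p \<in> W \<and> W \<subseteq> fst \<psi> \<and> smooth_fun N W (wcoord \<psi> \<eta>)"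
  shows "wnormal_section N M c V \<eta>"
  unfolding wnormal_section_def wnormal_space_def
proof (intro conjI ballI allI impI V mem)
  fix U e assume *: "U \<subseteq> V \<and> frame_field N M U e"
  then have e: "frame_field N M U e" and UV: "U \<subseteq> V" by blast+
  note Uo = frame_field_openin[OF e]
  show "tfield N M U (\<lambda>q. \<eta> q (e q))"
  proof (rule tfield_local[OF Uo])
    fix p assume p: "p \<in> U"
    obtain \<psi> W where \<psi>: "\<psi> \<in> charts_at M p" and W: "openin (mtop N) W" "p \<in> W" "W \<subseteq> fst \<psi>" "smooth_fun N W (wcoord \<psi> \<eta>)"
      using sm[of p] p UV by blast
    note \<psi>' = charts_atD[OF \<psi>]
    let ?W = "U \<inter> W"
    have Wo: "openin (mtop N) ?W" by (intro openin_Int Uo W)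
    have \<psi>q: "\<psi> \<in> charts_at M q" if "q \<in> ?W" for q using that W \<psi>' by (intro charts_atI) auto
    have F: "smooth_fun N ?W (\<lambda>q. frame_mat \<psi> (e q))"
      by (rule smooth_fun_subset[OF smooth_frame_mat[OF e \<psi>'(1)]]) (use W in auto)
    have fa: "frame_at M q (e q)" if "q \<in> ?W" for q using that by (intro frame_field_frame_at[OF e]) simp
    have "smooth_fun N ?W (\<lambda>q. \<bar>det (frame_mat \<psi> (e q))\<bar> powr (1 / real CARD('m)) *\<^sub>R wcoord \<psi> \<eta> q)"
    proof (rule smooth_fun_scaleR[OF N Wo smooth_fun_abs_powr[OF N Wo smooth_fun_det[OF N Wo F]]])
      show "det (frame_mat \<psi> (e q)) \<noteq> 0" if "q \<in> ?W" for q
        using fa[OF that] by (simp add: frame_at_iff[OF M \<psi>q[OF that]] invertible_det_nz)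
      show "smooth_fun N ?W (wcoord \<psi> \<eta>)" by (rule smooth_fun_subset[OF W(4)]) auto
    qed
    moreover have "\<bar>det (frame_mat \<psi> (e q))\<bar> powr (1 / real CARD('m)) *\<^sub>R wcoord \<psi> \<eta> q = \<eta> q (e q) \<psi>" if q: "q \<in> ?W" for q
      using weighted_eq_chart_frame[OF M \<psi>q[OF q] mem fa[OF q]] q UV
      by (auto simp: wcoord_def scaleR_fun_def)
    ultimately have s: "smooth_fun N ?W (\<lambda>q. \<eta> q (e q) \<psi>)"
      using smooth_fun_cong[OF N Wo, of "\<lambda>q. \<bar>det (frame_mat \<psi> (e q))\<bar> powr (1 / real CARD('m)) *\<^sub>R wcoord \<psi> \<eta> q" "\<lambda>q. \<eta> q (e q) \<psi>"]
      by blast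
    have "tfield N M ?W (\<lambda>q. \<eta> q (e q))"
    proof (rule tfield_chartI[where s = "\<lambda>q. \<eta> q (e q)", OF Wo \<psi>'(1) _ _ s])
      show "?W \<subseteq> fst \<psi>" using W by auto
      show "\<eta> q (e q) \<in> tspace M q" if "q \<in> ?W" for q
        by (rule normal_tspace[OF weighted_frame_mem[OF mem fa[OF that]]]) (use that UV in auto)
    qed
    then show "\<exists>W. p \<in> W \<and> W \<subseteq> U \<and> tfield N M W (\<lambda>q. \<eta> q (e q))" using p W by blast
  qed
qed

lemma wcov_normal:
  assumes "\<psi> \<in> charts_at M p" "p \<in> points N"
  shows "wcov D \<psi> p x h \<in> normal_space N M c p"
  unfolding wcov_def by (rule splitting(2)[OF assms(2) chart_vec_tspace[OF M assms(1)]])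

context
  fixes D V \<eta>
  assumes D: "weyl_structure M c D" and \<eta>: "wnormal_section N M c V \<eta>"
begin

lemma wcoord_wnormal_conn:
  assumes "q \<in> V" "\<psi> \<in> charts_at M q" "X q \<in> tspace N q"
  shows "wcoord \<psi> (\<lambda>q. wnormal_conn N M c D q (X q) \<eta>) q = wcov D \<psi> q (X q) (wcoord \<psi> \<eta>) \<psi>"
  unfolding wcoord_def[of \<psi> "\<lambda>q. wnormal_conn N M c D q (X q) \<eta>"] wnormal_conn_eq[OF D assms(2) \<eta> assms(1,3)]
    chart_weighted_chart_frame[OF M assms(2)] ..

lemma wcoord_wnormal_conn_chart:
  assumes "q \<in> V" "\<psi> \<in> charts_at M q" "X q \<in> tspace N q"
  shows "wcoord \<psi> (\<lambda>q. wnormal_conn N M c D q (X q) \<eta>) q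
    = dd N q (X q) (wcoord \<psi> \<eta>) + conn_mat D \<psi> q (X q) *v wcoord \<psi> \<eta> q"
  unfolding wcoord_wnormal_conn[where X = X, OF assms] wcov_chart[OF \<eta> assms] ..

text \<open>Allows derivatives to be iterated, as \<open>curvature\<close> requires; smoothness is
  visible from the form \<open>d + A\<close> in the chart.\<close>

lemma wnormal_section_conn:
  assumes X: "tfield N N V X"
  shows "wnormal_section N M c V (\<lambda>q. wnormal_conn N M c D q (X q) \<eta>)"
proof (rule wnormal_sectionI)
  show V: "openin (mtop N) V" by (rule tfield_openin[OF X])
  show "wnormal_conn N M c D q (X q) \<eta> \<in> weighted M (- 1) q (normal_space N M c q)" if q: "q \<in> V" for q
  proof -
    note qN = openin_points[OF V q]
    obtain \<psi> where \<psi>: "\<psi> \<in> charts_at M q" using ex_chart_M[OF qN] by blast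
    show ?thesis
      unfolding wnormal_conn_eq[OF D \<psi> \<eta> q tfield_tspace[OF X q]]
      by (rule chart_weighted_mem[OF M \<psi> normal_scaleR[OF qN wcov_normal[OF \<psi> qN]]])
  qed
  fix p assume p: "p \<in> V"
  note pN = openin_points[OF V p]
  obtain \<psi> where \<psi>: "\<psi> \<in> charts_at M p" using ex_chart_M[OF pN] by blast
  note \<psi>' = charts_atD[OF \<psi>]
  let ?W = "V \<inter> fst \<psi>"
  have W: "openin (mtop N) ?W" by (rule openin_Int_chart_M[OF V \<psi>'(1)])
  note XW = tfield_subset[OF X W Int_lower1]
  have "smooth_fun N ?W (\<lambda>q. dd N q (X q) (wcoord \<psi> \<eta>) + conn_mat D \<psi> q (X q) *v wcoord \<psi> \<eta> q)"
    by (intro smooth_fun_add[OF N W] smooth_fun_dd[OF N XW] smooth_fun_matrix_vector_mult[OF N W]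
        smooth_wcoord[OF \<eta> \<psi>'(1)] smooth_conn_mat[OF D \<psi>'(1) XW Int_lower2])
  moreover have "wcoord \<psi> (\<lambda>q. wnormal_conn N M c D q (X q) \<eta>) q
      = dd N q (X q) (wcoord \<psi> \<eta>) + conn_mat D \<psi> q (X q) *v wcoord \<psi> \<eta> q" if "q \<in> ?W" for q
    using that by (intro wcoord_wnormal_conn_chart charts_atI[OF \<psi>'(1)] tfield_tspace[OF X]) auto
  ultimately have "smooth_fun N ?W (wcoord \<psi> (\<lambda>q. wnormal_conn N M c D q (X q) \<eta>))"
    using smooth_fun_cong[OF N W, of "wcoord \<psi> (\<lambda>q. wnormal_conn N M c D q (X q) \<eta>)"
        "\<lambda>q. dd N q (X q) (wcoord \<psi> \<eta>) + conn_mat D \<psi> q (X q) *v wcoord \<psi> \<eta> q"] by blast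
  then show "\<exists>\<psi> W. \<psi> \<in> charts_at M p \<and> openin (mtop N) W \<and> p \<in> W \<and> W \<subseteq> fst \<psi>
      \<and> smooth_fun N W (wcoord \<psi> (\<lambda>q. wnormal_conn N M c D q (X q) \<eta>))"
    using \<psi> W p \<psi>'(2) by blast
qed

end

section \<open>The curvature form in charts\<close>

lemma chart_weighted_diff:
  "chart_weighted M \<psi> k q a - chart_weighted M \<psi> k q b = chart_weighted M \<psi> k q (a - b)"
  by (rule ext) (simp only: chart_weighted_def minus_apply scaleR_diff_right diff_self if_split, simp)

text \<open>The value of \<open>dA + A \<and> A\<close> on \<open>x\<close> and \<open>y\<close>,
  with \<open>dA\<close> expressed by the coefficient matrices of \<open>A\<close> in the chart
  \<phi>. No fields extending \<open>x\<close> and \<open>y\<close> occur, so the expression is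
  tensorial by its form.\<close>

definition curv_mat ::
    "('a, 'm, 'm) cderiv \<Rightarrow> ('a, 'n) chart \<Rightarrow> ('a, 'm) chart \<Rightarrow> 'a \<Rightarrow> ('a, 'n) tvec \<Rightarrow> ('a, 'n) tvec \<Rightarrow> real ^ 'm ^ 'm" where
  "curv_mat D \<phi> \<psi> p x y =
     (\<Sum>j\<in>UNIV. y \<phi> $ j *\<^sub>R dd N p x (\<lambda>q. conn_mat D \<psi> q (chart_vec N \<phi> (axis j 1) q))
             - x \<phi> $ j *\<^sub>R dd N p y (\<lambda>q. conn_mat D \<psi> q (chart_vec N \<phi> (axis j 1) q)))
     + (conn_mat D \<psi> p x ** conn_mat D \<psi> p y - conn_mat D \<psi> p y ** conn_mat D \<psi> p x)"

lemma dd_conn_mat: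
  assumes D: "weyl_structure M c D" and \<psi>: "\<psi> \<in> charts_at M p" and \<phi>: "\<phi> \<in> charts_at N p" and p: "p \<in> V"
    and Y: "tfield N N V Y" and x: "x \<in> tspace N p"
  shows "dd N p x (\<lambda>q. conn_mat D \<psi> q (Y q))
    = (\<Sum>j\<in>UNIV. dd N p x (\<lambda>q. Y q \<phi>) $ j *\<^sub>R conn_mat D \<psi> p (chart_vec N \<phi> (axis j 1) p)
        + Y p \<phi> $ j *\<^sub>R dd N p x (\<lambda>q. conn_mat D \<psi> q (chart_vec N \<phi> (axis j 1) q)))"
proof -
  note \<psi>' = charts_atD[OF \<psi>] and \<phi>' = charts_atD[OF \<phi>] and V = tfield_openin[OF Y]
  let ?W = "V \<inter> fst \<psi> \<inter> fst \<phi>" and ?A = "\<lambda>j q. conn_mat D \<psi> q (chart_vec N \<phi> (axis j 1) q)"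
  have W: "openin (mtop N) ?W" by (intro openin_Int_chart[OF N \<phi>'(1)] openin_Int_chart_M[OF V \<psi>'(1)])
  have pW: "p \<in> ?W" using p \<psi>' \<phi>' by simp
  have e: "tfield N N ?W (\<lambda>q. chart_vec N \<phi> (axis j 1) q)" for j
    by (rule submfd.tfield_chart_vec[OF submfd_self[OF N] W \<phi>'(1) _ smooth_fun_const]) auto
  have A: "smooth_fun N ?W (?A j)" for j by (rule smooth_conn_mat[OF D \<psi>'(1) e]) auto
  have sY: "smooth_fun N ?W (\<lambda>q. Y q \<phi>)" by (rule smooth_fun_subset[OF tfield_smooth[OF Y \<phi>'(1)]]) auto
  have sYj: "smooth_fun N ?W (\<lambda>q. Y q \<phi> $ j)" for j by (rule smooth_fun_vec_nth[OF N W sY])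
  have "dd N p x (\<lambda>q. conn_mat D \<psi> q (Y q)) = dd N p x (\<lambda>q. \<Sum>j\<in>UNIV. Y q \<phi> $ j *\<^sub>R ?A j q)"
  proof (rule dd_cong[OF N W pW])
    fix q assume q: "q \<in> ?W"
    show "conn_mat D \<psi> q (Y q) = (\<Sum>j\<in>UNIV. Y q \<phi> $ j *\<^sub>R ?A j q)"
      by (rule conn_mat_axis_sum[OF D charts_atI[OF \<psi>'(1)] charts_atI[OF \<phi>'(1)] tfield_tspace[OF Y]]) (use q in auto)
  qed
  also have "\<dots> = (\<Sum>j\<in>UNIV. dd N p x (\<lambda>q. Y q \<phi> $ j *\<^sub>R ?A j q))"
    by (rule dd_sum[OF N W pW x]) (intro smooth_fun_scaleR[OF N W] sYj A)
  also have "\<dots> = (\<Sum>j\<in>UNIV. dd N p x (\<lambda>q. Y q \<phi>) $ j *\<^sub>R ?A j p + Y p \<phi> $ j *\<^sub>R dd N p x (?A j))"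
    by (simp add: dd_scaleR[OF N W pW x sYj A] dd_vec_nth[OF N W pW x sY])
  finally show ?thesis .
qed

text \<open>Cartan's formula \<open>dA(X, Y) = X (A Y) - Y (A X) - A [X, Y]\<close>: the derivatives
  of the components of \<open>X\<close> and \<open>Y\<close> are removed by the bracket
  term.\<close>

lemma curv_mat_eq:
  assumes D: "weyl_structure M c D" and \<psi>: "\<psi> \<in> charts_at M p" and \<phi>: "\<phi> \<in> charts_at N p" and p: "p \<in> V"
    and X: "tfield N N V X" and Y: "tfield N N V Y"
  shows "curv_mat D \<phi> \<psi> p (X p) (Y p)
    = dd N p (X p) (\<lambda>q. conn_mat D \<psi> q (Y q)) - dd N p (Y p) (\<lambda>q. conn_mat D \<psi> q (X q))
      - conn_mat D \<psi> p (bracket N X Y p)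
      + (conn_mat D \<psi> p (X p) ** conn_mat D \<psi> p (Y p) - conn_mat D \<psi> p (Y p) ** conn_mat D \<psi> p (X p))"
proof -
  have "bracket N X Y p \<phi> = dd N p (X p) (\<lambda>q. Y q \<phi>) - dd N p (Y p) (\<lambda>q. X q \<phi>)"
    using \<phi> by (simp add: bracket_def)
  then show ?thesis
    unfolding dd_conn_mat[OF D \<psi> \<phi> p Y tfield_tspace[OF X p]] dd_conn_mat[OF D \<psi> \<phi> p X tfield_tspace[OF Y p]]
      conn_mat_axis_sum[OF D \<psi> \<phi> bracket_tspace[OF N X Y p]] curv_mat_def
    by (simp add: sum.distrib sum_subtractf scaleR_left_diff_distrib)
qed

text \<open>With \<open>h\<close> the components of \<eta>, the second derivatives of
  \<open>h\<close> cancel by \<open>dd_bracket\<close> and the mixed terms \<open>A(X) Y h\<close>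
  and \<open>A(Y) X h\<close> cancel in pairs; only a matrix acting on \<open>h p\<close> survives.
  Normality of the result is seen from the third expression, which also enters the proof of
  skewness.\<close>

lemma curvature_chart_weighted:
  assumes D: "weyl_structure M c D" and \<psi>: "\<psi> \<in> charts_at M p" and \<phi>: "\<phi> \<in> charts_at N p" and p: "p \<in> V"
    and X: "tfield N N V X" and Y: "tfield N N V Y" and \<eta>: "wnormal_section N M c V \<eta>"
  shows "curvature N (wnormal_conn N M c D) X Y \<eta> p
      = chart_weighted M \<psi> (- 1) p (chart_vec M \<psi> (curv_mat D \<phi> \<psi> p (X p) (Y p) *v wcoord \<psi> \<eta> p) p)"
    and "chart_vec M \<psi> (curv_mat D \<phi> \<psi> p (X p) (Y p) *v wcoord \<psi> \<eta> p) p \<in> normal_space N M c p"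
    and "chart_vec M \<psi> (curv_mat D \<phi> \<psi> p (X p) (Y p) *v wcoord \<psi> \<eta> p) p
      = wcov D \<psi> p (X p) (wcoord \<psi> (\<lambda>q. wnormal_conn N M c D q (Y q) \<eta>))
        - wcov D \<psi> p (Y p) (wcoord \<psi> (\<lambda>q. wnormal_conn N M c D q (X q) \<eta>))
        - wcov D \<psi> p (bracket N X Y p) (wcoord \<psi> \<eta>)" (is "?K = ?u1 - ?u2 - ?u3")
proof -
  note \<psi>' = charts_atD[OF \<psi>] and V = wnormal_section_openin[OF \<eta>]
  note pN = openin_points[OF V p] and B = bracket_tspace[OF N X Y p]
  note tX = tfield_tspace[OF X] and tY = tfield_tspace[OF Y]
  let ?h = "wcoord \<psi> \<eta>" and ?U = "V \<inter> fst \<psi>"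
  let ?\<eta>X = "\<lambda>q. wnormal_conn N M c D q (X q) \<eta>" and ?\<eta>Y = "\<lambda>q. wnormal_conn N M c D q (Y q) \<eta>"
  have U: "openin (mtop N) ?U" by (rule openin_Int_chart_M[OF V \<psi>'(1)])
  have pU: "p \<in> ?U" using p \<psi>' by simp
  note XU = tfield_subset[OF X U Int_lower1] and YU = tfield_subset[OF Y U Int_lower1]
  note h = smooth_wcoord[OF \<eta> \<psi>'(1)]
  note \<eta>X = wnormal_section_conn[OF D \<eta> X] and \<eta>Y = wnormal_section_conn[OF D \<eta> Y]
  have n: "?u1 \<in> normal_space N M c p" "?u2 \<in> normal_space N M c p" "?u3 \<in> normal_space N M c p"
    by (rule wcov_normal[OF \<psi> pN])+
  have deriv: "dd N p z (wcoord \<psi> (\<lambda>q. wnormal_conn N M c D q (Z q) \<eta>))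
      = dd N p z (\<lambda>q. dd N q (Z q) ?h) + (dd N p z (\<lambda>q. conn_mat D \<psi> q (Z q)) *v ?h p + conn_mat D \<psi> p (Z p) *v dd N p z ?h)"
    if Z: "tfield N N V Z" and z: "z \<in> tspace N p" for Z z
  proof -
    note ZU = tfield_subset[OF Z U Int_lower1]
    note A = smooth_conn_mat[OF D \<psi>'(1) ZU Int_lower2]
    have "dd N p z (wcoord \<psi> (\<lambda>q. wnormal_conn N M c D q (Z q) \<eta>))
        = dd N p z (\<lambda>q. dd N q (Z q) ?h + conn_mat D \<psi> q (Z q) *v ?h q)"
      by (rule dd_cong[OF N U pU], rule wcoord_wnormal_conn_chart[OF D \<eta>])
         (auto intro: charts_atI[OF \<psi>'(1)] tfield_tspace[OF Z])
    also have "\<dots> = dd N p z (\<lambda>q. dd N q (Z q) ?h) + dd N p z (\<lambda>q. conn_mat D \<psi> q (Z q) *v ?h q)"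
      by (rule dd_add[OF N U pU z smooth_fun_dd[OF N ZU h] smooth_fun_matrix_vector_mult[OF N U A h]])
    also have "dd N p z (\<lambda>q. conn_mat D \<psi> q (Z q) *v ?h q)
        = dd N p z (\<lambda>q. conn_mat D \<psi> q (Z q)) *v ?h p + conn_mat D \<psi> p (Z p) *v dd N p z ?h"
      by (rule dd_matrix_vector_mult[OF N U pU z A h])
    finally show ?thesis .
  qed
  show K: "?K = ?u1 - ?u2 - ?u3"
  proof (rule tspace_eqI[OF chart_vec_tspace[OF M \<psi>] _ \<psi>])
    show "?u1 - ?u2 - ?u3 \<in> tspace M p" by (intro tspace_diff[OF M] normal_tspace n)
    show "?K \<psi> = (?u1 - ?u2 - ?u3) \<psi>"
      unfolding chart_vec_same[OF M \<psi>] minus_apply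
        wcov_chart[OF \<eta>X p \<psi> tY[OF p]] wcov_chart[OF \<eta>Y p \<psi> tX[OF p]] wcov_chart[OF \<eta> p \<psi> B]
        deriv[OF X tY[OF p]] deriv[OF Y tX[OF p]]
        wcoord_wnormal_conn_chart[OF D \<eta>, of p \<psi> X, OF p \<psi> tX[OF p]]
        wcoord_wnormal_conn_chart[OF D \<eta>, of p \<psi> Y, OF p \<psi> tY[OF p]]
        dd_bracket[OF N XU YU h pU] curv_mat_eq[OF D \<psi> \<phi> p X Y]
      by (simp add: matrix_vector_mult_add_rdistrib matrix_vector_mult_diff_rdistrib matrix_vector_right_distrib
          matrix_vector_mul_assoc algebra_simps)
  qed
  have "1 *\<^sub>R (1 *\<^sub>R ?u1 + (-1) *\<^sub>R ?u2) + (-1) *\<^sub>R ?u3 \<in> normal_space N M c p"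
    by (intro normal_lincomb[OF pN] n)
  moreover have "1 *\<^sub>R (1 *\<^sub>R ?u1 + (-1) *\<^sub>R ?u2) + (-1) *\<^sub>R ?u3 = ?u1 - ?u2 - ?u3" by simp
  ultimately show "?K \<in> normal_space N M c p" unfolding K by (simp only:)
  show "curvature N (wnormal_conn N M c D) X Y \<eta> p = chart_weighted M \<psi> (- 1) p ?K"
    unfolding curvature_def wnormal_conn_eq[OF D \<psi> \<eta>Y p tX[OF p]] wnormal_conn_eq[OF D \<psi> \<eta>X p tY[OF p]]
      wnormal_conn_eq[OF D \<psi> \<eta> p B] K chart_weighted_diff ..
qed

end

section \<open>The curvature as a two-form with values in skew endomorphisms of the normal
  bundle\<close>

context conf_submfd
begin

text \<open>The curvature and \<eta> scale by the same factor when the frame changes, so the matrix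
  acts on the value in every frame. This identifies endomorphisms of
  \<open>\<nu> \<otimes> L\<^sup>-\<^sup>1\<close> with endomorphisms of \<nu>.\<close>

lemma curvature_frame:
  assumes D: "weyl_structure M c D" and \<psi>: "\<psi> \<in> charts_at M p" and \<phi>: "\<phi> \<in> charts_at N p" and p: "p \<in> V"
    and X: "tfield N N V X" and Y: "tfield N N V Y" and \<eta>: "wnormal_section N M c V \<eta>" and f: "frame_at M p f"
  shows "curvature N (wnormal_conn N M c D) X Y \<eta> p f
    = chart_vec M \<psi> (curv_mat D \<phi> \<psi> p (X p) (Y p) *v \<eta> p f \<psi>) p"
proof -
  let ?r = "\<bar>det (frame_mat \<psi> f)\<bar> powr (- (- 1 / real CARD('m)))"
  have "\<eta> p f = ?r *\<^sub>R \<eta> p (chart_frame M \<psi> p)"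
    by (rule weighted_eq_chart_frame[OF M \<psi> wnormal_section_mem[OF \<eta> p] f])
  then have "\<eta> p f \<psi> = ?r *\<^sub>R wcoord \<psi> \<eta> p" by (simp only: wcoord_def scaleR_fun_def)
  then show ?thesis
    unfolding curvature_chart_weighted(1)[OF D \<psi> \<phi> p X Y \<eta>] chart_weighted_def
    by (simp only: f if_True chart_vec_scaleR[OF M \<psi>] matrix_vector_mult_scaleR)
qed

text \<open>The vector \<xi> is extended with constant components in the chart and then projected to
  the normal spaces; at \<open>p\<close> the projection changes nothing.\<close>

lemma wnormal_extension:
  assumes \<psi>: "\<psi> \<in> charts_at M p" and p: "p \<in> points N" and \<xi>: "\<xi> \<in> normal_space N M c p"
  defines "\<eta> \<equiv> \<lambda>q. chart_weighted M \<psi> (- 1) q (nor_part N M c q (chart_vec M \<psi> (\<xi> \<psi>) q))"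
  shows "wnormal_section N M c (points N \<inter> fst \<psi>) \<eta>" "\<eta> p (chart_frame M \<psi> p) = \<xi>"
proof -
  note \<psi>' = charts_atD[OF \<psi>]
  let ?U = "points N \<inter> fst \<psi>"
  have U: "openin (mtop N) ?U" by (rule openin_points_chart[OF \<psi>'(1)])
  have \<psi>q: "\<psi> \<in> charts_at M q" if "q \<in> ?U" for q using that \<psi>' by (intro charts_atI) auto
  show "\<eta> p (chart_frame M \<psi> p) = \<xi>"
    unfolding \<eta>_def chart_weighted_chart_frame[OF M \<psi>] chart_vec_eq[OF M \<psi> normal_tspace[OF \<xi>]]
    by (rule nor_part_normal[OF p \<xi>])
  show "wnormal_section N M c ?U \<eta>"
  proof (rule wnormal_sectionI[OF U])
    fix q assume q: "q \<in> ?U"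
    then have qN: "q \<in> points N" by simp
    show "\<eta> q \<in> weighted M (- 1) q (normal_space N M c q)"
      unfolding \<eta>_def
      by (rule chart_weighted_mem[OF M \<psi>q[OF q] normal_scaleR[OF qN splitting(2)[OF qN chart_vec_tspace[OF M \<psi>q[OF q]]]]])
    have "wcoord \<psi> \<eta> r = nor_mat \<psi> r *v \<xi> \<psi>" if r: "r \<in> ?U" for r
      using nor_part_nor_mat[OF \<psi>q[OF r] openin_points[OF U r] chart_vec_tspace[OF M \<psi>q[OF r]], of "\<xi> \<psi>"]
      unfolding wcoord_def \<eta>_def chart_weighted_chart_frame[OF M \<psi>q[OF r]] chart_vec_same[OF M \<psi>q[OF r]] .
    moreover have "smooth_fun N ?U (\<lambda>r. nor_mat \<psi> r *v \<xi> \<psi>)"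
      by (intro smooth_fun_matrix_vector_mult[OF N U] smooth_nor_mat[OF \<psi>'(1)] smooth_fun_const)
    ultimately have "smooth_fun N ?U (wcoord \<psi> \<eta>)"
      using smooth_fun_cong[OF N U, of "wcoord \<psi> \<eta>" "\<lambda>r. nor_mat \<psi> r *v \<xi> \<psi>"] by blast
    then show "\<exists>\<psi> W. \<psi> \<in> charts_at M q \<and> openin (mtop N) W \<and> q \<in> W \<and> W \<subseteq> fst \<psi> \<and> smooth_fun N W (wcoord \<psi> \<eta>)"
      using \<psi>q[OF q] U q by blast
  qed
qed

lemma wnormal_section_subset:
  assumes "wnormal_section N M c V \<eta>" "openin (mtop N) W" "W \<subseteq> V"
  shows "wnormal_section N M c W \<eta>"
  using assms unfolding wnormal_section_def by blast

text \<open>Realises vectors given at one point by sections on a common open set, so that pointwise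
  identities can be obtained from the curvature of sections.\<close>

lemma extension:
  assumes \<psi>: "\<psi> \<in> charts_at M p" and \<phi>: "\<phi> \<in> charts_at N p" and x: "x \<in> tspace N p" and y: "y \<in> tspace N p"
    and \<xi>: "\<xi> \<in> normal_space N M c p" and \<zeta>: "\<zeta> \<in> normal_space N M c p"
  obtains V X Y \<eta> \<theta> where "p \<in> V" "tfield N N V X" "tfield N N V Y" "wnormal_section N M c V \<eta>" "wnormal_section N M c V \<theta>"
    "X p = x" "Y p = y" "\<eta> p (chart_frame M \<psi> p) = \<xi>" "\<theta> p (chart_frame M \<psi> p) = \<zeta>"
proof -
  note \<psi>' = charts_atD[OF \<psi>] and \<phi>' = charts_atD[OF \<phi>] and p = q_N[OF \<phi> \<psi>]
  let ?V = "points N \<inter> fst \<psi> \<inter> fst \<phi>"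
  have V: "openin (mtop N) ?V" by (rule openin_Int_chart[OF N \<phi>'(1) openin_points_chart[OF \<psi>'(1)]])
  have t: "tfield N N ?V (chart_vec N \<phi> a)" for a
    by (rule submfd.tfield_chart_vec[OF submfd_self[OF N] V \<phi>'(1) Int_lower2 smooth_fun_const])
  note e = wnormal_extension[OF \<psi> p \<xi>] and e' = wnormal_extension[OF \<psi> p \<zeta>]
  have "p \<in> ?V" using p \<psi>' \<phi>' by simp
  then show ?thesis
    by (rule that[OF _ t t wnormal_section_subset[OF e(1) V Int_lower1] wnormal_section_subset[OF e'(1) V Int_lower1]
        chart_vec_eq[OF N \<phi> x] chart_vec_eq[OF N \<phi> y] e(2) e'(2)])
qed

lemma c_sum_eq_0:
  assumes \<psi>: "\<psi> \<in> charts_at M p" and v: "v \<in> tspace M p" "w \<in> tspace M p" "v' \<in> tspace M p" "w' \<in> tspace M p"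
    and eq: "metric \<psi> p (v \<psi>) (w \<psi>) + metric \<psi> p (v' \<psi>) (w' \<psi>) = 0"
  shows "c p v w + c p v' w' = 0"
proof
  note P = charts_at_points[OF \<psi>]
  fix f
  show "(c p v w + c p v' w') f = 0 f"
  proof (cases "frame_at M p f")
    case True
    show ?thesis
      unfolding plus_fun_apply weighted_eq_chart_frame[OF M \<psi> c_mem[OF P v(1,2)] True]
        weighted_eq_chart_frame[OF M \<psi> c_mem[OF P v(3,4)] True] scaleR_add_right[symmetric]
        c_chart[OF \<psi> v(1,2)] c_chart[OF \<psi> v(3,4)] eq by simp
  next
    case False
    then show ?thesis using c_mem[OF P v(1,2)] c_mem[OF P v(3,4)] by (simp add: weighted_def)
  qed
qed

text \<open>The charts are picked separately at every point; \<open>normal_curvature_eq\<close>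
  replaces them by any others.\<close>

definition normal_curvature ::
    "('a, 'm, 'm) cderiv \<Rightarrow> 'a \<Rightarrow> ('a, 'n) tvec \<Rightarrow> ('a, 'n) tvec \<Rightarrow> ('a, 'm) tvec \<Rightarrow> ('a, 'm) tvec" where
  "normal_curvature D p x y \<xi> = (let \<phi> = SOME \<phi>. \<phi> \<in> charts_at N p; \<psi> = SOME \<psi>. \<psi> \<in> charts_at M p
     in chart_vec M \<psi> (curv_mat D \<phi> \<psi> p x y *v \<xi> \<psi>) p)"

context
  fixes D
  assumes D: "weyl_structure M c D"
begin

text \<open>Both pairs of charts compute the curvature of the same extending sections on the same
  frame, and that curvature mentions no chart.\<close>

lemma normal_curvature_eq:
  assumes \<psi>: "\<psi> \<in> charts_at M p" and \<phi>: "\<phi> \<in> charts_at N p" and x: "x \<in> tspace N p" and y: "y \<in> tspace N p"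
    and \<xi>: "\<xi> \<in> normal_space N M c p"
  shows "normal_curvature D p x y \<xi> = chart_vec M \<psi> (curv_mat D \<phi> \<psi> p x y *v \<xi> \<psi>) p"
proof -
  let ?\<phi> = "SOME \<phi>. \<phi> \<in> charts_at N p" and ?\<psi> = "SOME \<psi>. \<psi> \<in> charts_at M p"
  have \<phi>': "?\<phi> \<in> charts_at N p" by (rule someI[of "\<lambda>\<phi>. \<phi> \<in> charts_at N p", OF \<phi>])
  have \<psi>': "?\<psi> \<in> charts_at M p" by (rule someI[of "\<lambda>\<psi>. \<psi> \<in> charts_at M p", OF \<psi>])
  obtain V X Y \<eta> \<theta> where p: "p \<in> V" and *: "tfield N N V X" "tfield N N V Y" "wnormal_section N M c V \<eta>"
    and "wnormal_section N M c V \<theta>"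
    and v: "X p = x" "Y p = y" "\<eta> p (chart_frame M \<psi> p) = \<xi>" and "\<theta> p (chart_frame M \<psi> p) = \<xi>"
    by (rule extension[OF \<psi> \<phi> x y \<xi> \<xi>])
  note f = chart_frame_at[OF M \<psi>]
  show ?thesis
    unfolding normal_curvature_def Let_def
    using curvature_frame[OF D \<psi> \<phi> p * f] curvature_frame[OF D \<psi>' \<phi>' p * f] unfolding v by (simp only:)
qed

lemma normal_curvature_chart:
  assumes \<psi>: "\<psi> \<in> charts_at M p" and \<phi>: "\<phi> \<in> charts_at N p" and x: "x \<in> tspace N p" and y: "y \<in> tspace N p"
    and \<xi>: "\<xi> \<in> normal_space N M c p"
  shows "normal_curvature D p x y \<xi> \<psi> = curv_mat D \<phi> \<psi> p x y *v \<xi> \<psi>"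
  unfolding normal_curvature_eq[OF assms] chart_vec_same[OF M \<psi>] ..

lemma normal_curvature_normal:
  assumes p: "p \<in> points N" and x: "x \<in> tspace N p" and y: "y \<in> tspace N p" and \<xi>: "\<xi> \<in> normal_space N M c p"
  shows "normal_curvature D p x y \<xi> \<in> normal_space N M c p"
proof -
  obtain \<psi> where \<psi>: "\<psi> \<in> charts_at M p" using ex_chart_M[OF p] by blast
  obtain \<phi> where \<phi>: "\<phi> \<in> charts_at N p" using ex_chart_at[OF N p] by blast
  obtain V X Y \<eta> \<theta> where pV: "p \<in> V" and *: "tfield N N V X" "tfield N N V Y" "wnormal_section N M c V \<eta>"
    and "wnormal_section N M c V \<theta>"
    and v: "X p = x" "Y p = y" "\<eta> p (chart_frame M \<psi> p) = \<xi>" and "\<theta> p (chart_frame M \<psi> p) = \<xi>"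
    by (rule extension[OF \<psi> \<phi> x y \<xi> \<xi>])
  show ?thesis
    using curvature_chart_weighted(2)[OF D \<psi> \<phi> pV *] unfolding normal_curvature_eq[OF \<psi> \<phi> x y \<xi>] wcoord_def v .
qed

lemma curvature_normal_curvature:
  assumes p: "p \<in> V" and X: "tfield N N V X" and Y: "tfield N N V Y" and \<eta>: "wnormal_section N M c V \<eta>"
    and f: "frame_at M p f"
  shows "curvature N (wnormal_conn N M c D) X Y \<eta> p f = normal_curvature D p (X p) (Y p) (\<eta> p f)"
proof -
  note pN = openin_points[OF tfield_openin[OF X] p]
  obtain \<psi> where \<psi>: "\<psi> \<in> charts_at M p" using ex_chart_M[OF pN] by blast
  obtain \<phi> where \<phi>: "\<phi> \<in> charts_at N p" using ex_chart_at[OF N pN] by blast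
  show ?thesis
    unfolding curvature_frame[OF D \<psi> \<phi> p X Y \<eta> f]
      normal_curvature_eq[OF \<psi> \<phi> tfield_tspace[OF X p] tfield_tspace[OF Y p] weighted_frame_mem[OF wnormal_section_mem[OF \<eta> p] f]] ..
qed

text \<open>The weightless connection is metric: passing from the Christoffel matrix to
  \<open>weyl_mat\<close> absorbs the trace term of \<open>metric_compatible\<close>, and the normal
  projection is not felt in products with normal vectors.\<close>

lemma dd_metric:
  assumes \<eta>: "wnormal_section N M c V \<eta>" and \<theta>: "wnormal_section N M c V \<theta>" and p: "p \<in> V"
    and \<psi>: "\<psi> \<in> charts_at M p" and x: "x \<in> tspace N p"
  shows "dd N p x (\<lambda>q. metric \<psi> q (wcoord \<psi> \<eta> q) (wcoord \<psi> \<theta> q))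
    = metric \<psi> p (wcov D \<psi> p x (wcoord \<psi> \<eta>) \<psi>) (wcoord \<psi> \<theta> p)
      + metric \<psi> p (wcoord \<psi> \<eta> p) (wcov D \<psi> p x (wcoord \<psi> \<theta>) \<psi>)"
proof -
  note \<psi>' = charts_atD[OF \<psi>] and V = wnormal_section_openin[OF \<eta>]
  note pN = openin_points[OF V p]
  let ?U = "V \<inter> fst \<psi>" and ?h = "wcoord \<psi> \<eta>" and ?k = "wcoord \<psi> \<theta>" and ?u = "dincl N M p x"
  have U: "openin (mtop N) ?U" by (rule openin_Int_chart_M[OF V \<psi>'(1)])
  have pU: "p \<in> ?U" using p \<psi>' by simp
  note h = smooth_wcoord[OF \<eta> \<psi>'(1)] and k = smooth_wcoord[OF \<theta> \<psi>'(1)]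
  have g: "smooth_fun N ?U (gram \<psi>)"
    by (rule smooth_fun_restrict[OF U openin_chart[OF M \<psi>'(1)] smooth_gram[OF \<psi>'(1)]]) simp
  have dg: "dd N p x (gram \<psi>) = dd M p ?u (gram \<psi>)"
    by (rule dd_restrict[OF openin_chart[OF M \<psi>'(1)] smooth_gram[OF \<psi>'(1)] \<psi>'(2) pN x, symmetric])
  let ?\<Gamma> = "christoffel M D \<psi> p ?u" and ?B = "weyl_mat D \<psi> p x"
  have "?h p \<bullet> (dd M p ?u (gram \<psi>) *v ?k p)
      = metric \<psi> p (?\<Gamma> *v ?h p) (?k p) + metric \<psi> p (?h p) (?\<Gamma> *v ?k p) - 2 / real CARD('m) * trace ?\<Gamma> * metric \<psi> p (?h p) (?k p)"
    using metric_compatible[OF D \<psi> dincl_tspace[OF pN x], of "?h p" "?k p"] by simp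
  also have "\<dots> = metric \<psi> p (?B *v ?h p) (?k p) + metric \<psi> p (?h p) (?B *v ?k p)"
    by (simp add: weyl_mat_def matrix_vector_mult_diff_rdistrib scaleR_matrix_vector_assoc[symmetric] metric_simps)
  finally have mc: "?h p \<bullet> (dd M p ?u (gram \<psi>) *v ?k p) = \<dots>" .
  have n: "metric \<psi> p (wcov D \<psi> p x a \<psi>) (\<zeta> p (chart_frame M \<psi> p) \<psi>)
      = metric \<psi> p (dd N p x a + ?B *v a p) (\<zeta> p (chart_frame M \<psi> p) \<psi>)"
    if "wnormal_section N M c V \<zeta>" for a \<zeta>
    using nor_part_metric[OF \<psi> pN chart_vec_tspace[OF M \<psi>] wnormal_chart_frame[OF that p \<psi>]]
    unfolding wcov_def chart_vec_same[OF M \<psi>] .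
  have "dd N p x (\<lambda>q. metric \<psi> q (?h q) (?k q))
      = dd N p x ?h \<bullet> (gram \<psi> p *v ?k p) + ?h p \<bullet> (dd N p x (gram \<psi>) *v ?k p + gram \<psi> p *v dd N p x ?k)"
    unfolding metric_def dd_inner[OF N U pU x h smooth_fun_matrix_vector_mult[OF N U g k]]
      dd_matrix_vector_mult[OF N U pU x g k] ..
  also have "\<dots> = metric \<psi> p (dd N p x ?h) (?k p) + metric \<psi> p (?B *v ?h p) (?k p) + metric \<psi> p (?h p) (?B *v ?k p)
      + metric \<psi> p (?h p) (dd N p x ?k)"
    unfolding inner_add_right dg mc by (simp add: metric_def)
  also have "\<dots> = metric \<psi> p (wcov D \<psi> p x ?h \<psi>) (?k p) + metric \<psi> p (wcov D \<psi> p x ?k \<psi>) (?h p)"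
    using n[OF \<theta>, of ?h] n[OF \<eta>, of ?k] metric_sym[OF \<psi>, of "?h p"] by (simp add: wcoord_def metric_simps)
  finally show ?thesis using metric_sym[OF \<psi>, of "?h p"] by simp
qed

text \<open>The product of two sections is a real function, on which
  \<open>X Y - Y X - [X, Y]\<close> vanishes. Expanding this by \<open>dd_metric\<close> twice gives
  the sum of the two curvature terms.\<close>

lemma normal_curvature_skew:
  assumes \<psi>: "\<psi> \<in> charts_at M p" and p: "p \<in> points N" and x: "x \<in> tspace N p" and y: "y \<in> tspace N p"
    and \<xi>: "\<xi> \<in> normal_space N M c p" and \<zeta>: "\<zeta> \<in> normal_space N M c p"
  shows "metric \<psi> p (normal_curvature D p x y \<xi> \<psi>) (\<zeta> \<psi>) + metric \<psi> p (\<xi> \<psi>) (normal_curvature D p x y \<zeta> \<psi>) = 0"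
proof -
  obtain \<phi> where \<phi>: "\<phi> \<in> charts_at N p" using ex_chart_at[OF N p] by blast
  obtain V X Y \<eta> \<theta> where pV: "p \<in> V" and X: "tfield N N V X" and Y: "tfield N N V Y"
    and \<eta>: "wnormal_section N M c V \<eta>" and \<theta>: "wnormal_section N M c V \<theta>"
    and v: "X p = x" "Y p = y" "\<eta> p (chart_frame M \<psi> p) = \<xi>" "\<theta> p (chart_frame M \<psi> p) = \<zeta>"
    by (rule extension[OF \<psi> \<phi> x y \<xi> \<zeta>])
  note \<psi>' = charts_atD[OF \<psi>] and V = wnormal_section_openin[OF \<eta>] and B = bracket_tspace[OF N X Y pV]
  let ?U = "V \<inter> fst \<psi>"
  have U: "openin (mtop N) ?U" by (rule openin_Int_chart_M[OF V \<psi>'(1)])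
  have pU: "p \<in> ?U" using pV \<psi>' by simp
  note XU = tfield_subset[OF X U Int_lower1] and YU = tfield_subset[OF Y U Int_lower1]
  let ?C = "\<lambda>Z \<eta> q. wnormal_conn N M c D q (Z q) \<eta>"
  let ?g = "\<lambda>\<eta> \<theta> q. metric \<psi> q (wcoord \<psi> \<eta> q) (wcoord \<psi> \<theta> q)"
  have smg: "smooth_fun N ?U (?g \<eta> \<theta>)" if "wnormal_section N M c V \<eta>" "wnormal_section N M c V \<theta>" for \<eta> \<theta>
    unfolding metric_def
    by (intro smooth_fun_inner[OF N U] smooth_fun_matrix_vector_mult[OF N U] smooth_wcoord[OF that(1) \<psi>'(1)]
        smooth_wcoord[OF that(2) \<psi>'(1)]
        smooth_fun_restrict[OF U openin_chart[OF M \<psi>'(1)] smooth_gram[OF \<psi>'(1)]]) simp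
  have first: "dd N q (Z q) (?g \<eta> \<theta>) = ?g (?C Z \<eta>) \<theta> q + ?g \<eta> (?C Z \<theta>) q"
    if Z: "tfield N N V Z" and q: "q \<in> ?U" for Z q
  proof -
    have \<psi>q: "\<psi> \<in> charts_at M q" and qV: "q \<in> V" using q \<psi>' by (auto intro: charts_atI)
    show ?thesis
      unfolding dd_metric[OF \<eta> \<theta> qV \<psi>q tfield_tspace[OF Z qV]]
        wcoord_wnormal_conn[OF D \<eta> qV \<psi>q, where X = Z, OF tfield_tspace[OF Z qV]]
        wcoord_wnormal_conn[OF D \<theta> qV \<psi>q, where X = Z, OF tfield_tspace[OF Z qV]] ..
  qed
  let ?w = "\<lambda>x \<eta>. wcov D \<psi> p x (wcoord \<psi> \<eta>) \<psi>"
  have second: "dd N p z (\<lambda>q. dd N q (Z q) (?g \<eta> \<theta>))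
      = metric \<psi> p (?w z (?C Z \<eta>)) (wcoord \<psi> \<theta> p) + metric \<psi> p (?w (Z p) \<eta>) (?w z \<theta>)
        + (metric \<psi> p (?w z \<eta>) (?w (Z p) \<theta>) + metric \<psi> p (wcoord \<psi> \<eta> p) (?w z (?C Z \<theta>)))"
    if Z: "tfield N N V Z" and z: "z \<in> tspace N p" for Z z
  proof -
    note \<eta>Z = wnormal_section_conn[OF D \<eta> Z] and \<theta>Z = wnormal_section_conn[OF D \<theta> Z]
    have "dd N p z (\<lambda>q. dd N q (Z q) (?g \<eta> \<theta>)) = dd N p z (\<lambda>q. ?g (?C Z \<eta>) \<theta> q + ?g \<eta> (?C Z \<theta>) q)"
      by (rule dd_cong[OF N U pU first[OF Z]])
    also have "\<dots> = dd N p z (?g (?C Z \<eta>) \<theta>) + dd N p z (?g \<eta> (?C Z \<theta>))"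
      by (rule dd_add[OF N U pU z smg[OF \<eta>Z \<theta>] smg[OF \<eta> \<theta>Z]])
    finally show ?thesis
      unfolding dd_metric[OF \<eta>Z \<theta> pV \<psi> z] dd_metric[OF \<eta> \<theta>Z pV \<psi> z]
        wcoord_wnormal_conn[OF D \<eta> pV \<psi>, where X = Z, OF tfield_tspace[OF Z pV]]
        wcoord_wnormal_conn[OF D \<theta> pV \<psi>, where X = Z, OF tfield_tspace[OF Z pV]] .
  qed
  have K: "normal_curvature D p x y (\<beta> p (chart_frame M \<psi> p)) \<psi>
      = ?w x (?C Y \<beta>) - ?w y (?C X \<beta>) - ?w (bracket N X Y p) \<beta>"
    if \<beta>: "wnormal_section N M c V \<beta>" for \<beta>
    using fun_cong[OF curvature_chart_weighted(3)[OF D \<psi> \<phi> pV X Y \<beta>], of \<psi>]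
      normal_curvature_eq[OF \<psi> \<phi> x y wnormal_chart_frame[OF \<beta> pV \<psi>]]
    unfolding wcoord_def[of \<psi> \<beta> p] v minus_apply by (simp only:)
  have "dd N p (bracket N X Y p) (?g \<eta> \<theta>)
      = dd N p x (\<lambda>q. dd N q (Y q) (?g \<eta> \<theta>)) - dd N p y (\<lambda>q. dd N q (X q) (?g \<eta> \<theta>))"
    using dd_bracket[OF N XU YU smg[OF \<eta> \<theta>] pU] unfolding v .
  \<comment> \<open>The products of a first derivative of \<eta> with a first derivative of \<theta>
    are symmetric in \<open>x\<close> and \<open>y\<close>, hence drop out of the
    difference.\<close>
  then show ?thesis
    using K[OF \<eta>] K[OF \<theta>]
    unfolding dd_metric[OF \<eta> \<theta> pV \<psi> B] second[OF Y x] second[OF X y] v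
    by (simp add: metric_simps wcoord_def v)
qed

lemma curv_mat_swap: "curv_mat D \<phi> \<psi> p x y = - curv_mat D \<phi> \<psi> p y x"
  unfolding curv_mat_def by (simp add: sum_subtractf)

lemma curv_mat_lincomb:
  assumes \<psi>: "\<psi> \<in> charts_at M p" and \<phi>: "\<phi> \<in> charts_at N p" and x: "x \<in> tspace N p" "z \<in> tspace N p"
  shows "curv_mat D \<phi> \<psi> p (a *\<^sub>R x + b *\<^sub>R z) y = a *\<^sub>R curv_mat D \<phi> \<psi> p x y + b *\<^sub>R curv_mat D \<phi> \<psi> p z y"
proof -
  note \<psi>' = charts_atD[OF \<psi>] and \<phi>' = charts_atD[OF \<phi>] and p = q_N[OF \<phi> \<psi>]
  let ?W = "points N \<inter> fst \<psi> \<inter> fst \<phi>" and ?A = "\<lambda>j q. conn_mat D \<psi> q (chart_vec N \<phi> (axis j 1) q)"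
  have W: "openin (mtop N) ?W" by (rule openin_Int_chart[OF N \<phi>'(1) openin_points_chart[OF \<psi>'(1)]])
  have pW: "p \<in> ?W" using p \<psi>' \<phi>' by simp
  have e: "tfield N N ?W (\<lambda>q. chart_vec N \<phi> (axis j 1) q)" for j
    by (rule submfd.tfield_chart_vec[OF submfd_self[OF N] W \<phi>'(1) Int_lower2 smooth_fun_const])
  have A: "smooth_fun N ?W (?A j)" for j by (rule smooth_conn_mat[OF D \<psi>'(1) e]) auto
  have mm: "(a *\<^sub>R B + b *\<^sub>R C) ** E = a *\<^sub>R (B ** E) + b *\<^sub>R (C ** E)"
    "E ** (a *\<^sub>R B + b *\<^sub>R C) = a *\<^sub>R (E ** B) + b *\<^sub>R (E ** C)" for B C E :: "real^'m^'m"
    by (simp_all add: matrix_matrix_mult_def vec_eq_iff sum.distrib sum_distrib_left algebra_simps)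
  show ?thesis
    unfolding curv_mat_def conn_mat_lincomb[OF D \<psi> p x] dd_lincomb[OF N W pW A x] mm
    unfolding plus_fun_apply scaleR_fun_def vector_add_component vector_scaleR_component
    by (simp add: sum.distrib sum_subtractf scaleR_sum_right algebra_simps)
qed

lemma normal_curvature_swap:
  assumes p: "p \<in> points N" and x: "x \<in> tspace N p" and y: "y \<in> tspace N p" and \<xi>: "\<xi> \<in> normal_space N M c p"
  shows "normal_curvature D p x y \<xi> = - normal_curvature D p y x \<xi>"
proof -
  obtain \<psi> where \<psi>: "\<psi> \<in> charts_at M p" using ex_chart_M[OF p] by blast
  obtain \<phi> where \<phi>: "\<phi> \<in> charts_at N p" using ex_chart_at[OF N p] by blast
  note n = normal_tspace[OF normal_curvature_normal[OF p _ _ \<xi>]]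
  have "normal_curvature D p x y \<xi> \<psi> = (- normal_curvature D p y x \<xi>) \<psi>"
    unfolding uminus_apply normal_curvature_chart[OF \<psi> \<phi> x y \<xi>] normal_curvature_chart[OF \<psi> \<phi> y x \<xi>]
    by (subst curv_mat_swap) (simp add: matrix_vector_mult_def vec_eq_iff sum_negf)
  then show ?thesis by (rule tspace_eqI[OF n[OF x y] tspace_minus[OF M n[OF y x]] \<psi>])
qed

lemma normal_curvature_lincomb_left:
  assumes p: "p \<in> points N" and x: "x \<in> tspace N p" and z: "z \<in> tspace N p" and y: "y \<in> tspace N p"
    and \<xi>: "\<xi> \<in> normal_space N M c p"
  shows "normal_curvature D p (a *\<^sub>R x + b *\<^sub>R z) y \<xi> = a *\<^sub>R normal_curvature D p x y \<xi> + b *\<^sub>R normal_curvature D p z y \<xi>"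
proof -
  obtain \<psi> where \<psi>: "\<psi> \<in> charts_at M p" using ex_chart_M[OF p] by blast
  obtain \<phi> where \<phi>: "\<phi> \<in> charts_at N p" using ex_chart_at[OF N p] by blast
  have xz: "a *\<^sub>R x + b *\<^sub>R z \<in> tspace N p" by (intro tspace_add[OF N] tspace_scaleR[OF N] x z)
  note n = normal_tspace[OF normal_curvature_normal[OF p _ y \<xi>]]
  have "normal_curvature D p (a *\<^sub>R x + b *\<^sub>R z) y \<xi> \<psi> = (a *\<^sub>R normal_curvature D p x y \<xi> + b *\<^sub>R normal_curvature D p z y \<xi>) \<psi>"
    unfolding plus_fun_apply scaleR_fun_def[of _ "normal_curvature _ _ _ _ _"] normal_curvature_chart[OF \<psi> \<phi> xz y \<xi>]
      normal_curvature_chart[OF \<psi> \<phi> x y \<xi>] normal_curvature_chart[OF \<psi> \<phi> z y \<xi>] curv_mat_lincomb[OF \<psi> \<phi> x z]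
    by (simp add: matrix_vector_mult_add_rdistrib scaleR_matrix_vector_assoc)
  then show ?thesis
    by (rule tspace_eqI[OF n[OF xz] tspace_add[OF M tspace_scaleR[OF M n[OF x]] tspace_scaleR[OF M n[OF z]]] \<psi>])
qed

lemma normal_curvature_lincomb_right:
  assumes p: "p \<in> points N" and x: "x \<in> tspace N p" and y: "y \<in> tspace N p"
    and \<xi>: "\<xi> \<in> normal_space N M c p" and \<zeta>: "\<zeta> \<in> normal_space N M c p"
  shows "normal_curvature D p x y (a *\<^sub>R \<xi> + b *\<^sub>R \<zeta>) = a *\<^sub>R normal_curvature D p x y \<xi> + b *\<^sub>R normal_curvature D p x y \<zeta>"
proof -
  obtain \<psi> where \<psi>: "\<psi> \<in> charts_at M p" using ex_chart_M[OF p] by blast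
  obtain \<phi> where \<phi>: "\<phi> \<in> charts_at N p" using ex_chart_at[OF N p] by blast
  note l = normal_lincomb[OF p \<xi> \<zeta>, of a b]
  note n = normal_tspace[OF normal_curvature_normal[OF p x y]]
  have "normal_curvature D p x y (a *\<^sub>R \<xi> + b *\<^sub>R \<zeta>) \<psi> = (a *\<^sub>R normal_curvature D p x y \<xi> + b *\<^sub>R normal_curvature D p x y \<zeta>) \<psi>"
    unfolding plus_fun_apply[of _ _ \<psi>] scaleR_fun_def normal_curvature_chart[OF \<psi> \<phi> x y l, unfolded scaleR_fun_def]
      normal_curvature_chart[OF \<psi> \<phi> x y \<xi>] normal_curvature_chart[OF \<psi> \<phi> x y \<zeta>]
    by (simp add: matrix_vector_right_distrib matrix_vector_mult_scaleR)
  then show ?thesis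
    by (rule tspace_eqI[OF n[OF l] tspace_add[OF M tspace_scaleR[OF M n[OF \<xi>]] tspace_scaleR[OF M n[OF \<zeta>]]] \<psi>])
qed

text \<open>The charts chosen inside \<open>normal_curvature\<close> may jump from point to point;
  near each point they are replaced by one fixed pair, in which the formula is smooth.\<close>

lemma normal_section_normal_curvature:
  assumes X: "tfield N N V X" and Y: "tfield N N V Y" and \<xi>: "normal_section N M c V \<xi>"
  shows "normal_section N M c V (\<lambda>q. normal_curvature D q (X q) (Y q) (\<xi> q))"
proof -
  note V = tfield_openin[OF X]
  have t: "tfield N M V \<xi>" and n: "\<And>q. q \<in> V \<Longrightarrow> \<xi> q \<in> normal_space N M c q"
    using \<xi> by (auto simp: normal_section_def)
  have nc: "normal_curvature D q (X q) (Y q) (\<xi> q) \<in> normal_space N M c q" if "q \<in> V" for q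
    by (rule normal_curvature_normal[OF openin_points[OF V that] tfield_tspace[OF X that] tfield_tspace[OF Y that] n[OF that]])
  have "tfield N M V (\<lambda>q. normal_curvature D q (X q) (Y q) (\<xi> q))"
  proof (rule tfield_local[OF V])
    fix p assume p: "p \<in> V"
    note pN = openin_points[OF V p]
    obtain \<psi> where \<psi>: "\<psi> \<in> charts_at M p" using ex_chart_M[OF pN] by blast
    obtain \<phi> where \<phi>: "\<phi> \<in> charts_at N p" using ex_chart_at[OF N pN] by blast
    note \<psi>' = charts_atD[OF \<psi>] and \<phi>' = charts_atD[OF \<phi>]
    let ?W = "V \<inter> fst \<psi> \<inter> fst \<phi>" and ?A = "\<lambda>j q. conn_mat D \<psi> q (chart_vec N \<phi> (axis j 1) q)"
    have W: "openin (mtop N) ?W" by (intro openin_Int_chart[OF N \<phi>'(1)] openin_Int_chart_M[OF V \<psi>'(1)])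
    have WV: "?W \<subseteq> V" by auto
    note XW = tfield_subset[OF X W WV] and YW = tfield_subset[OF Y W WV]
    have sX: "smooth_fun N ?W (\<lambda>q. Z q \<phi>)" if "tfield N N ?W Z" for Z
      by (rule smooth_fun_subset[OF tfield_smooth[OF that \<phi>'(1)]]) auto
    have e: "tfield N N ?W (\<lambda>q. chart_vec N \<phi> (axis j 1) q)" for j
      by (rule submfd.tfield_chart_vec[OF submfd_self[OF N] W \<phi>'(1) _ smooth_fun_const]) auto
    have A: "smooth_fun N ?W (?A j)" for j by (rule smooth_conn_mat[OF D \<psi>'(1) e]) auto
    have AZ: "smooth_fun N ?W (\<lambda>q. conn_mat D \<psi> q (Z q))" if "tfield N N ?W Z" for Z
      by (rule smooth_conn_mat[OF D \<psi>'(1) that]) auto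
    have R: "smooth_fun N ?W (\<lambda>q. curv_mat D \<phi> \<psi> q (X q) (Y q))"
      unfolding curv_mat_def
      by (intro smooth_fun_add[OF N W] smooth_fun_sum[OF N W] smooth_fun_diff[OF N W] smooth_fun_scaleR[OF N W]
          smooth_fun_vec_nth[OF N W] sX XW YW smooth_fun_dd[OF N XW] smooth_fun_dd[OF N YW] A
          smooth_fun_matrix_mult[OF N W] AZ)
    have s: "smooth_fun N ?W (\<lambda>q. \<xi> q \<psi>)" by (rule smooth_fun_subset[OF tfield_smooth[OF t \<psi>'(1)]]) auto
    have "tfield N M ?W (\<lambda>q. chart_vec M \<psi> (curv_mat D \<phi> \<psi> q (X q) (Y q) *v \<xi> q \<psi>) q)"
      by (rule tfield_chart_vec[OF W \<psi>'(1) _ smooth_fun_matrix_vector_mult[OF N W R s]]) auto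
    moreover have "chart_vec M \<psi> (curv_mat D \<phi> \<psi> q (X q) (Y q) *v \<xi> q \<psi>) q = normal_curvature D q (X q) (Y q) (\<xi> q)"
      if q: "q \<in> ?W" for q
    proof -
      have "\<psi> \<in> charts_at M q" "\<phi> \<in> charts_at N q" "q \<in> V" using q \<psi>' \<phi>' by (auto intro: charts_atI)
      then show ?thesis
        using normal_curvature_eq[OF _ _ tfield_tspace[OF X] tfield_tspace[OF Y] n, of \<psi> q \<phi>] by simp
    qed
    ultimately have "tfield N M ?W (\<lambda>q. normal_curvature D q (X q) (Y q) (\<xi> q))" by (rule tfield_eq_on)
    then show "\<exists>W. p \<in> W \<and> W \<subseteq> V \<and> tfield N M W (\<lambda>q. normal_curvature D q (X q) (Y q) (\<xi> q))"
      using p \<psi>' \<phi>' by (intro exI[of _ ?W]) auto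
  qed
  then show ?thesis unfolding normal_section_def using nc by blast
qed

lemma skew_normal_two_form_curvature: "skew_normal_two_form N M c (normal_curvature D)"
  unfolding skew_normal_two_form_def
proof (intro conjI ballI allI impI; (elim conjE)?)
  fix p x y \<xi> assume p: "p \<in> points N" and x: "x \<in> tspace N p" and y: "y \<in> tspace N p"
    and \<xi>: "\<xi> \<in> normal_space N M c p"
  show "normal_curvature D p x y \<xi> \<in> normal_space N M c p" by (rule normal_curvature_normal[OF p x y \<xi>])
  show "normal_curvature D p x y \<xi> = - normal_curvature D p y x \<xi>" by (rule normal_curvature_swap[OF p x y \<xi>])
  show "normal_curvature D p (a *\<^sub>R x + b *\<^sub>R z) y \<xi> = a *\<^sub>R normal_curvature D p x y \<xi> + b *\<^sub>R normal_curvature D p z y \<xi>"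
    if "z \<in> tspace N p" for z a b
    by (rule normal_curvature_lincomb_left[OF p x that y \<xi>])
  fix \<zeta> assume \<zeta>: "\<zeta> \<in> normal_space N M c p"
  show "normal_curvature D p x y (a *\<^sub>R \<xi> + b *\<^sub>R \<zeta>) = a *\<^sub>R normal_curvature D p x y \<xi> + b *\<^sub>R normal_curvature D p x y \<zeta>" for a b
    by (rule normal_curvature_lincomb_right[OF p x y \<xi> \<zeta>])
  obtain \<psi> where \<psi>: "\<psi> \<in> charts_at M p" using ex_chart_M[OF p] by blast
  show "c p (normal_curvature D p x y \<xi>) \<zeta> + c p \<xi> (normal_curvature D p x y \<zeta>) = 0"
    by (rule c_sum_eq_0[OF \<psi> normal_tspace[OF normal_curvature_normal[OF p x y \<xi>]] normal_tspace[OF \<zeta>]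
        normal_tspace[OF \<xi>] normal_tspace[OF normal_curvature_normal[OF p x y \<zeta>]] normal_curvature_skew[OF \<psi> p x y \<xi> \<zeta>]])
next
  fix V X Y \<xi> assume "tfield N N V X" "tfield N N V Y" "normal_section N M c V \<xi>"
  then show "normal_section N M c V (\<lambda>q. normal_curvature D q (X q) (Y q) (\<xi> q))"
    by (rule normal_section_normal_curvature)
qed

end

text \<open>The inner derivatives for \<open>D\<close> and \<open>D'\<close> are known to agree at
  points of \<open>V\<close>. Besides exchanging the outer connection, it must be seen that the
  outer derivative depends only on values in \<open>V\<close>; in the chart this is
  \<open>dd_cong\<close>.\<close>

lemma curvature_independent:
  assumes D: "weyl_structure M c D" and D': "weyl_structure M c D'"
    and p: "p \<in> V" and X: "tfield N N V X" and Y: "tfield N N V Y" and \<eta>: "wnormal_section N M c V \<eta>"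
  shows "curvature N (wnormal_conn N M c D) X Y \<eta> p = curvature N (wnormal_conn N M c D') X Y \<eta> p"
proof -
  note V = tfield_openin[OF X]
  note pN = openin_points[OF V p]
  obtain \<psi> where \<psi>: "\<psi> \<in> charts_at M p" using ex_chart_M[OF pN] by blast
  have "wnormal_conn N M c D p z (\<lambda>q. wnormal_conn N M c D q (Z q) \<eta>)
      = wnormal_conn N M c D' p z (\<lambda>q. wnormal_conn N M c D' q (Z q) \<eta>)"
    if Z: "tfield N N V Z" and z: "z \<in> tspace N p" for Z z
  proof -
    note s = wnormal_section_conn[OF D \<eta> Z] and s' = wnormal_section_conn[OF D' \<eta> Z]
    have eq: "wnormal_conn N M c D q (Z q) \<eta> = wnormal_conn N M c D' q (Z q) \<eta>" if "q \<in> V" for q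
      by (rule wnormal_conn_independent[OF D D' \<eta> that tfield_tspace[OF Z that]])
    have "wnormal_conn N M c D p z (\<lambda>q. wnormal_conn N M c D q (Z q) \<eta>) = wnormal_conn N M c D' p z (\<lambda>q. wnormal_conn N M c D q (Z q) \<eta>)"
      by (rule wnormal_conn_independent[OF D D' s p z])
    also have "\<dots> = wnormal_conn N M c D' p z (\<lambda>q. wnormal_conn N M c D' q (Z q) \<eta>)"
    proof -
      have w: "wcoord \<psi> (\<lambda>q. wnormal_conn N M c D q (Z q) \<eta>) q = wcoord \<psi> (\<lambda>q. wnormal_conn N M c D' q (Z q) \<eta>) q" if "q \<in> V" for q
        using eq[OF that] by (simp add: wcoord_def)
      then have "dd N p z (wcoord \<psi> (\<lambda>q. wnormal_conn N M c D q (Z q) \<eta>)) = dd N p z (wcoord \<psi> (\<lambda>q. wnormal_conn N M c D' q (Z q) \<eta>))"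
        by (rule dd_cong[OF N V p])
      then show ?thesis
        unfolding wnormal_conn_eq[OF D' \<psi> s p z] wnormal_conn_eq[OF D' \<psi> s' p z] wcov_def w[OF p] by (simp only:)
    qed
    finally show ?thesis .
  qed
  then show ?thesis
    unfolding curvature_def
    using X Y tfield_tspace[OF X p] tfield_tspace[OF Y p] wnormal_conn_independent[OF D D' \<eta> p bracket_tspace[OF N X Y p]]
    by (simp only:)
qed

lemma normal_space_zero:
  assumes p: "p \<in> points N"
  shows "0 \<in> normal_space N M c p"
proof -
  obtain \<psi> where \<psi>: "\<psi> \<in> charts_at M p" using ex_chart_M[OF p] by blast
  show ?thesis
    using normal_scaleR[OF p splitting(2)[OF p chart_vec_tspace[OF M \<psi>]], of 0 0] by (simp only: scaleR_zero_left)
qed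

text \<open>Serves when no Weyl structure exists: the condition on curvatures is then vacuous, but a
  form must still be exhibited.\<close>

lemma skew_normal_two_form_zero: "skew_normal_two_form N M c (\<lambda>p x y \<xi>. 0)"
  unfolding skew_normal_two_form_def
proof (intro conjI ballI allI impI; (elim conjE)?)
  fix p \<xi> assume p: "p \<in> points N" and \<xi>: "\<xi> \<in> normal_space N M c p"
  show 0: "0 \<in> normal_space N M c p" by (rule normal_space_zero[OF p])
  obtain \<psi> where \<psi>: "\<psi> \<in> charts_at M p" using ex_chart_M[OF p] by blast
  fix \<zeta> assume \<zeta>: "\<zeta> \<in> normal_space N M c p"
  show "c p 0 \<zeta> + c p \<xi> 0 = 0"
    by (rule c_sum_eq_0[OF \<psi> normal_tspace[OF 0] normal_tspace[OF \<zeta>] normal_tspace[OF \<xi>] normal_tspace[OF 0]])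
       (simp add: metric_def)
next
  fix V X Y \<xi> assume X: "tfield N N V X" and \<xi>: "normal_section N M c V \<xi>"
  have z: "0 \<in> normal_space N M c q" if "q \<in> V" for q
    by (rule normal_space_zero[OF openin_points[OF tfield_openin[OF X] that]])
  have "tfield N M V (\<lambda>q. 0)"
    by (rule tfieldI[OF tfield_openin[OF X] normal_tspace[OF z]]) (simp_all add: smooth_fun_const)
  then show "normal_section N M c V (\<lambda>q. 0)" using z by (simp add: normal_section_def)
qed simp_all

end

theorem proposition4p15:
  fixes M :: "('a, 'm::finite) mfd"
    and N :: "('a, 'n::finite) mfd"
    and c :: "('a, 'm) conf"
  assumes "manifold M"
    and "conformal_structure M c"
    and "submanifold N M"
  shows
    "(\<forall>D D'. weyl_structure M c D \<and> weyl_structure M c D' \<and>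
        (\<forall>V Y. tfield N N V Y \<longrightarrow> (\<forall>p\<in>V. \<forall>x\<in>tspace N p.
           induced_weyl N M c D p x Y = induced_weyl N M c D' p x Y)) \<longrightarrow>
        (\<forall>V \<xi>. normal_section N M c V \<xi> \<longrightarrow> (\<forall>p\<in>V. \<forall>x\<in>tspace N p.
           normal_conn N M c D p x \<xi> = normal_conn N M c D' p x \<xi>))) \<and>
     (\<forall>D D'. weyl_structure M c D \<and> weyl_structure M c D' \<longrightarrow>
        (\<forall>V \<eta>. wnormal_section N M c V \<eta> \<longrightarrow> (\<forall>p\<in>V. \<forall>x\<in>tspace N p.
           wnormal_conn N M c D p x \<eta> = wnormal_conn N M c D' p x \<eta>))) \<and>
     (\<exists>\<kappa>. skew_normal_two_form N M c \<kappa> \<and>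
        (\<forall>D. weyl_structure M c D \<longrightarrow>
           (\<forall>V X Y \<eta>. tfield N N V X \<and> tfield N N V Y \<and> wnormal_section N M c V \<eta> \<longrightarrow>
              (\<forall>p\<in>V. \<forall>f. frame_at M p f \<longrightarrow>
                 curvature N (wnormal_conn N M c D) X Y \<eta> p f = \<kappa> p (X p) (Y p) (\<eta> p f)))))"
proof -
  interpret conf_submfd N M c
    using assms by unfold_locales
  show ?thesis
  proof (intro conjI)
    show "\<forall>D D'. weyl_structure M c D \<and> weyl_structure M c D' \<and>
        (\<forall>V Y. tfield N N V Y \<longrightarrow> (\<forall>p\<in>V. \<forall>x\<in>tspace N p.
           induced_weyl N M c D p x Y = induced_weyl N M c D' p x Y)) \<longrightarrow>
        (\<forall>V \<xi>. normal_section N M c V \<xi> \<longrightarrow> (\<forall>p\<in>V. \<forall>x\<in>tspace N p.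
           normal_conn N M c D p x \<xi> = normal_conn N M c D' p x \<xi>))"
    proof (intro allI impI ballI, elim conjE)
      fix D D' V \<xi> p x
      assume D: "weyl_structure M c D" and D': "weyl_structure M c D'"
        and eq: "\<forall>V Y. tfield N N V Y \<longrightarrow> (\<forall>p\<in>V. \<forall>x\<in>tspace N p.
           induced_weyl N M c D p x Y = induced_weyl N M c D' p x Y)"
        and \<xi>: "normal_section N M c V \<xi>" and p: "p \<in> V" and x: "x \<in> tspace N p"
      have "openin (mtop N) V" using \<xi> tfield_openin by (auto simp: normal_section_def)
      note pN = openin_points[OF this p]
      obtain \<psi> where \<psi>: "\<psi> \<in> charts_at M p" using ex_chart_M[OF pN] by blast
      have "trace_diff D D' \<psi> p x = 0"
        by (rule induced_weyl_eq_imp_trace_diff[OF D D' \<psi> pN x]) (use eq x in blast)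
      then show "normal_conn N M c D p x \<xi> = normal_conn N M c D' p x \<xi>"
        using normal_conn_difference[OF D D' \<psi> \<xi> p x] by (simp only: scaleR_zero_left add_0_right scaleR_one)
    qed
    show "\<forall>D D'. weyl_structure M c D \<and> weyl_structure M c D' \<longrightarrow>
        (\<forall>V \<eta>. wnormal_section N M c V \<eta> \<longrightarrow> (\<forall>p\<in>V. \<forall>x\<in>tspace N p.
           wnormal_conn N M c D p x \<eta> = wnormal_conn N M c D' p x \<eta>))"
      using wnormal_conn_independent by blast
    show "\<exists>\<kappa>. skew_normal_two_form N M c \<kappa> \<and>
        (\<forall>D. weyl_structure M c D \<longrightarrow>
           (\<forall>V X Y \<eta>. tfield N N V X \<and> tfield N N V Y \<and> wnormal_section N M c V \<eta> \<longrightarrow>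
              (\<forall>p\<in>V. \<forall>f. frame_at M p f \<longrightarrow>
                 curvature N (wnormal_conn N M c D) X Y \<eta> p f = \<kappa> p (X p) (Y p) (\<eta> p f))))"
    proof (cases "\<exists>D. weyl_structure M c D")
      case True
      then obtain D where D: "weyl_structure M c D" by blast
      \<comment> \<open>The form is built from one Weyl structure \<open>D\<close>, and independence
        of the curvature transfers it to every other \<open>D'\<close>.\<close>
      have "curvature N (wnormal_conn N M c D') X Y \<eta> p f = normal_curvature D p (X p) (Y p) (\<eta> p f)"
        if "weyl_structure M c D'" "tfield N N V X" "tfield N N V Y" "wnormal_section N M c V \<eta>" "p \<in> V" "frame_at M p f"
        for D' V X Y \<eta> p f
        unfolding curvature_independent[OF that(1) D that(5,2,3,4)]
        by (rule curvature_normal_curvature[OF D that(5,2,3,4,6)])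
      then show ?thesis using skew_normal_two_form_curvature[OF D] by blast
    next
      case False
      then show ?thesis using skew_normal_two_form_zero by blast
    qed
  qed
qed

end
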